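(* Let $k>1$ be an odd integer and let $q,r>2$ be coprime integers. Let $\mathbb{K}\subset\mathbb{R}$ be a real number field whose discriminant $d_{\mathbb{K}}$ is coprime to $qr$, and assume $\zeta(k)\notin\mathbb{K}$. For an integer $m>2$, let $\widehat{V}_k(m,\mathbb{K})$ be the $\mathbb{K}$-linear span of the numbers $1$ and $\zeta(k,a/m)$ for $1\le a<m$, $\gcd(a,m)=1$. Then either $$\dim_{\mathbb{K}}\widehat{V}_k(q,\mathbb{K})\ge\frac{\varphi(q)}{2}+2\quad\text{or}\quad\dim_{\mathbb{K}}\widehat{V}_k(r,\mathbb{K})\ge\frac{\varphi(r)}{2}+2.$$
   Context: For $0<x\le1$ and $\Re(s)>1$, the Hurwitz zeta function is $\zeta(s,x)=\sum_{n\ge0}(n+x)^{-s}$; $\zeta(s)=\zeta(s,1)$. $\varphi$ is Euler's totient function. *)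

theory Defs
  imports
    "HOL-Analysis.Analysis"
    "HOL-Algebra.Algebra"
    "HOL-Algebra.Algebraic_Closure_Type"
    "HOL-Number_Theory.Totient"
    "Jordan_Normal_Form.Determinant"
begin

section \<open>The Hurwitz zeta function\<close>

text \<open>Meaningful for \<open>0 < x \<le> 1\<close> and \<open>Re s > 1\<close>, where the series converges absolutely.\<close>

definition hurwitz_zeta :: "complex \<Rightarrow> real \<Rightarrow> complex" where
  "hurwitz_zeta s x = suminf (\<lambda>n. of_real (real n + x) powr (- s))"

definition riemann_zeta :: "complex \<Rightarrow> complex" where
  "riemann_zeta s = hurwitz_zeta s 1"

section \<open>Number fields and their discriminant\<close>

abbreviation complex_field :: "complex ring" where
  "complex_field \<equiv> ring_of_type_algebra"

definition number_field :: "complex set \<Rightarrow> bool" where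
  "number_field K \<longleftrightarrow> subfield K complex_field \<and> ring.finite_dimension complex_field \<rat> K"

definition ring_of_integers :: "complex set \<Rightarrow> complex set" where
  "ring_of_integers K = {x \<in> K. algebraic_int x}"

definition integral_basis :: "complex set \<Rightarrow> complex list \<Rightarrow> bool" where
  "integral_basis K bs \<longleftrightarrow> set bs \<subseteq> ring_of_integers K \<and>
     (\<forall>x \<in> ring_of_integers K. \<exists>!cs :: int list.
        length cs = length bs \<and> x = (\<Sum>i<length bs. of_int (cs ! i) * bs ! i))"

text \<open>Restricting to extensional functions makes two embeddings equal iff they agree on \<open>K\<close>.\<close>

definition embeddings :: "complex set \<Rightarrow> (complex \<Rightarrow> complex) set" where
  "embeddings K = Ring.ring_hom (complex_field\<lparr>carrier := K\<rparr>) complex_field \<inter> extensional K"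

text \<open>
  The discriminant is \<open>det (\<sigma>\<^sub>i b\<^sub>j)\<^sup>2\<close>, where \<open>\<sigma>\<^sub>1, \<dots>, \<sigma>\<^sub>n\<close> are the distinct embeddings of \<open>K\<close>
  into the complex numbers and \<open>b\<^sub>1, \<dots>, b\<^sub>n\<close> is an integral basis. It is a rational integer and
  independent of the enumeration of the embeddings and of the integral basis.
\<close>

definition number_field_discriminant :: "complex set \<Rightarrow> int" where
  "number_field_discriminant K = (THE d. \<exists>\<sigma>s bs.
     distinct \<sigma>s \<and> set \<sigma>s = embeddings K \<and> integral_basis K bs \<and>
     of_int d =
       (Determinant.det (Matrix.mat (length \<sigma>s) (length bs) (\<lambda>(i, j). (\<sigma>s ! i) (bs ! j))))\<^sup>2)"

section \<open>The extended Chowla--Milnor spaces\<close>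

definition chowla_milnor_space :: "nat \<Rightarrow> nat \<Rightarrow> complex set \<Rightarrow> complex set" where
  "chowla_milnor_space k m K = ring.Span complex_field K
     (1 # map (\<lambda>a. hurwitz_zeta (of_nat k) (real a / real m)) (filter (\<lambda>a. coprime a m) [1..<m]))"

end

theory Submission
  imports Defs "Jordan_Normal_Form.Char_Poly"
begin

text \<open>
  Put \<open>X\<^sub>a = \<zeta>(k, a/m) - \<zeta>(k, 1 - a/m)\<close> with \<open>a < m/2\<close> coprime to \<open>m\<close>. As \<open>k\<close> is odd, differentiating the
  partial fraction expansion of the cotangent gives \<open>X\<^sub>a = \<i> \<pi>\<^sup>k A(\<zeta>\<^sub>m\<^sup>a)\<close> with \<open>A\<close> over the rationals. If every prime
  divisor of \<open>m\<close> is unramified in \<open>K\<close>, the cyclotomic polynomial of order \<open>m\<close> stays irreducible over \<open>K\<close>, so a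
  \<open>K\<close>-linear relation between the \<open>X\<^sub>a\<close> can be conjugated so that its largest coefficient belongs to \<open>X\<^sub>1\<close>; since
  \<open>X\<^sub>1\<close> exceeds the sum of the absolute values of all the other \<open>X\<^sub>a\<close>, the relation is trivial.

  If both dimensions are at most \<open>\<phi>/2 + 1\<close>, the \<open>\<phi>/2 + 2\<close> elements \<open>1, \<zeta>(k), X\<^sub>a\<close> are dependent for \<open>q\<close> and for \<open>r\<close>:
  there are nonzero \<open>(c\<^sub>0, c\<^sub>1)\<close>, \<open>(d\<^sub>0, d\<^sub>1)\<close> over \<open>K\<close> such that \<open>c\<^sub>0 + c\<^sub>1 \<zeta>(k) = \<i> \<pi>\<^sup>k \<beta>\<close> and
  \<open>d\<^sub>0 + d\<^sub>1 \<zeta>(k) = \<i> \<pi>\<^sup>k \<delta>\<close> with \<open>\<beta> \<in> K(\<zeta>\<^sub>q)\<close> and \<open>\<delta> \<in> K(\<zeta>\<^sub>r)\<close>. Eliminating \<open>\<zeta>(k)\<close>, the transcendence of \<open>\<pi>\<close>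
  makes the pairs proportional, so \<open>\<beta>\<close> is a multiple of \<open>\<delta>\<close> by a factor in \<open>K\<close>. The automorphism of \<open>K(\<zeta>\<^sub>q\<^sub>r)\<close> over
  \<open>K\<close> that inverts \<open>\<zeta>\<^sub>q\<close> and fixes \<open>\<zeta>\<^sub>r\<close> shows that \<open>\<beta>\<close> is real, whence \<open>c\<^sub>0 + c\<^sub>1 \<zeta>(k)\<close> is both real and
  imaginary, that is, zero, contrary to the assumption on \<open>\<zeta>(k)\<close>.
\<close>

text \<open>No Galois group is ever formed. Conjugation is a transfer of zeros: a polynomial over K
  that vanishes at a primitive m-th root of unity vanishes at its b-th power for every b coprime to
  m (\<open>root_of_unity_conjugate\<close>). This statement serves both the independence of the X_a
  and the comparison of the conductors q and r. It is proved one prime power at a time, by playing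
  total ramification in the cyclotomic field against the absence of nilpotents modulo p, a property
  that survives adjoining roots of unity of order prime to p. The discriminant enters only through
  the trace form: if p does not divide its determinant, an integer of K whose traces against an
  integral basis are all divisible by p is itself divisible by p. That X_1 dominates comes from the
  term n = 1 of the sum of n^(-k): all terms with n > 1 together amount to at most 1/2. That zeta(k)
  lies in both spaces comes from the Euler product: removing the factors of the primes dividing m
  multiplies it by a nonzero rational number.\<close>

hide_const (open) up_ring.coeff up_ring.monom module.smult Polynomials.degree Coset.order Divisibility.prime

no_notation fps_nth (infixl \<open>$\<close> 75)

section \<open>Subrings and subfields of the complex numbers\<close>

text \<open>Subrings are bare sets of complex numbers, so that the integers, the rationals, the
  reals, the algebraic integers, the algebraic numbers, K and its extensions are instances of one
  locale, and polynomials over all of them share the type \<open>complex poly\<close>.\<close>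

locale complex_subring =
  fixes R :: "complex set"
  assumes one_closed [simp, intro]: "1 \<in> R"
    and diff_closed [simp, intro]: "x \<in> R \<Longrightarrow> y \<in> R \<Longrightarrow> x - y \<in> R"
    and mult_closed [simp, intro]: "x \<in> R \<Longrightarrow> y \<in> R \<Longrightarrow> x * y \<in> R"
begin

lemma zero_closed [simp, intro]: "0 \<in> R"
  using diff_closed[OF one_closed one_closed] by simp

lemma uminus_closed [simp, intro]: "x \<in> R \<Longrightarrow> - x \<in> R"
  using diff_closed[OF zero_closed, of x] by simp

lemma add_closed [simp, intro]: "x \<in> R \<Longrightarrow> y \<in> R \<Longrightarrow> x + y \<in> R"
  using diff_closed[of x "- y"] by simp

lemma of_nat_closed [simp, intro]: "of_nat n \<in> R"
  by (induction n) auto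

lemma of_int_closed [simp, intro]: "of_int n \<in> R"
  by (cases n) (auto simp del: of_nat_Suc)

lemma Ints_subset: "\<int> \<subseteq> R"
  by (auto elim!: Ints_cases)

lemma power_closed [simp, intro]: "x \<in> R \<Longrightarrow> x ^ n \<in> R"
  by (induction n) auto

lemma sum_closed [intro]: "(\<And>i. i \<in> I \<Longrightarrow> f i \<in> R) \<Longrightarrow> sum f I \<in> R"
  by (induction I rule: infinite_finite_induct) auto

lemma prod_closed [intro]: "(\<And>i. i \<in> I \<Longrightarrow> f i \<in> R) \<Longrightarrow> prod f I \<in> R"
  by (induction I rule: infinite_finite_induct) auto

end

definition polys_over :: "complex set \<Rightarrow> complex poly set" where
  "polys_over R = {p. \<forall>i. coeff p i \<in> R}"

lemma polys_overD: "p \<in> polys_over R \<Longrightarrow> coeff p i \<in> R"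
  by (simp add: polys_over_def)

lemma polys_over_mono: "R \<subseteq> S \<Longrightarrow> p \<in> polys_over R \<Longrightarrow> p \<in> polys_over S"
  by (auto simp: polys_over_def)

context complex_subring
begin

lemma polys_over_0 [simp, intro]: "0 \<in> polys_over R"
  and polys_over_1 [simp, intro]: "1 \<in> polys_over R"
  by (auto simp: polys_over_def coeff_1)

lemma polys_over_pCons [simp, intro]: "c \<in> R \<Longrightarrow> p \<in> polys_over R \<Longrightarrow> pCons c p \<in> polys_over R"
  by (auto simp: polys_over_def coeff_pCons split: nat.splits)

lemma polys_over_monom [simp, intro]: "c \<in> R \<Longrightarrow> monom c n \<in> polys_over R"
  by (auto simp: polys_over_def)

lemma polys_over_add [simp, intro]: "p \<in> polys_over R \<Longrightarrow> q \<in> polys_over R \<Longrightarrow> p + q \<in> polys_over R"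
  and polys_over_diff [simp, intro]: "p \<in> polys_over R \<Longrightarrow> q \<in> polys_over R \<Longrightarrow> p - q \<in> polys_over R"
  and polys_over_smult [simp, intro]: "c \<in> R \<Longrightarrow> p \<in> polys_over R \<Longrightarrow> smult c p \<in> polys_over R"
  by (auto simp: polys_over_def)

lemma polys_over_mult [simp, intro]: "p \<in> polys_over R \<Longrightarrow> q \<in> polys_over R \<Longrightarrow> p * q \<in> polys_over R"
  by (auto simp: polys_over_def coeff_mult)

lemma polys_over_power [simp, intro]: "p \<in> polys_over R \<Longrightarrow> p ^ n \<in> polys_over R"
  by (induction n) auto

lemma polys_over_sum [intro]: "(\<And>i. i \<in> I \<Longrightarrow> f i \<in> polys_over R) \<Longrightarrow> sum f I \<in> polys_over R"
  by (induction I rule: infinite_finite_induct) auto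

lemma polys_over_prod [intro]: "(\<And>i. i \<in> I \<Longrightarrow> f i \<in> polys_over R) \<Longrightarrow> prod f I \<in> polys_over R"
  by (induction I rule: infinite_finite_induct) auto

lemma polys_over_pderiv [simp, intro]: "p \<in> polys_over R \<Longrightarrow> pderiv p \<in> polys_over R"
  by (auto simp: polys_over_def coeff_pderiv simp del: of_nat_Suc)

lemma polys_over_pcompose [simp, intro]:
  assumes "p \<in> polys_over R" "q \<in> polys_over R"
  shows "pcompose p q \<in> polys_over R"
proof -
  have "\<forall>i. coeff p i \<in> R \<Longrightarrow> pcompose p q \<in> polys_over R" for p
  proof (induction p)
    case (pCons c p)
    have "\<forall>i. coeff p i \<in> R"
      using pCons.prems by (metis coeff_pCons_Suc)
    moreover have "c \<in> R"
      using pCons.prems by (metis coeff_pCons_0)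
    ultimately show ?case
      using pCons.IH assms(2) by (auto simp: pcompose_pCons)
  qed auto
  thus ?thesis
    using assms(1) by (auto simp: polys_over_def)
qed

lemma poly_closed [intro]: "p \<in> polys_over R \<Longrightarrow> x \<in> R \<Longrightarrow> poly p x \<in> R"
  by (auto simp: poly_altdef polys_over_def)

text \<open>Long division inverts nothing but the leading coefficient of the divisor; since this is
  1, all coefficients stay in the subring.\<close>

lemma polys_over_division:
  assumes "p \<in> polys_over R" "g \<in> polys_over R" "Polynomial.lead_coeff g = 1"
  obtains q r where "q \<in> polys_over R" "r \<in> polys_over R" "p = q * g + r" "r = 0 \<or> degree r < degree g"
proof -
  have "\<exists>q\<in>polys_over R. p - q * g \<in> polys_over R \<and> (p - q * g = 0 \<or> degree (p - q * g) < degree g)"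
    using assms(1)
  proof (induction "degree p" arbitrary: p rule: less_induct)
    case less
    show ?case
    proof (cases "p = 0 \<or> degree p < degree g")
      case True
      thus ?thesis using less.prems by (intro bexI[of _ 0]) auto
    next
      case False
      define m where "m = monom (Polynomial.lead_coeff p) (degree p - degree g)"
      define p' where "p' = p - m * g"
      have m: "m \<in> polys_over R"
        using less.prems by (auto simp: m_def polys_overD)
      have g0: "g \<noteq> 0" using assms(3) by auto
      have p': "p' \<in> polys_over R"
        using m less.prems assms(2) by (auto simp: p'_def)
      have m0: "m \<noteq> 0" using False by (simp add: m_def)
      have md: "degree m = degree p - degree g"
        using False by (simp add: m_def degree_monom_eq)
      have dm: "degree (m * g) = degree p"
        using False g0 m0 md by (simp add: degree_mult_eq)
      have "Polynomial.lead_coeff m = Polynomial.lead_coeff p"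
        using md by (simp add: m_def)
      hence "Polynomial.lead_coeff (m * g) = Polynomial.lead_coeff p"
        unfolding Polynomial.lead_coeff_mult using assms(3) by simp
      hence "coeff (m * g) (degree p) = Polynomial.lead_coeff p"
        by (simp only: dm)
      hence c0: "coeff p' (degree p) = 0" by (simp add: p'_def)
      have "degree p' \<le> degree p"
        unfolding p'_def using dm by (metis degree_diff_le order_refl)
      hence "p' = 0 \<or> degree p' < degree p"
        using c0 by (metis le_neq_implies_less leading_coeff_0_iff)
      then obtain q where q: "q \<in> polys_over R"
          "p' - q * g \<in> polys_over R \<and> (p' - q * g = 0 \<or> degree (p' - q * g) < degree g)"
      proof
        assume "p' = 0" thus ?thesis using that[of 0] by auto
      next
        assume "degree p' < degree p"
        thus ?thesis using less.hyps[OF _ p'] that by blast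
      qed
      show ?thesis
        using q m by (intro bexI[of _ "q + m"]) (auto simp: p'_def algebra_simps)
    qed
  qed
  then obtain q where "q \<in> polys_over R" "p - q * g \<in> polys_over R"
      "p - q * g = 0 \<or> degree (p - q * g) < degree g" by blast
  thus ?thesis
    by (intro that[of q "p - q * g"]) auto
qed

lemma det_closed:
  assumes "A \<in> carrier_mat n n" "\<And>i j. i < n \<Longrightarrow> j < n \<Longrightarrow> A $$ (i, j) \<in> R"
  shows "Determinant.det A \<in> R"
proof -
  have "signof \<pi> * (\<Prod>i = 0..<n. A $$ (i, \<pi> i)) \<in> R" if "\<pi> permutes {0..<n}" for \<pi>
  proof (intro mult_closed prod_closed)
    show "signof \<pi> \<in> R" by (auto simp: sign_def)
    show "A $$ (i, \<pi> i) \<in> R" if "i \<in> {0..<n}" for i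
      using assms(2) that permutes_in_image[OF \<open>\<pi> permutes _\<close>, of i] by auto
  qed
  thus ?thesis
    unfolding det_def'[OF assms(1)] by auto
qed

end

locale complex_subfield = complex_subring +
  assumes inverse_closed [simp, intro]: "x \<in> R \<Longrightarrow> inverse x \<in> R"
begin

lemma divide_closed [simp, intro]: "x \<in> R \<Longrightarrow> y \<in> R \<Longrightarrow> x / y \<in> R"
  by (simp add: divide_inverse)

lemma Rats_subset: "\<rat> \<subseteq> R"
  by (auto elim!: Rats_cases')

end

interpretation Ints: complex_subring \<int>
  by unfold_locales auto

interpretation Rats: complex_subfield \<rat>
  by unfold_locales auto

section \<open>Algebraic integers\<close>

text \<open>The determinant trick: \<open>w\<close> is an eigenvector of an integer matrix for the
  eigenvalue \<open>x\<close>, and the characteristic polynomial of that matrix is monic with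
  integer coefficients.\<close>

lemma algebraic_int_eigenvalue:
  fixes w :: "'i \<Rightarrow> complex"
  assumes "finite I" "\<And>i. i \<in> I \<Longrightarrow> x * w i = (\<Sum>j\<in>I. of_int (A i j) * w j)"
    and "i0 \<in> I" "w i0 \<noteq> 0"
  shows "algebraic_int x"
proof -
  define n where "n = card I"
  obtain e where e: "bij_betw e {0..<n} I"
    using ex_bij_betw_nat_finite[OF assms(1)] by (auto simp: n_def)
  define M where "M = Matrix.mat n n (\<lambda>(i, j). A (e i) (e j))"
  define M' :: "complex mat" where "M' = map_mat of_int M"
  define v where "v = Matrix.vec n (\<lambda>i. w (e i))"
  have M: "M \<in> carrier_mat n n" "M' \<in> carrier_mat n n"
    by (auto simp: M_def M'_def)
  obtain k0 where k0: "k0 < n" "e k0 = i0"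
    using e assms(3) by (metis atLeastLessThan_iff bij_betw_iff_bijections)
  have "v \<noteq> 0\<^sub>v n"
    using k0 assms(4) by (metis index_vec index_zero_vec(1) v_def)
  moreover have "M' *\<^sub>v v = x \<cdot>\<^sub>v v"
  proof (rule eq_vecI)
    fix i assume "i < dim_vec (x \<cdot>\<^sub>v v)"
    hence i: "i < n" by (simp add: v_def)
    have "vec_index (M' *\<^sub>v v) i = (\<Sum>j\<in>{0..<n}. of_int (A (e i) (e j)) * w (e j))"
      using i by (simp add: M'_def M_def v_def scalar_prod_def)
    also have "\<dots> = (\<Sum>j\<in>I. of_int (A (e i) j) * w j)"
      by (rule sum.reindex_bij_betw[OF e])
    also have "\<dots> = x * w (e i)"
      using assms(2)[of "e i"] e i by (auto simp: bij_betw_def)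
    finally show "vec_index (M' *\<^sub>v v) i = vec_index (x \<cdot>\<^sub>v v) i"
      using i by (simp add: v_def)
  qed (auto simp: M'_def M_def v_def)
  ultimately have "eigenvalue M' x"
    unfolding eigenvalue_def eigenvector_def using M by (intro exI[of _ v]) (auto simp: v_def)
  hence "poly (char_poly M') x = 0"
    using eigenvalue_root_char_poly[OF M(2)] by simp
  moreover have "char_poly M' = map_poly of_int (char_poly M)"
    unfolding M'_def by (rule of_int_hom.char_poly_hom[OF M(1)])
  moreover have "Polynomial.lead_coeff (char_poly M') = 1"
    using degree_monic_char_poly[OF M(2)] by simp
  ultimately show ?thesis
    by (intro algebraic_int.intros[of "char_poly M'"]) (auto simp: coeff_map_poly)
qed

lemma algebraic_int_monic_relation:
  assumes "algebraic_int (x :: complex)"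
  obtains n and c :: "nat \<Rightarrow> int" where "n > 0" "x ^ n = (\<Sum>i<n. of_int (c i) * x ^ i)"
proof -
  obtain p where p: "Polynomial.lead_coeff p = 1" "\<forall>i. coeff p i \<in> \<int>" "poly p x = 0"
    using assms by (auto elim: algebraic_int.cases)
  define n where "n = degree p"
  have "n > 0"
  proof (rule ccontr)
    assume "\<not> n > 0"
    hence "degree p = 0" by (simp add: n_def)
    then obtain a where "p = [:a:]" by (elim degree_eq_zeroE)
    hence "p = [:1:]" using p(1) by simp
    thus False using p(3) by simp
  qed
  have "\<forall>i. \<exists>c. coeff p i = of_int c"
    using p(2) by (auto elim: Ints_cases)
  then obtain c where c: "\<And>i. coeff p i = of_int (c i)"
    by metis
  have "0 = (\<Sum>i\<le>n. of_int (c i) * x ^ i)"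
    using p(3) by (simp add: poly_altdef c n_def)
  also have "\<dots> = (\<Sum>i<n. of_int (c i) * x ^ i) + x ^ n"
    using p(1) c[of n] by (simp add: lessThan_Suc_atMost[symmetric] n_def)
  finally have "x ^ n = (\<Sum>i<n. of_int (- c i) * x ^ i)"
    by (simp add: sum_negf eq_neg_iff_add_eq_0 add.commute)
  with \<open>n > 0\<close> show ?thesis by (rule that)
qed

text \<open>The products x^i y^j with i < n and j < m span an additive group stable under
  multiplication by x and by y, so x + y and x y act on it by integer matrices.\<close>

lemma algebraic_int_plus_times:
  fixes x y :: complex
  assumes "algebraic_int x" "algebraic_int y"
  shows "algebraic_int (x + y) \<and> algebraic_int (x * y)"
proof -
  obtain n c where n: "n > 0" "x ^ n = (\<Sum>i<n. of_int (c i) * x ^ i)"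
    using algebraic_int_monic_relation[OF assms(1)] .
  obtain m d where m: "m > 0" "y ^ m = (\<Sum>i<m. of_int (d i) * y ^ i)"
    using algebraic_int_monic_relation[OF assms(2)] .
  define I where "I = {..<n} \<times> {..<m}"
  define w where "w = (\<lambda>(i, j). x ^ i * y ^ j)"
  \<comment> \<open>Multiplication by \<open>x\<close> shifts \<open>i\<close> to
    \<open>Suc i\<close>; at i = n - 1 the monic relation of \<open>x\<close> supplies the row.
    \<open>B\<close> does the same for \<open>y\<close>.\<close>
  define A :: "nat \<times> nat \<Rightarrow> nat \<times> nat \<Rightarrow> int" where "A = (\<lambda>(i, j) (i', j'). if j' = j then
      (if Suc i < n then (if i' = Suc i then 1 else 0) else c i') else 0)"
  define B :: "nat \<times> nat \<Rightarrow> nat \<times> nat \<Rightarrow> int" where "B = (\<lambda>(i, j) (i', j'). if i' = i then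
      (if Suc j < m then (if j' = Suc j then 1 else 0) else d j') else 0)"
  have A: "x * w a = (\<Sum>b\<in>I. of_int (A a b) * w b)" if "a \<in> I" for a
  proof -
    obtain i j where [simp]: "a = (i, j)" by (cases a)
    have ij: "i < n" "j < m" using that by (auto simp: I_def)
    have "(\<Sum>b\<in>I. of_int (A a b) * w b) = (\<Sum>i'<n. \<Sum>j'<m. if j' = j then of_int (if Suc i < n then (if i' = Suc i then 1 else 0) else c i') * x ^ i' * y ^ j' else 0)"
      unfolding I_def sum.cartesian_product by (intro sum.cong) (auto simp: A_def w_def)
    also have "\<dots> = (\<Sum>i'<n. of_int (if Suc i < n then (if i' = Suc i then 1 else 0) else c i') * x ^ i') * y ^ j"
      using ij by (simp add: sum_distrib_right)
    also have "(\<Sum>i'<n. of_int (if Suc i < n then (if i' = Suc i then 1 else 0) else c i') * x ^ i') = x ^ Suc i"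
    proof (cases "Suc i < n")
      case True
      hence "(\<Sum>i'<n. of_int (if Suc i < n then (if i' = Suc i then 1 else 0) else c i') * x ^ i') = (\<Sum>i'<n. if i' = Suc i then x ^ i' else 0)"
        by (intro sum.cong) auto
      thus ?thesis using True by simp
    next
      case False
      hence "n = Suc i" using ij by simp
      thus ?thesis using n(2) by simp
    qed
    finally show ?thesis by (simp add: w_def)
  qed
  have B: "y * w a = (\<Sum>b\<in>I. of_int (B a b) * w b)" if "a \<in> I" for a
  proof -
    obtain i j where [simp]: "a = (i, j)" by (cases a)
    have ij: "i < n" "j < m" using that by (auto simp: I_def)
    have "(\<Sum>b\<in>I. of_int (B a b) * w b) = (\<Sum>i'<n. \<Sum>j'<m. if i' = i then of_int (if Suc j < m then (if j' = Suc j then 1 else 0) else d j') * y ^ j' * x ^ i' else 0)"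
      unfolding I_def sum.cartesian_product by (intro sum.cong) (auto simp: B_def w_def)
    also have "\<dots> = (\<Sum>j'<m. of_int (if Suc j < m then (if j' = Suc j then 1 else 0) else d j') * y ^ j') * x ^ i"
      using ij by (subst sum.swap) (simp add: sum_distrib_right)
    also have "(\<Sum>j'<m. of_int (if Suc j < m then (if j' = Suc j then 1 else 0) else d j') * y ^ j') = y ^ Suc j"
    proof (cases "Suc j < m")
      case True
      hence "(\<Sum>j'<m. of_int (if Suc j < m then (if j' = Suc j then 1 else 0) else d j') * y ^ j') = (\<Sum>j'<m. if j' = Suc j then y ^ j' else 0)"
        by (intro sum.cong) auto
      thus ?thesis using True by simp
    next
      case False
      hence "m = Suc j" using ij by simp
      thus ?thesis using m(2) by simp
    qed
    finally show ?thesis by (simp add: w_def)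
  qed
  have fin: "finite I" and w0: "(0, 0) \<in> I" "w (0, 0) \<noteq> 0"
    using n m by (auto simp: I_def w_def)
  have plus: "(x + y) * w a = (\<Sum>b\<in>I. of_int (A a b + B a b) * w b)" if "a \<in> I" for a
    using A[OF that] B[OF that] by (simp add: ring_distribs sum.distrib)
  have times: "(x * y) * w a = (\<Sum>b\<in>I. of_int (\<Sum>t\<in>I. B a t * A t b) * w b)" if "a \<in> I" for a
  proof -
    have "(x * y) * w a = (\<Sum>t\<in>I. of_int (B a t) * (x * w t))"
      using B[OF that] by (simp add: mult.assoc sum_distrib_left mult.left_commute)
    also have "\<dots> = (\<Sum>t\<in>I. \<Sum>b\<in>I. of_int (B a t * A t b) * w b)"
      by (intro sum.cong) (simp_all add: A sum_distrib_left mult.assoc)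
    also have "\<dots> = (\<Sum>b\<in>I. of_int (\<Sum>t\<in>I. B a t * A t b) * w b)"
      by (subst sum.swap) (simp add: sum_distrib_right)
    finally show ?thesis .
  qed
  show ?thesis
    using algebraic_int_eigenvalue[OF fin plus w0] algebraic_int_eigenvalue[OF fin times w0] by simp
qed

lemma complex_subring_algebraic_int: "complex_subring {x. algebraic_int x}"
proof unfold_locales
  show "1 \<in> {x. algebraic_int (x :: complex)}"
    by (simp add: int_imp_algebraic_int)
  fix x y :: complex assume "x \<in> {x. algebraic_int x}" "y \<in> {x. algebraic_int x}"
  thus "x - y \<in> {x. algebraic_int x}" "x * y \<in> {x. algebraic_int x}"
    using algebraic_int_plus_times[of x "- y"] algebraic_int_plus_times[of x y] by auto
qed

interpretation AlgInt: complex_subring "{x. algebraic_int x}"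
  by (rule complex_subring_algebraic_int)

section \<open>Newton's identities\<close>

text \<open>Here \<open>l i\<close> is the logarithmic derivative of \<open>f i\<close>; the form F'
  = F L avoids dividing by F.\<close>

lemma fps_deriv_prod_log:
  fixes f :: "'i \<Rightarrow> complex fps"
  assumes "\<And>i. i \<in> I \<Longrightarrow> fps_deriv (f i) = f i * l i"
  shows "fps_deriv (prod f I) = prod f I * sum l I"
  using assms
  by (induction I rule: infinite_finite_induct) (simp_all add: algebra_simps)

text \<open>The logarithmic derivative of 1 - aX is -(a + a^2 X + a^3 X^2 + ...); summed over a
  family of roots it generates their power sums.\<close>

lemma fps_deriv_linear_log:
  fixes a :: complex
  shows "fps_deriv (1 - fps_const a * fps_X) = (1 - fps_const a * fps_X) * Abs_fps (\<lambda>n. - (a ^ Suc n))"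
proof (rule fps_ext)
  fix n
  have "(1 - fps_const a * fps_X) * Abs_fps (\<lambda>n. - (a ^ Suc n))
      = Abs_fps (\<lambda>n. - (a ^ Suc n)) - fps_const a * (fps_X * Abs_fps (\<lambda>n. - (a ^ Suc n)))"
    by (simp add: algebra_simps)
  thus "fps_nth (fps_deriv (1 - fps_const a * fps_X)) n
      = fps_nth ((1 - fps_const a * fps_X) * Abs_fps (\<lambda>n. - (a ^ Suc n))) n"
    by (cases n) auto
qed

context complex_subfield
begin

text \<open>Comparing coefficients expresses (m + 1) F_(m+1) by earlier coefficients of
  \<open>F\<close> and those of \<open>L\<close>; the division by m + 1 asks for a field.\<close>

lemma fps_ode_closed:
  assumes "fps_deriv F = F * L" "fps_nth F 0 \<in> R" "\<And>n. fps_nth L n \<in> R"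
  shows "fps_nth F n \<in> R"
proof (induction n rule: less_induct)
  case (less n)
  show ?case
  proof (cases n)
    case (Suc m)
    have "of_nat (Suc m) * fps_nth F (Suc m) = (\<Sum>i=0..m. fps_nth F i * fps_nth L (m - i))"
      using arg_cong[OF assms(1), of "\<lambda>f. fps_nth f m"] by (simp add: fps_mult_nth)
    also have "\<dots> \<in> R"
      using less.IH assms(3) Suc by auto
    finally have "(of_nat (Suc m) * fps_nth F (Suc m)) / of_nat (Suc m) \<in> R"
      by (rule divide_closed) (rule of_nat_closed)
    thus ?thesis using Suc by (simp del: of_nat_Suc)
  qed (use assms in auto)
qed

lemma fps_quotient_closed:
  assumes "F * L = H" "fps_nth F 0 \<noteq> 0" "\<And>n. fps_nth F n \<in> R" "\<And>n. fps_nth H n \<in> R"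
  shows "fps_nth L n \<in> R"
proof (induction n rule: less_induct)
  case (less n)
  have "fps_nth H n = (\<Sum>i\<in>{0..n}. fps_nth F i * fps_nth L (n - i))"
    using assms(1) by (auto simp: fps_mult_nth)
  also have "{0..n} = insert 0 {1..n}" by auto
  finally have "fps_nth L n = (fps_nth H n - (\<Sum>i\<in>{1..n}. fps_nth F i * fps_nth L (n - i))) / fps_nth F 0"
    using assms(2) by simp
  also have "\<dots> \<in> R"
    by (intro divide_closed diff_closed sum_closed mult_closed assms less.IH) auto
  finally show ?case .
qed

lemma fps_of_reflect_prod:
  "fps_of_poly (reflect_poly (\<Prod>i\<in>I. [:- \<alpha> i, 1:])) = (\<Prod>i\<in>I. 1 - fps_const (\<alpha> i) * fps_X)"
  for \<alpha> :: "'i \<Rightarrow> complex"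
proof -
  have "reflect_poly [:- \<alpha> i, 1:] = [:1, - \<alpha> i:]" for i
    by (rule poly_eqI) (auto simp: coeff_reflect_poly coeff_pCons split: nat.splits)
  moreover have "fps_of_poly [:1, - \<alpha> i:] = 1 - fps_const (\<alpha> i) * fps_X" for i
    using fps_of_poly_linear'[of "- \<alpha> i"] by (simp add: fps_const_neg[symmetric] del: fps_const_neg)
  ultimately show ?thesis
    by (simp only: reflect_poly_prod fps_of_poly_prod)
qed

text \<open>From coefficients to power sums: their generating series is, up to sign, F'/F for the
  reversed polynomial F, which has constant term 1.\<close>

lemma power_sum_closed:
  fixes \<alpha> :: "'i \<Rightarrow> complex"
  assumes "(\<Prod>i\<in>I. [:- \<alpha> i, 1:]) \<in> polys_over R"
  shows "(\<Sum>i\<in>I. \<alpha> i ^ n) \<in> R"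
proof (cases n)
  case (Suc m)
  define P where "P = (\<Prod>i\<in>I. [:- \<alpha> i, 1:])"
  define F where "F = fps_of_poly (reflect_poly P)"
  define L where "L = (\<Sum>i\<in>I. Abs_fps (\<lambda>n. - (\<alpha> i ^ Suc n)))"
  have F: "fps_nth F n \<in> R" for n
    using assms by (auto simp: F_def P_def coeff_reflect_poly polys_over_def)
  have F_eq: "F = (\<Prod>i\<in>I. 1 - fps_const (\<alpha> i) * fps_X)"
    unfolding F_def P_def by (rule fps_of_reflect_prod)
  have "F * L = fps_deriv F"
    unfolding F_eq L_def by (rule fps_deriv_prod_log[symmetric]) (rule fps_deriv_linear_log)
  moreover have "fps_nth F 0 \<noteq> 0"
    by (simp add: F_def P_def Polynomial.lead_coeff_prod)
  moreover have "fps_nth (fps_deriv F) n \<in> R" for n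
    using F by (auto simp del: of_nat_Suc)
  ultimately have "fps_nth L m \<in> R"
    using F fps_quotient_closed by blast
  thus ?thesis
    using Suc uminus_closed[of "fps_nth L m"] by (simp add: L_def fps_sum_nth sum_negf)
qed auto

text \<open>The converse: F' = F L recovers the coefficients from the power sums. The two directions
  stand in for the theorem on symmetric functions; values may repeat in the family.\<close>

lemma prod_linear_closed:
  fixes \<alpha> :: "'i \<Rightarrow> complex"
  assumes "\<And>n. (\<Sum>i\<in>I. \<alpha> i ^ n) \<in> R"
  shows "(\<Prod>i\<in>I. [:- \<alpha> i, 1:]) \<in> polys_over R"
proof -
  define P where "P = (\<Prod>i\<in>I. [:- \<alpha> i, 1:])"
  define F where "F = fps_of_poly (reflect_poly P)"
  define L where "L = (\<Sum>i\<in>I. Abs_fps (\<lambda>n. - (\<alpha> i ^ Suc n)))"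
  have F_eq: "F = (\<Prod>i\<in>I. 1 - fps_const (\<alpha> i) * fps_X)"
    unfolding F_def P_def by (rule fps_of_reflect_prod)
  have "fps_deriv F = F * L"
    unfolding F_eq L_def by (rule fps_deriv_prod_log) (rule fps_deriv_linear_log)
  moreover have "fps_nth F 0 \<in> R"
    by (simp add: F_def P_def Polynomial.lead_coeff_prod)
  moreover have "fps_nth L n \<in> R" for n
    using assms[of "Suc n"] by (simp add: L_def fps_sum_nth sum_negf)
  ultimately have "fps_nth F n \<in> R" for n
    by (rule fps_ode_closed)
  hence *: "coeff (reflect_poly P) n \<in> R" for n
    by (simp add: F_def)
  have "coeff P n \<in> R" for n
  proof (cases "n \<le> degree P")
    case True
    moreover have "\<not> degree P < degree P - n" by simp
    ultimately show ?thesis using *[of "degree P - n"] by (simp only: coeff_reflect_poly) simp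
  qed (simp add: coeff_eq_0)
  thus ?thesis by (simp add: P_def polys_over_def)
qed

lemma trace_closed:
  fixes \<alpha> :: "'i \<Rightarrow> complex"
  assumes "(\<Prod>i\<in>I. [:- \<alpha> i, 1:]) \<in> polys_over R" "T \<in> polys_over R"
  shows "(\<Sum>i\<in>I. poly T (\<alpha> i)) \<in> R"
proof -
  have "(\<Sum>i\<in>I. poly T (\<alpha> i)) = (\<Sum>k\<le>degree T. coeff T k * (\<Sum>i\<in>I. \<alpha> i ^ k))"
    unfolding poly_altdef sum_distrib_left by (rule sum.swap)
  also have "\<dots> \<in> R"
    using power_sum_closed[OF assms(1)] assms(2) by (auto simp: polys_over_def)
  finally show ?thesis .
qed

section \<open>Minimal polynomials\<close>

text \<open>Irreducibility enters only as minimality of the degree; the leading coefficient 1 makes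
  division possible.\<close>

definition is_minpoly :: "complex poly \<Rightarrow> complex \<Rightarrow> bool" where
  "is_minpoly g x \<longleftrightarrow> g \<in> polys_over R \<and> Polynomial.lead_coeff g = 1 \<and> poly g x = 0 \<and>
     (\<forall>q\<in>polys_over R. poly q x = 0 \<longrightarrow> q = 0 \<or> degree g \<le> degree q)"

lemma minpoly_exists:
  assumes "p \<in> polys_over R" "p \<noteq> 0" "poly p x = 0"
  obtains g where "is_minpoly g x" "degree g \<le> degree p"
proof -
  define P where "P d \<longleftrightarrow> (\<exists>q\<in>polys_over R. q \<noteq> 0 \<and> poly q x = 0 \<and> degree q = d)" for d
  have P: "P (degree p)" using assms by (auto simp: P_def)
  obtain q where q: "q \<in> polys_over R" "q \<noteq> 0" "poly q x = 0" "degree q = (LEAST d. P d)"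
    using LeastI[of P, OF P] unfolding P_def by blast
  define g where "g = smult (inverse (Polynomial.lead_coeff q)) q"
  have "degree g = degree q"
    using q(2) by (simp add: g_def)
  hence dg: "degree g = (LEAST d. P d)"
    using q(4) by simp
  have "is_minpoly g x"
    unfolding is_minpoly_def
  proof (intro conjI ballI impI)
    show "g \<in> polys_over R" using q(1) by (auto simp: g_def polys_overD)
    show "Polynomial.lead_coeff g = 1" using q(2) by (simp add: g_def)
    show "poly g x = 0" using q(3) by (simp add: g_def)
    fix r assume "r \<in> polys_over R" "poly r x = 0"
    hence "r = 0 \<or> P (degree r)" by (auto simp: P_def)
    thus "r = 0 \<or> degree g \<le> degree r"
      using Least_le[of P] dg by auto
  qed
  moreover have "degree g \<le> degree p"
    using Least_le[of P, OF P] dg by simp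
  ultimately show ?thesis by (rule that)
qed

lemma minpoly_dvd:
  assumes "is_minpoly g x" "q \<in> polys_over R" "poly q x = 0"
  obtains h where "h \<in> polys_over R" "q = h * g"
proof -
  obtain h r where h: "h \<in> polys_over R" "r \<in> polys_over R" "q = h * g + r" "r = 0 \<or> degree r < degree g"
    using polys_over_division[OF assms(2), of g] assms(1) unfolding is_minpoly_def by metis
  have "poly r x = 0"
    using h(3) assms by (simp add: is_minpoly_def)
  hence "r = 0"
    using h assms(1) by (auto simp: is_minpoly_def)
  with h show ?thesis by (intro that[of h]) auto
qed

lemma minpoly_degree_pos: "is_minpoly g x \<Longrightarrow> degree g > 0"
  by (rule ccontr) (auto simp: is_minpoly_def elim!: degree_eq_zeroE)

text \<open>If a were a root of something smaller, then g = h m with m minimal for a, and x would be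
  a root of h or of m, both of smaller degree than g.\<close>

lemma minpoly_conjugate:
  assumes g: "is_minpoly g x" and a: "poly g a = 0"
  shows "is_minpoly g a"
proof (rule ccontr)
  assume not: "\<not> is_minpoly g a"
  have g': "g \<in> polys_over R" "Polynomial.lead_coeff g = 1" "g \<noteq> 0"
    using g by (auto simp: is_minpoly_def)
  then obtain q where q: "q \<in> polys_over R" "poly q a = 0" "q \<noteq> 0" "degree q < degree g"
    using not a unfolding is_minpoly_def by auto
  obtain m where m: "is_minpoly m a" "degree m \<le> degree q"
    using minpoly_exists[OF q(1,3,2)] .
  obtain h where h: "h \<in> polys_over R" "g = h * m"
    using minpoly_dvd[OF m(1) g'(1) a] .
  have nz: "h \<noteq> 0" "m \<noteq> 0" using h g' by auto
  have "degree g = degree h + degree m"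
    using h(2) nz by (simp add: degree_mult_eq)
  hence "degree h < degree g"
    using minpoly_degree_pos[OF m(1)] by simp
  moreover have "poly h x = 0 \<or> poly m x = 0"
    using g h(2) by (simp add: is_minpoly_def)
  ultimately show False
    using g h m q(4) nz unfolding is_minpoly_def by (metis le_less_trans leD)
qed

text \<open>The substitute for the isomorphism that sends x to its conjugate a: polynomial relations
  over \<open>R\<close> carry over.\<close>

lemma minpoly_conjugate_root:
  assumes "is_minpoly g x" "poly g a = 0" "q \<in> polys_over R" "poly q x = 0"
  shows "poly q a = 0"
  using minpoly_dvd[OF assms(1,3,4)] assms(2) by (metis mult_zero_right poly_mult)

text \<open>Separability: g is minimal for each of its roots, so at a double root the nonzero
  derivative, of smaller degree, could not vanish.\<close>

lemma minpoly_split: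
  assumes "is_minpoly g x"
  shows "g = (\<Prod>z | poly g z = 0. [:- z, 1:])" "finite {z. poly g z = 0}"
proof -
  have "rsquarefree g"
    unfolding rsquarefree_roots
  proof (intro allI notI)
    fix a assume a: "poly g a = 0 \<and> poly (pderiv g) a = 0"
    have "is_minpoly g a" using minpoly_conjugate[OF assms] a by simp
    hence "pderiv g = 0 \<or> degree g \<le> degree (pderiv g)"
      using a unfolding is_minpoly_def by auto
    thus False
      using minpoly_degree_pos[OF assms] by (auto simp: pderiv_eq_0_iff degree_pderiv)
  qed
  from complex_poly_decompose_rsquarefree[OF this] show "g = (\<Prod>z | poly g z = 0. [:- z, 1:])"
    using assms by (simp add: is_minpoly_def)
  show "finite {z. poly g z = 0}"
    by (rule poly_roots_finite) (use assms in \<open>auto simp: is_minpoly_def\<close>)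
qed

lemma conjugate_trace_closed:
  assumes "is_minpoly g x" "T \<in> polys_over R"
  shows "(\<Sum>z | poly g z = 0. poly T z) \<in> R"
proof (rule trace_closed)
  show "(\<Prod>z | poly g z = 0. [:- z, 1:]) \<in> polys_over R"
    using assms(1) minpoly_split(1)[OF assms(1)] by (metis is_minpoly_def)
qed fact

end

section \<open>The field of algebraic numbers\<close>

lemma Rats_common_denominator:
  fixes f :: "'i \<Rightarrow> complex"
  assumes "finite I" "\<And>i. i \<in> I \<Longrightarrow> f i \<in> \<rat>"
  shows "\<exists>D::nat. D > 0 \<and> (\<forall>i\<in>I. of_nat D * f i \<in> \<int>)"
  using assms
proof (induction I rule: finite_induct)
  case (insert i I)
  then obtain D :: nat where D: "D > 0" "\<forall>i\<in>I. of_nat D * f i \<in> \<int>" by auto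
  obtain a b where ab: "b > (0::int)" "f i = of_int a / of_int b"
    using insert.prems[of i] by (auto elim: Rats_cases')
  define E where "E = D * nat b"
  have b: "of_nat (nat b) = (of_int b :: complex)" using ab(1) by simp
  have "of_nat E * f i = of_int (int D * a)"
    using ab by (simp add: E_def b)
  hence "of_nat E * f i \<in> \<int>" by (metis Ints_of_int)
  moreover have "of_nat E * f j = of_int b * (of_nat D * f j)" for j
    by (simp add: E_def b)
  ultimately have "\<forall>j\<in>insert i I. of_nat E * f j \<in> \<int>"
    using D(2) by (metis Ints_mult Ints_of_int insertE)
  moreover have "E > 0" using D ab by (simp add: E_def)
  ultimately show ?case by blast
qed (auto intro: exI[of _ 1])

text \<open>One \<open>D\<close> works for all roots at once, as the transcendence proof
  requires.\<close>

lemma common_scaling_algebraic_int: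
  assumes "g \<in> polys_over \<rat>" "Polynomial.lead_coeff g = 1"
  obtains D :: nat where "D > 0" "\<And>z. poly g z = 0 \<Longrightarrow> algebraic_int (of_nat D * z)"
proof -
  define n where "n = degree g"
  obtain D :: nat where D: "D > 0" "\<And>i. i \<le> n \<Longrightarrow> of_nat D * coeff g i \<in> \<int>"
    using Rats_common_denominator[of "{..n}" "coeff g"] assms by (auto simp: polys_over_def)
  \<comment> \<open>This is D^n g(X/D): its roots are those of g scaled by D, it is still monic, and
    every lower coefficient carries at least one factor D.\<close>
  define G where "G = (\<Sum>i\<le>n. monom (of_nat D ^ (n - i) * coeff g i) i)"
  have cG: "coeff G i = (if i \<le> n then of_nat D ^ (n - i) * coeff g i else 0)" for i
    by (simp add: G_def coeff_sum)
  have monic: "coeff G n = 1" using assms(2) by (simp add: cG n_def)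
  moreover have "degree G = n"
  proof (rule antisym)
    show "degree G \<le> n" by (rule degree_le) (simp add: cG)
    show "n \<le> degree G" by (rule le_degree) (simp add: monic)
  qed
  ultimately have lc: "Polynomial.lead_coeff G = 1" by simp
  have int: "coeff G i \<in> \<int>" for i
  proof (cases "i < n")
    case True
    hence "coeff G i = of_nat (D ^ (n - i - 1)) * (of_nat D * coeff g i)"
      by (simp add: cG power_Suc[symmetric] Suc_diff_Suc mult.assoc[symmetric] power_Suc2[symmetric] del: power_Suc)
    thus ?thesis using D(2)[of i] True by (metis Ints_mult Ints_of_nat less_imp_le)
  qed (use monic in \<open>auto simp: cG n_def le_less\<close>)
  have "algebraic_int (of_nat D * z)" if "poly g z = 0" for z
  proof (rule algebraic_int.intros[of G])
    have "poly G (of_nat D * z) = (\<Sum>i\<le>n. of_nat D ^ (n - i) * coeff g i * (of_nat D * z) ^ i)"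
      by (simp add: G_def poly_sum poly_monom)
    also have "\<dots> = (\<Sum>i\<le>n. of_nat D ^ n * (coeff g i * z ^ i))"
      by (intro sum.cong refl) (simp add: power_mult_distrib algebra_simps flip: power_add)
    also have "\<dots> = of_nat D ^ n * poly g z"
      by (simp add: poly_altdef n_def sum_distrib_left)
    finally show "poly G (of_nat D * z) = 0" using that by simp
  qed (use lc int in auto)
  with D(1) show ?thesis by (rule that)
qed

lemma algebraic_iff_polys_over: "algebraic (x :: complex) \<longleftrightarrow> (\<exists>p\<in>polys_over \<rat>. p \<noteq> 0 \<and> poly p x = 0)"
  by (auto simp: algebraic_altdef polys_over_def)

lemma algebraic_minpoly:
  assumes "algebraic (x :: complex)"
  obtains g where "Rats.is_minpoly g x"
proof -
  from assms obtain p where p: "p \<in> polys_over \<rat>" "p \<noteq> 0" "poly p x = 0"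
    by (auto simp: algebraic_iff_polys_over)
  from Rats.minpoly_exists[OF this] show ?thesis using that by blast
qed

text \<open>Reduces closure of the algebraic numbers under differences and products to that of the
  algebraic integers.\<close>

lemma algebraic_iff_algebraic_int:
  "algebraic (x :: complex) \<longleftrightarrow> (\<exists>D::nat. D > 0 \<and> algebraic_int (of_nat D * x))"
proof
  assume "algebraic x"
  then obtain g where g: "Rats.is_minpoly g x" by (rule algebraic_minpoly)
  obtain D :: nat where "D > 0" "\<And>z. poly g z = 0 \<Longrightarrow> algebraic_int (of_nat D * z)"
    using common_scaling_algebraic_int[of g] g unfolding Rats.is_minpoly_def by auto
  thus "\<exists>D::nat. D > 0 \<and> algebraic_int (of_nat D * x)"
    using g by (auto simp: Rats.is_minpoly_def)
next
  assume "\<exists>D::nat. D > 0 \<and> algebraic_int (of_nat D * x)"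
  then obtain D :: nat where D: "D > 0" "algebraic (of_nat D * x)" by auto
  then obtain p where p: "p \<in> polys_over \<rat>" "p \<noteq> 0" "poly p (of_nat D * x) = 0"
    by (auto simp: algebraic_iff_polys_over)
  have "pcompose p [:0, of_nat D:] \<in> polys_over \<rat>"
    using p(1) by (intro Rats.polys_over_pcompose) auto
  moreover have "pcompose p [:0, of_nat D:] \<noteq> 0"
    using p(2) D(1) by (simp add: pcompose_eq_0_iff)
  moreover have "poly (pcompose p [:0, of_nat D:]) x = 0"
    using p(3) by (simp add: poly_pcompose mult.commute)
  ultimately show "algebraic x"
    unfolding algebraic_iff_polys_over by blast
qed

lemma complex_subfield_algebraic: "complex_subfield {x. algebraic x}"
proof unfold_locales
  fix x y :: complex assume "x \<in> {x. algebraic x}" "y \<in> {x. algebraic x}"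
  hence "algebraic x" "algebraic y" by auto
  then obtain a b :: nat where ab: "a > 0" "algebraic_int (of_nat a * x)" "b > 0" "algebraic_int (of_nat b * y)"
    unfolding algebraic_iff_algebraic_int by blast
  have "of_nat (a * b) * (x - y) = of_nat b * (of_nat a * x) - of_nat a * (of_nat b * y)"
    by (simp add: algebra_simps)
  moreover have "of_nat b * (of_nat a * x) - of_nat a * (of_nat b * y) \<in> {x. algebraic_int x}"
    by (rule AlgInt.diff_closed; rule AlgInt.mult_closed[OF AlgInt.of_nat_closed]; use ab in simp)
  ultimately show "x - y \<in> {x. algebraic x}"
    unfolding algebraic_iff_algebraic_int mem_Collect_eq using ab(1,3) by (intro exI[of _ "a * b"]) simp
  have eq: "of_nat (a * b) * (x * y) = (of_nat a * x) * (of_nat b * y)"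
    by (simp add: algebra_simps)
  have "algebraic_int (of_nat (a * b) * (x * y))"
    unfolding eq using ab algebraic_int_plus_times by blast
  thus "x * y \<in> {x. algebraic x}"
    unfolding algebraic_iff_algebraic_int mem_Collect_eq using ab(1,3) by (intro exI[of _ "a * b"] conjI) auto
qed auto

interpretation Alg: complex_subfield "{x. algebraic x}"
  by (rule complex_subfield_algebraic)

section \<open>Transcendence of \<open>\<pi>\<close>\<close>

lemma linear_power_dvd_pderiv:
  fixes f :: "complex poly"
  assumes "[:- a, 1:] ^ Suc m dvd f"
  shows "[:- a, 1:] ^ m dvd pderiv f"
proof -
  define q where "q = [:- a, 1:]"
  obtain r where "f = q ^ Suc m * r" using assms unfolding q_def by (elim dvdE)
  hence "pderiv f = pderiv (q ^ Suc m * r)" by (rule arg_cong)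
  also have "\<dots> = q ^ m * (q * pderiv r + smult (of_nat (Suc m)) (pderiv q) * r)"
    unfolding pderiv_mult pderiv_power_Suc by (simp add: algebra_simps del: of_nat_Suc)
  finally have "pderiv f = q ^ m * (q * pderiv r + smult (of_nat (Suc m)) (pderiv q) * r)" .
  thus ?thesis by (simp add: q_def)
qed

lemma poly_higher_pderiv_eq_0:
  fixes f :: "complex poly"
  assumes "[:- a, 1:] ^ m dvd f" "i < m"
  shows "poly ((pderiv ^^ i) f) a = 0"
  using assms
proof (induction i arbitrary: f m)
  case 0
  hence "[:- a, 1:] dvd f"
    by (metis dvd_power dvd_trans)
  thus ?case by (simp add: poly_eq_0_iff_dvd)
next
  case (Suc i)
  then obtain m' where m: "m = Suc m'" "i < m'" by (cases m) auto
  thus ?case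
    using Suc.IH[OF linear_power_dvd_pderiv, of m' f] Suc.prems
    by (simp del: funpow.simps add: funpow_Suc_right)
qed

lemma pochhammer_Suc_fact: "pochhammer (Suc n) i * fact n = (fact (n + i) :: nat)"
  by (induction i) (simp_all add: pochhammer_Suc algebra_simps)

text \<open>The quotient is the binomial coefficient of n + i over i. Hence i! divides all
  coefficients of the i-th derivative of an integer polynomial.\<close>

lemma fact_dvd_pochhammer_Suc: "(fact i :: nat) dvd pochhammer (Suc n) i"
proof -
  have "(fact n * fact i :: nat) dvd fact (n + i)" by (rule fact_fact_dvd_fact)
  hence "(fact i * fact n :: nat) dvd pochhammer (Suc n) i * fact n"
    unfolding pochhammer_Suc_fact by (simp only: mult.commute)
  thus ?thesis by simp
qed

lemma poly_higher_pderiv_monom: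
  fixes c x :: complex
  shows "poly ((pderiv ^^ i) (monom c n)) x = (if i \<le> n then c * fact n / fact (n - i) * x ^ (n - i) else 0)"
proof -
  have "(pderiv ^^ i) (monom c n) = (if i \<le> n then monom (c * fact n / fact (n - i)) (n - i) else 0)"
  proof (induction i)
    case (Suc i)
    show ?case
    proof (cases "Suc i \<le> n")
      case True
      hence n: "n - i = Suc (n - Suc i)" by simp
      have "(fact (n - i) :: complex) = of_nat (n - i) * fact (n - Suc i)"
        unfolding n by (simp add: algebra_simps)
      thus ?thesis using Suc True n
        by (simp add: pderiv_monom field_simps del: of_nat_Suc)
    next
      case False
      thus ?thesis using Suc by (cases "i = n") (auto simp: pderiv_monom)
    qed
  qed simp
  thus ?thesis by (simp add: poly_monom)
qed

text \<open>The key estimate: for \<open>f = x\<^sup>n\<close> the left-hand side is \<open>n!\<close> times the tail of the exponential series.\<close>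

lemma exp_higher_pderiv_bound:
  fixes f :: "complex poly" and x :: complex
  assumes "degree f \<le> d"
  shows "norm (exp x * (\<Sum>i\<le>d. poly ((pderiv ^^ i) f) 0) - (\<Sum>i\<le>d. poly ((pderiv ^^ i) f) x))
         \<le> norm x * exp (norm x) * (\<Sum>n\<le>d. norm (coeff f n) * norm x ^ n)"
proof -
  define \<Phi> where "\<Phi> g = exp x * (\<Sum>i\<le>d. poly ((pderiv ^^ i) g) 0) - (\<Sum>i\<le>d. poly ((pderiv ^^ i) g) x)" for g
  have f: "f = (\<Sum>n\<le>d. monom (coeff f n) n)"
    using poly_as_sum_of_monoms'[OF assms] by simp
  have "\<Phi> (\<Sum>n\<in>A. g n) = (\<Sum>n\<in>A. \<Phi> (g n))" for A :: "nat set" and g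
    by (induction A rule: infinite_finite_induct)
      (simp_all add: \<Phi>_def higher_pderiv_add sum.distrib algebra_simps)
  hence "\<Phi> f = (\<Sum>n\<le>d. \<Phi> (monom (coeff f n) n))"
    using arg_cong[OF f, of \<Phi>] by simp
  also have "norm \<dots> \<le> (\<Sum>n\<le>d. norm x * exp (norm x) * (norm (coeff f n) * norm x ^ n))"
  proof (rule sum_norm_le)
    fix n assume "n \<in> {..d}"
    hence n: "n \<le> d" by simp
    define c where "c = coeff f n"
    have val: "(\<Sum>i\<le>d. poly ((pderiv ^^ i) (monom c n)) y) = c * fact n * (\<Sum>j\<le>n. y ^ j / fact j)" for y
    proof -
      have "(\<Sum>i\<le>d. poly ((pderiv ^^ i) (monom c n)) y) = (\<Sum>i\<in>{..n}. c * fact n / fact (n - i) * y ^ (n - i))"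
        by (rule sum.mono_neutral_cong_right) (use n in \<open>auto simp: poly_higher_pderiv_monom\<close>)
      also have "\<dots> = (\<Sum>j\<le>n. c * fact n / fact j * y ^ j)"
        by (rule sum.reindex_bij_witness[of _ "\<lambda>i. n - i" "\<lambda>i. n - i"]) auto
      finally show ?thesis by (simp add: sum_distrib_left mult.assoc)
    qed
    have "(\<Sum>j\<le>n. (0::complex) ^ j / fact j) = 1"
      by (subst sum.remove[of _ 0]) (auto intro!: sum.neutral)
    hence "\<Phi> (monom c n) = c * fact n * (exp x - (\<Sum>j\<le>n. x ^ j / fact j))"
      unfolding \<Phi>_def val by (simp add: algebra_simps)
    hence "norm (\<Phi> (monom c n)) = norm c * fact n * norm (exp x - (\<Sum>j\<le>n. x ^ j / fact j))"
      by (simp add: norm_mult)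
    also have "\<dots> \<le> norm c * fact n * (exp (norm x) * norm x ^ Suc n / fact n)"
      by (intro mult_left_mono Taylor_exp_field) auto
    finally show "norm (\<Phi> (monom (coeff f n) n)) \<le> norm x * exp (norm x) * (norm (coeff f n) * norm x ^ n)"
      by (simp add: c_def mult_ac)
  qed
  finally show ?thesis
    unfolding \<Phi>_def by (simp add: sum_distrib_left)
qed

text \<open>Coefficientwise majorants multiply, so the absolute values of the coefficients of h^p
  are controlled by the p-th power of one real polynomial, uniformly in p.\<close>

definition dominated :: "complex poly \<Rightarrow> real poly \<Rightarrow> bool" where
  "dominated f g \<longleftrightarrow> (\<forall>n. norm (coeff f n) \<le> coeff g n)"

lemma dominated_mult:
  assumes "dominated f g" "dominated f' g'"
  shows "dominated (f * f') (g * g')"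
  unfolding dominated_def
proof
  fix n
  have nn: "0 \<le> coeff g k" for k
    using assms(1) norm_ge_zero order_trans unfolding dominated_def by blast
  have "norm (coeff (f * f') n) \<le> (\<Sum>i\<le>n. norm (coeff f i * coeff f' (n - i)))"
    unfolding coeff_mult by (rule norm_sum)
  also have "\<dots> \<le> (\<Sum>i\<le>n. coeff g i * coeff g' (n - i))"
    using assms nn by (intro sum_mono) (auto simp: norm_mult dominated_def intro!: mult_mono)
  finally show "norm (coeff (f * f') n) \<le> coeff (g * g') n"
    by (simp add: coeff_mult)
qed

lemma dominated_power: "dominated f g \<Longrightarrow> dominated (f ^ n) (g ^ n)"
proof (induction n)
  case 0
  thus ?case by (auto simp: dominated_def)
qed (auto intro: dominated_mult)

lemma power_less_fact_eventually:
  fixes C K :: real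
  assumes "K \<ge> 0"
  shows "eventually (\<lambda>n. C * K ^ n < fact (n - 1)) sequentially"
proof -
  have "(\<lambda>n. inverse (fact n) * K ^ n) \<longlonglongrightarrow> 0"
    by (rule summable_LIMSEQ_zero) (rule summable_exp)
  hence "(\<lambda>n. (C * K) * (inverse (fact n) * K ^ n)) \<longlonglongrightarrow> (C * K) * 0"
    by (intro tendsto_intros)
  hence "eventually (\<lambda>n. (C * K) * (inverse (fact n) * K ^ n) < 1) sequentially"
    by (intro order_tendstoD(2)[of _ "C * K * 0"]) auto
  hence "eventually (\<lambda>n. C * K ^ Suc n < fact (Suc n - 1)) sequentially"
    by eventually_elim (simp add: field_simps)
  thus ?thesis
    by (rule eventually_sequentially_Suc[THEN iffD1])
qed

text \<open>
  Hermite's argument in Niven's form, with \<open>f = x\<^sup>p\<^sup>-\<^sup>1 h\<^sup>p\<close> for a large prime \<open>p\<close>, where \<open>h\<close> vanishes exactly at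
  the \<open>\<alpha> j\<close>: the sums of all derivatives of \<open>f\<close> at \<open>0\<close> and at the \<open>\<alpha> j\<close> combine, up to a power of \<open>D\<close>, to a
  multiple of \<open>(p - 1)!\<close> that is nonzero modulo \<open>p!\<close>, but the estimate above makes it smaller than \<open>(p - 1)!\<close>.
\<close>

lemma exp_sum_ne_neg_nat:
  fixes \<alpha> :: "'i \<Rightarrow> complex" and D N :: nat
  assumes fin: "finite J" and nz: "\<And>j. j \<in> J \<Longrightarrow> \<alpha> j \<noteq> 0" and D: "D > 0"
    and int: "\<And>j. j \<in> J \<Longrightarrow> algebraic_int (of_nat D * \<alpha> j)"
    and ps: "\<And>n. (\<Sum>j\<in>J. \<alpha> j ^ n) \<in> \<rat>" and N: "N > 0"
  shows "of_nat N + (\<Sum>j\<in>J. exp (\<alpha> j)) \<noteq> 0"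
proof
  assume zero: "of_nat N + (\<Sum>j\<in>J. exp (\<alpha> j)) = 0"
  define M where "M = card J"
  define H where "H = (\<Prod>j\<in>J. [:- (of_nat D * \<alpha> j), 1:])"
  \<comment> \<open>The coefficients are rational because the power sums of the roots are, and
    algebraic integers because the roots are; so they are integers.\<close>
  have Hint: "H \<in> polys_over \<int>"
  proof -
    have "H \<in> polys_over \<rat>"
      unfolding H_def
    proof (rule Rats.prod_linear_closed)
      fix n show "(\<Sum>j\<in>J. (of_nat D * \<alpha> j) ^ n) \<in> \<rat>"
        using ps[of n] by (simp add: power_mult_distrib sum_distrib_left[symmetric])
    qed
    moreover have "H \<in> polys_over {x. algebraic_int x}"
      unfolding H_def
    proof (rule AlgInt.polys_over_prod)
      fix j assume "j \<in> J"
      hence "- (of_nat D * \<alpha> j) \<in> {x. algebraic_int x}" using int by simp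
      thus "[:- (of_nat D * \<alpha> j), 1:] \<in> polys_over {x. algebraic_int x}"
        by (intro AlgInt.polys_over_pCons AlgInt.one_closed AlgInt.polys_over_0)
    qed
    ultimately show ?thesis
      using rational_algebraic_int_is_int by (auto simp: polys_over_def)
  qed
  define h where "h = pcompose H [:0, of_nat D:]"
  have hint: "h \<in> polys_over \<int>"
    using Hint by (auto simp: h_def)
  have dH: "degree H = M"
    unfolding H_def M_def by (subst degree_prod_eq_sum_degree) auto
  have dh: "degree h \<le> M"
    unfolding h_def using degree_pcompose_le[of H "[:0, of_nat D:]"] dH
    by (metis (no_types, lifting) One_nat_def degree_pCons_le degree_pCons_eq_if degree_0 dual_order.trans mult.right_neutral mult_le_mono2 pCons_0_0)
  have hroot: "poly h (\<alpha> j) = 0" if "j \<in> J" for j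
    using that fin by (auto simp: h_def H_def poly_pcompose poly_prod mult.commute)
  have h0: "poly h 0 \<noteq> 0"
    using nz fin D by (auto simp: h_def H_def poly_pcompose poly_prod)
  have "coeff h 0 \<in> \<int>"
    using hint by (rule polys_overD)
  then obtain z where z: "poly h 0 = of_int z"
    by (metis Ints_cases poly_0_coeff_0)
  have z0: "z \<noteq> 0" using h0 z by auto
  define hh where "hh = map_poly norm h"
  have dom: "dominated h hh"
    by (auto simp: dominated_def hh_def coeff_map_poly)
  have hhnn: "poly hh r \<ge> 0" if "r \<ge> 0" for r
    using that by (auto simp: poly_altdef hh_def coeff_map_poly intro!: sum_nonneg)
  define C where "C = (\<Sum>j\<in>J. exp (norm (\<alpha> j)))"
  \<comment> \<open>The factor D^(M+1) pays for D^d, since d < (M + 1) p; 1 plus the sum over all j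
    bounds the contribution of every single j.\<close>
  define K where "K = real D ^ Suc M * (1 + (\<Sum>j\<in>J. norm (\<alpha> j) * poly hh (norm (\<alpha> j))))"
  have "K \<ge> 0"
    unfolding K_def by (intro mult_nonneg_nonneg add_nonneg_nonneg sum_nonneg hhnn) auto
  from power_less_fact_eventually[OF this, of C]
  obtain n0 where n0: "\<And>n. n \<ge> n0 \<Longrightarrow> C * K ^ n < fact (n - 1)"
    by (auto simp: eventually_sequentially)
  \<comment> \<open>Exceeding \<open>D\<close>, \<open>N\<close> and |z| keeps p from dividing any
    of them; exceeding \<open>n0\<close> lets (p - 1)! beat the estimate.\<close>
  obtain p where p: "prime p" "p > n0 + D + N + nat \<bar>z\<bar>"
    using bigger_prime by blast
  have p1: "p \<ge> 1" using p(2) by simp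
  define d where "d = p - 1 + p * M"
  define f where "f = monom 1 (p - 1) * h ^ p"
  have df: "degree f \<le> d"
  proof -
    have "degree f \<le> degree (monom (1::complex) (p - 1)) + degree (h ^ p)"
      unfolding f_def by (rule degree_mult_le)
    also have "\<dots> \<le> (p - 1) + p * M"
      using degree_power_le[of h p] dh
      by (intro add_mono degree_monom_le order.trans[OF degree_power_le]) (simp add: mult.commute)
    finally show ?thesis by (simp add: d_def)
  qed
  have fint: "f \<in> polys_over \<int>"
    unfolding f_def using hint by (intro Ints.polys_over_mult Ints.polys_over_monom Ints.polys_over_power) auto
  have coeff_f: "coeff f n = (if n < p - 1 then 0 else coeff (h ^ p) (n - (p - 1)))" for n
    by (simp add: f_def coeff_monom_mult)
  define F where "F x = (\<Sum>i\<le>d. poly ((pderiv ^^ i) f) x)" for x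
  define q where "q n i = pochhammer (Suc n) i div (fact p :: nat)" for n i
  have q: "pochhammer (of_nat (Suc n)) i = (fact p * of_nat (q n i) :: complex)" if "i \<ge> p" for n i
  proof -
    have "(fact p :: nat) dvd pochhammer (Suc n) i"
      using fact_dvd[OF that] fact_dvd_pochhammer_Suc dvd_trans by blast
    hence "pochhammer (Suc n) i = fact p * q n i" by (simp add: q_def)
    hence "of_nat (pochhammer (Suc n) i) = (of_nat (fact p * q n i) :: complex)" by simp
    thus ?thesis by (simp add: pochhammer_of_nat del: of_nat_Suc)
  qed
  \<comment> \<open>The sum of the derivatives of order at least p, divided by p!; it stays integral
    because i! divides the i-th derivative.\<close>
  define G where "G = (\<Sum>i\<in>{p..d}. \<Sum>n\<le>d. monom (of_nat (q n i) * coeff f (n + i)) n)"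
  have G: "(\<Sum>i\<in>{p..d}. poly ((pderiv ^^ i) f) x) = fact p * poly G x" for x
  proof -
    have "poly ((pderiv ^^ i) f) x = (\<Sum>n\<le>d. fact p * (of_nat (q n i) * coeff f (n + i) * x ^ n))" if "i \<ge> p" for i
    proof -
      have "degree ((pderiv ^^ i) f) \<le> d"
        using df by (simp add: degree_higher_pderiv)
      hence "poly ((pderiv ^^ i) f) x = poly (\<Sum>n\<le>d. monom (coeff ((pderiv ^^ i) f) n) n) x"
        by (simp add: poly_as_sum_of_monoms')
      thus ?thesis
        by (simp add: poly_sum poly_monom coeff_higher_pderiv q[OF that] mult_ac del: of_nat_Suc)
    qed
    thus ?thesis
      by (simp add: G_def poly_sum poly_monom sum_distrib_left)
  qed
  have Gint: "G \<in> polys_over \<int>"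
    unfolding G_def using fint
    by (intro Ints.polys_over_sum Ints.polys_over_monom Ints.mult_closed Ints.of_nat_closed polys_overD)
  have dG: "degree G \<le> d"
    unfolding G_def by (intro degree_sum_le order.trans[OF degree_monom_le]) auto
  have split: "F x = (\<Sum>i<p. poly ((pderiv ^^ i) f) x) + fact p * poly G x" for x
  proof -
    have "{..d} = {..<p} \<union> {p..d}" if "p - 1 \<le> d" using p1 that by auto
    hence "{..d} = {..<p} \<union> {p..d}" by (simp add: d_def)
    thus ?thesis unfolding F_def G[symmetric]
      by (simp add: sum.union_disjoint ivl_disj_int)
  qed
  have F\<alpha>: "F (\<alpha> j) = fact p * poly G (\<alpha> j)" if "j \<in> J" for j
  proof -
    have "[:- \<alpha> j, 1:] dvd h" using hroot[OF that] by (simp add: poly_eq_0_iff_dvd)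
    hence "[:- \<alpha> j, 1:] ^ p dvd f"
      unfolding f_def by (intro dvd_mult dvd_power_same)
    thus ?thesis unfolding split by (simp add: poly_higher_pderiv_eq_0)
  qed
  have "F 0 = (\<Sum>i<p. fact i * coeff f i) + fact p * poly G 0"
    unfolding split by (simp add: poly_0_coeff_0 coeff_higher_pderiv pochhammer_fact[symmetric])
  \<comment> \<open>As x^(p-1) divides f, only the order p - 1 survives at 0 among the orders below
    p; it contributes (p - 1)! h(0)^p.\<close>
  also have "(\<Sum>i<p. fact i * coeff f i) = (\<Sum>i\<in>{p-1}. fact i * coeff f i)"
    using p1 by (intro sum.mono_neutral_right) (auto simp: coeff_f)
  also have "\<dots> = fact (p - 1) * poly h 0 ^ p"
    by (simp add: coeff_f poly_0_coeff_0[symmetric] poly_power)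
  finally have F0: "F 0 = fact (p - 1) * of_int z ^ p + fact p * poly G 0"
    by (simp add: z)
  have "poly G 0 \<in> \<int>" using Gint by (intro Ints.poly_closed) auto
  then obtain A where A: "poly G 0 = of_int A" by (elim Ints_cases)
  \<comment> \<open>The sum is a combination of power sums, hence rational; D^d clears the
    denominators of all powers up to d, which makes it an algebraic integer as well.\<close>
  have "of_nat D ^ d * (\<Sum>j\<in>J. poly G (\<alpha> j)) \<in> \<int>"
  proof (rule rational_algebraic_int_is_int)
    have "(\<Sum>j\<in>J. poly G (\<alpha> j)) = (\<Sum>n\<le>degree G. coeff G n * (\<Sum>j\<in>J. \<alpha> j ^ n))"
      unfolding poly_altdef sum_distrib_left by (rule sum.swap)
    also have "\<dots> \<in> \<rat>"
      by (rule Rats.sum_closed, rule Rats.mult_closed)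
        (use ps polys_overD[OF Gint] Ints_subset_Rats in blast)+
    finally show "of_nat D ^ d * (\<Sum>j\<in>J. poly G (\<alpha> j)) \<in> \<rat>"
      by (intro Rats.mult_closed Rats.power_closed) auto
    have "of_nat D ^ d * (c * x ^ n) = c * (of_nat D ^ (d - n) * (of_nat D * x) ^ n)" if "n \<le> degree G"
      for c x :: complex and n
    proof -
      have "(of_nat D :: complex) ^ d = of_nat D ^ (d - n) * of_nat D ^ n"
        using that dG by (simp flip: power_add)
      thus ?thesis by (simp only: power_mult_distrib mult_ac)
    qed
    hence "of_nat D ^ d * (\<Sum>j\<in>J. poly G (\<alpha> j))
        = (\<Sum>j\<in>J. \<Sum>n\<le>degree G. coeff G n * (of_nat D ^ (d - n) * (of_nat D * \<alpha> j) ^ n))"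
      unfolding poly_altdef sum_distrib_left by (intro sum.cong refl) auto
    also have "\<dots> \<in> {x. algebraic_int x}"
    proof (intro AlgInt.sum_closed AlgInt.mult_closed)
      fix j n assume "j \<in> J"
      show "coeff G n \<in> {x. algebraic_int x}"
        using polys_overD[OF Gint] by (simp add: int_imp_algebraic_int)
      show "(of_nat D :: complex) ^ (d - n) \<in> {x. algebraic_int x}"
        by (rule AlgInt.power_closed) (rule AlgInt.of_nat_closed)
      show "(of_nat D * \<alpha> j) ^ n \<in> {x. algebraic_int x}"
        by (rule AlgInt.power_closed) (use int \<open>j \<in> J\<close> in simp)
    qed
    finally show "algebraic_int (of_nat D ^ d * (\<Sum>j\<in>J. poly G (\<alpha> j)))" by simp
  qed
  then obtain B where B: "of_nat D ^ d * (\<Sum>j\<in>J. poly G (\<alpha> j)) = of_int B" by (elim Ints_cases)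
  define Z where "Z = int D ^ d * int N * z ^ p + int p * (int D ^ d * int N * A + B)"
  have fp: "(fact p :: complex) = of_nat p * fact (p - 1)"
    using p1 by (simp add: fact_reduce)
  have "of_nat D ^ d * (of_nat N * F 0 + (\<Sum>j\<in>J. F (\<alpha> j)))
     = fact (p - 1) * (of_nat D ^ d * of_nat N * of_int z ^ p + of_nat p * (of_nat D ^ d * of_nat N * of_int A
         + of_nat D ^ d * (\<Sum>j\<in>J. poly G (\<alpha> j))))"
    by (simp add: F\<alpha> F0 fp A algebra_simps sum_distrib_left)
  also have "\<dots> = fact (p - 1) * of_int Z"
    unfolding B by (simp add: Z_def)
  finally have lhs: "of_nat D ^ d * (of_nat N * F 0 + (\<Sum>j\<in>J. F (\<alpha> j))) = fact (p - 1) * of_int Z" .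
  \<comment> \<open>Modulo p only D^d N z^p is left, and p divides none of its factors.\<close>
  have "\<not> int p dvd Z"
  proof
    assume "int p dvd Z"
    hence "int p dvd int D ^ d * int N * z ^ p"
      unfolding Z_def by (subst (asm) dvd_add_left_iff) auto
    moreover have pp: "prime (int p)" using p(1) by simp
    ultimately have "int p dvd int D \<or> int p dvd int N \<or> int p dvd z"
      by (metis prime_dvd_mult_iff prime_dvd_power)
    moreover have "\<not> int p dvd int D" "\<not> int p dvd int N"
      using p(2) D N by (auto dest: dvd_imp_le)
    moreover have "\<not> int p dvd z"
      using p(2) z0 dvd_imp_le_int[of z "int p"] by auto
    ultimately show False by blast
  qed
  hence "Z \<noteq> 0" by auto
  hence "(1::real) \<le> \<bar>of_int Z\<bar>" by linarith
  hence "fact (p - 1) * 1 \<le> (fact (p - 1) * \<bar>of_int Z\<bar> :: real)"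
    by (intro mult_left_mono) auto
  also have "\<dots> = norm (of_nat D ^ d * (of_nat N * F 0 + (\<Sum>j\<in>J. F (\<alpha> j))))"
    unfolding lhs by (simp add: norm_mult)
  \<comment> \<open>The assumed relation replaces N by minus the sum of the exponentials, so that
    only the small differences of \<open>exp_higher_pderiv_bound\<close> remain.\<close>
  also have "of_nat N * F 0 + (\<Sum>j\<in>J. F (\<alpha> j)) = - (\<Sum>j\<in>J. exp (\<alpha> j) * F 0 - F (\<alpha> j))"
  proof -
    have "of_nat N = - (\<Sum>j\<in>J. exp (\<alpha> j))" using zero by (simp add: eq_neg_iff_add_eq_0)
    thus ?thesis by (simp add: sum_subtractf sum_distrib_right)
  qed
  also have "norm (of_nat D ^ d * - (\<Sum>j\<in>J. exp (\<alpha> j) * F 0 - F (\<alpha> j)))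
      = real D ^ d * norm (\<Sum>j\<in>J. exp (\<alpha> j) * F 0 - F (\<alpha> j))"
    by (simp add: norm_mult norm_power)
  also have "\<dots> \<le> real D ^ d * (\<Sum>j\<in>J. exp (norm (\<alpha> j)) * (norm (\<alpha> j) * poly hh (norm (\<alpha> j))) ^ p)"
  proof (intro mult_left_mono sum_norm_le)
    fix j assume "j \<in> J"
    define r where "r = norm (\<alpha> j)"
    have "norm (exp (\<alpha> j) * F 0 - F (\<alpha> j)) \<le> r * exp r * (\<Sum>n\<le>d. norm (coeff f n) * r ^ n)"
      unfolding F_def r_def by (rule exp_higher_pderiv_bound[OF df])
    also have "r * exp r * (\<Sum>n\<le>d. norm (coeff f n) * r ^ n) \<le> r * exp r * poly (monom 1 (p - 1) * hh ^ p) r"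
    proof (rule mult_left_mono)
      have "dominated (monom 1 (p - 1)) (monom 1 (p - 1))"
        by (auto simp: dominated_def)
      hence dm: "dominated f (monom 1 (p - 1) * hh ^ p)"
        unfolding f_def by (intro dominated_mult dominated_power dom)
      have nn: "0 \<le> coeff (monom 1 (p - 1) * hh ^ p) n" for n
        using dm norm_ge_zero order_trans unfolding dominated_def by blast
      define e where "e = max d (degree (monom 1 (p - 1) * hh ^ p))"
      have "(\<Sum>n\<le>d. norm (coeff f n) * r ^ n) \<le> (\<Sum>n\<le>d. coeff (monom 1 (p - 1) * hh ^ p) n * r ^ n)"
        using dm by (intro sum_mono mult_right_mono) (auto simp: dominated_def r_def)
      also have "\<dots> \<le> (\<Sum>n\<le>e. coeff (monom 1 (p - 1) * hh ^ p) n * r ^ n)"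
        using nn by (intro sum_mono2) (auto simp: e_def r_def)
      also have "\<dots> = poly (\<Sum>n\<le>e. monom (coeff (monom 1 (p - 1) * hh ^ p) n) n) r"
        by (simp add: poly_sum poly_monom)
      also have "(\<Sum>n\<le>e. monom (coeff (monom 1 (p - 1) * hh ^ p) n) n) = monom 1 (p - 1) * hh ^ p"
        by (rule poly_as_sum_of_monoms') (simp add: e_def)
      finally show "(\<Sum>n\<le>d. norm (coeff f n) * r ^ n) \<le> poly (monom 1 (p - 1) * hh ^ p) r" .
    qed (simp add: r_def)
    also have "r * exp r * poly (monom 1 (p - 1) * hh ^ p) r = exp r * (r * r ^ (p - 1)) * poly hh r ^ p"
      by (simp add: poly_monom poly_power)
    also have "r * r ^ (p - 1) = r ^ p"
      using p1 by (cases p) auto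
    finally show "norm (exp (\<alpha> j) * F 0 - F (\<alpha> j)) \<le> exp (norm (\<alpha> j)) * (norm (\<alpha> j) * poly hh (norm (\<alpha> j))) ^ p"
      by (simp add: r_def power_mult_distrib mult_ac)
  qed auto
  also have "\<dots> \<le> real D ^ d * (\<Sum>j\<in>J. exp (norm (\<alpha> j)) * (1 + (\<Sum>j\<in>J. norm (\<alpha> j) * poly hh (norm (\<alpha> j)))) ^ p)"
  proof (intro mult_left_mono sum_mono power_mono)
    fix j assume j: "j \<in> J"
    have "norm (\<alpha> j) * poly hh (norm (\<alpha> j)) \<le> (\<Sum>j\<in>J. norm (\<alpha> j) * poly hh (norm (\<alpha> j)))"
      using j fin by (intro member_le_sum mult_nonneg_nonneg hhnn) auto
    thus "norm (\<alpha> j) * poly hh (norm (\<alpha> j)) \<le> 1 + (\<Sum>j\<in>J. norm (\<alpha> j) * poly hh (norm (\<alpha> j)))" by simp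
    show "0 \<le> norm (\<alpha> j) * poly hh (norm (\<alpha> j))"
      by (intro mult_nonneg_nonneg hhnn) auto
  qed auto
  also have "\<dots> \<le> (real D ^ Suc M) ^ p * (\<Sum>j\<in>J. exp (norm (\<alpha> j)) * (1 + (\<Sum>j\<in>J. norm (\<alpha> j) * poly hh (norm (\<alpha> j)))) ^ p)"
  proof (intro mult_right_mono)
    have "d \<le> Suc M * p" by (simp add: d_def)
    thus "real D ^ d \<le> (real D ^ Suc M) ^ p"
      using D unfolding power_mult[symmetric] by (intro power_increasing) auto
  qed (auto intro!: sum_nonneg mult_nonneg_nonneg add_nonneg_nonneg zero_le_power hhnn)
  also have "\<dots> = C * K ^ p"
    by (simp add: C_def K_def power_mult_distrib sum_distrib_right sum_distrib_left mult_ac)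
  also have "\<dots> < fact (p - 1)"
    using p(2) by (intro n0) simp
  finally show False by simp
qed

text \<open>The product of 1 + e^(zX) over z in S is the exponential generating series of the power
  sums of the subset sums. Its logarithmic derivative has coefficients that are rational multiples
  of the power sums over S, so the series itself is rational.\<close>

lemma power_sums_subset_sums_Rats:
  fixes S :: "complex set"
  assumes "finite S" and ps: "\<And>n. (\<Sum>z\<in>S. z ^ n) \<in> \<rat>"
  shows "(\<Sum>Y\<in>Pow S. (\<Sum>z\<in>Y. z) ^ n) \<in> \<rat>"
proof -
  \<comment> \<open>The logarithmic derivative of 1 + e^X; that of 1 + e^(zX) is z G(zX), called
    \<open>l z\<close> below.\<close>
  define G where "G = inverse (1 + fps_exp 1) * fps_exp (1 :: complex)"
  have G: "(1 + fps_exp 1) * G = fps_exp 1"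
    unfolding G_def by (simp add: mult.assoc[symmetric] inverse_mult_eq_1' del: mult.assoc)
  have "(1 / fact n :: complex) \<in> \<rat>" for n
    by (metis Rats_1 Rats_divide Rats_of_nat of_nat_fact)
  hence Grat: "fps_nth G n \<in> \<rat>" for n
    using G by (intro Rats.fps_quotient_closed[of "1 + fps_exp 1" G "fps_exp 1"]) auto
  define l where "l z = Abs_fps (\<lambda>n. z ^ Suc n * fps_nth G n)" for z :: complex
  have l: "fps_deriv (1 + fps_exp z) = (1 + fps_exp z) * l z" for z
  proof (rule fps_ext)
    fix n
    have "fps_nth ((1 + fps_exp z) * l z) n = fps_nth (l z) n + fps_nth (fps_exp z * l z) n"
      by (simp add: ring_distribs)
    also have "fps_nth (fps_exp z * l z) n = (\<Sum>i=0..n. z ^ Suc n * (fps_nth (fps_exp 1) i * fps_nth G (n - i)))"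
      unfolding fps_mult_nth by (intro sum.cong) (auto simp: l_def algebra_simps simp flip: power_add)
    also have "\<dots> = z ^ Suc n * fps_nth (fps_exp 1 * G) n"
      by (simp add: fps_mult_nth sum_distrib_left)
    also have "fps_nth (l z) n + \<dots> = z ^ Suc n * fps_nth ((1 + fps_exp 1) * G) n"
      by (simp add: l_def ring_distribs)
    also have "\<dots> = z ^ Suc n / fact n"
      unfolding G by simp
    finally show "fps_nth (fps_deriv (1 + fps_exp z)) n = fps_nth ((1 + fps_exp z) * l z) n"
      by (simp add: mult_ac)
  qed
  define E where "E = (\<Prod>z\<in>S. 1 + fps_exp z)"
  have "fps_deriv E = E * (\<Sum>z\<in>S. l z)"
    unfolding E_def by (rule fps_deriv_prod_log) (rule l)
  moreover have "fps_nth E 0 \<in> \<rat>"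
    unfolding E_def by (induction S rule: infinite_finite_induct) auto
  moreover have "fps_nth (\<Sum>z\<in>S. l z) n \<in> \<rat>" for n
    using ps[of "Suc n"] Grat[of n] by (simp add: fps_sum_nth l_def sum_distrib_right[symmetric])
  ultimately have "fps_nth E n \<in> \<rat>" by (rule Rats.fps_ode_closed)
  moreover have "E = (\<Sum>Y\<in>Pow S. fps_exp (\<Sum>z\<in>Y. z))"
  proof -
    have "(\<Prod>z\<in>Y. fps_exp z) = fps_exp (\<Sum>z\<in>Y. z)" for Y :: "complex set"
      by (induction Y rule: infinite_finite_induct) (simp_all add: fps_exp_add_mult)
    moreover have "E = (\<Prod>z\<in>S. fps_exp z + 1)"
      by (simp add: E_def add.commute)
    ultimately show ?thesis
      using prod_add[OF assms(1), of fps_exp "\<lambda>_. 1"] by simp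
  qed
  moreover have factR: "(fact n :: complex) \<in> \<rat>"
    by (metis Rats_of_nat of_nat_fact)
  ultimately have "fact n * (\<Sum>Y\<in>Pow S. (\<Sum>z\<in>Y. z) ^ n / fact n) \<in> \<rat>"
    by (intro Rats.mult_closed factR) (auto simp: fps_sum_nth)
  thus ?thesis
    by (simp add: sum_distrib_left)
qed

text \<open>Lindemann's argument: for algebraic pi the product of 1 + e^z over the conjugates z of i
  pi would vanish. Expanded, it is a sum of exponentials of subset sums, in which the subset sums
  equal to 0, the empty one among them, contribute a positive integer \<open>N\<close>.\<close>

theorem transcendental_pi: "\<not> algebraic (of_real pi :: complex)"
proof
  assume "algebraic (of_real pi :: complex)"
  hence "algebraic (\<i> * of_real pi)"
    using Alg.mult_closed[of "\<i>" "of_real pi"] by simp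
  then obtain g where g: "Rats.is_minpoly g (\<i> * of_real pi)" by (rule algebraic_minpoly)
  define S where "S = {z. poly g z = 0}"
  have gS: "g = (\<Prod>z\<in>S. [:- z, 1:])" and fin: "finite S"
    using Rats.minpoly_split[OF g] by (simp_all add: S_def)
  have mem: "\<i> * of_real pi \<in> S" using g by (simp add: S_def Rats.is_minpoly_def)
  have grat: "g \<in> polys_over \<rat>" "Polynomial.lead_coeff g = 1"
    using g by (simp_all add: Rats.is_minpoly_def)
  obtain D :: nat where D: "D > 0" "\<And>z. poly g z = 0 \<Longrightarrow> algebraic_int (of_nat D * z)"
    using common_scaling_algebraic_int[OF grat] by blast
  have ps: "(\<Sum>z\<in>S. z ^ n) \<in> \<rat>" for n
    using Rats.power_sum_closed[of "\<lambda>z. z" S] grat(1) gS by simp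
  define \<sigma> where "\<sigma> Y = (\<Sum>z\<in>Y. z)" for Y :: "complex set"
  \<comment> \<open>Indexing by subsets rather than by values keeps the multiplicity of coinciding
    sums.\<close>
  define J where "J = {Y \<in> Pow S. \<sigma> Y \<noteq> 0}"
  define N where "N = card {Y \<in> Pow S. \<sigma> Y = 0}"
  have finP: "finite (Pow S)" using fin by simp
  have Pow: "(\<Sum>Y\<in>Pow S. f Y) = (\<Sum>Y\<in>{Y \<in> Pow S. \<sigma> Y = 0}. f Y) + (\<Sum>Y\<in>J. f Y)" for f :: "complex set \<Rightarrow> complex"
    using finP by (subst sum.union_disjoint[symmetric]) (auto simp: J_def intro!: sum.cong)
  have N: "N > 0"
  proof -
    have "{} \<in> {Y \<in> Pow S. \<sigma> Y = 0}" by (simp add: \<sigma>_def)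
    thus ?thesis using finP by (auto simp: N_def card_gt_0_iff)
  qed
  have "(\<Sum>Y\<in>J. \<sigma> Y ^ n) \<in> \<rat>" for n
  proof (cases "n = 0")
    case False
    hence "(\<Sum>Y\<in>Pow S. \<sigma> Y ^ n) = (\<Sum>Y\<in>J. \<sigma> Y ^ n)"
      unfolding Pow by (simp add: power_0_left)
    thus ?thesis
      using power_sums_subset_sums_Rats[OF fin ps, of n] by (simp add: \<sigma>_def)
  qed auto
  moreover have "algebraic_int (of_nat D * \<sigma> Y)" if "Y \<in> J" for Y
  proof -
    have "of_nat D * \<sigma> Y = (\<Sum>z\<in>Y. of_nat D * z)"
      by (simp add: \<sigma>_def sum_distrib_left)
    also have "\<dots> \<in> {x. algebraic_int x}"
      using that D(2) by (intro AlgInt.sum_closed) (auto simp: J_def S_def)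
    finally show ?thesis by simp
  qed
  ultimately have "of_nat N + (\<Sum>Y\<in>J. exp (\<sigma> Y)) \<noteq> 0"
    using finP N D(1) by (intro exp_sum_ne_neg_nat[of J \<sigma> D N]) (auto simp: J_def)
  moreover have "of_nat N + (\<Sum>Y\<in>J. exp (\<sigma> Y)) = (\<Sum>Y\<in>Pow S. exp (\<sigma> Y))"
    unfolding Pow by (simp add: N_def)
  moreover have "(\<Sum>Y\<in>Pow S. exp (\<sigma> Y)) = (\<Prod>z\<in>S. exp z + 1)"
  proof -
    have "(\<Prod>z\<in>Y. exp z) = exp (\<sigma> Y)" if "Y \<in> Pow S" for Y
      using that fin unfolding \<sigma>_def by (subst exp_sum) (auto intro: finite_subset)
    thus ?thesis
      using prod_add[OF fin, of exp "\<lambda>_. 1"] by simp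
  qed
  moreover have "(\<Prod>z\<in>S. exp z + 1) = 0"
  proof (rule prod_zero[OF fin])
    have "exp (\<i> * of_real pi) + 1 = (0 :: complex)" using exp_pi_i' by simp
    thus "\<exists>z\<in>S. exp z + 1 = 0" using mem by blast
  qed
  ultimately show False by simp
qed

section \<open>Primitive roots of unity\<close>

text \<open>The multiplicative order is exactly n; n > 0 excludes the numbers of infinite order,
  which satisfy the second condition for n = 0.\<close>

definition primitive_root_of_unity :: "nat \<Rightarrow> complex \<Rightarrow> bool" where
  "primitive_root_of_unity n z \<longleftrightarrow> n > 0 \<and> (\<forall>k. z ^ k = 1 \<longleftrightarrow> n dvd k)"

lemma primitive_root_of_unity_cis:
  assumes "n > 0"
  shows "primitive_root_of_unity n (cis (2 * pi / real n))"
  unfolding primitive_root_of_unity_def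
proof (intro conjI allI assms)
  fix k :: nat
  have cis1: "cis x = 1 \<longleftrightarrow> (\<exists>j::int. x = 2 * of_int j * pi)" for x
    unfolding cis_conv_exp exp_eq_1 by (auto simp: mult_ac)
  have "cis (2 * pi / real n) ^ k = 1 \<longleftrightarrow> (\<exists>j::int. real k * (2 * pi / real n) = 2 * of_int j * pi)"
    by (simp only: Complex.DeMoivre cis1)
  also have "\<dots> \<longleftrightarrow> (\<exists>j::int. int k = j * int n)"
  proof (intro iff_exI)
    fix j :: int
    have "real k * (2 * pi / real n) = 2 * of_int j * pi \<longleftrightarrow> of_int (int k) = (of_int (j * int n) :: real)"
      using assms by (auto simp: field_simps)
    thus "real k * (2 * pi / real n) = 2 * of_int j * pi \<longleftrightarrow> int k = j * int n"
      by (simp only: of_int_eq_iff)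
  qed
  also have "\<dots> \<longleftrightarrow> n dvd k"
    by (metis dvd_def int_dvd_int_iff mult.commute)
  finally show "cis (2 * pi / real n) ^ k = 1 \<longleftrightarrow> n dvd k" .
qed

context
  fixes n :: nat and z :: complex
  assumes prim: "primitive_root_of_unity n z"
begin

lemma primitive_root_power_eq_1_iff: "z ^ k = 1 \<longleftrightarrow> n dvd k"
  and primitive_root_order_pos: "n > 0"
  and primitive_root_power_order: "z ^ n = 1"
  using prim by (auto simp: primitive_root_of_unity_def)

lemma primitive_root_nonzero: "z \<noteq> 0"
  using primitive_root_power_order primitive_root_order_pos by (metis zero_neq_one zero_power)

lemma primitive_root_power_cong:
  assumes "[i = j] (mod n)"
  shows "z ^ i = z ^ j"
proof -
  have red: "z ^ i = z ^ (i mod n)" for i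
  proof -
    have "z ^ i = (z ^ n) ^ (i div n) * z ^ (i mod n)"
      by (simp flip: power_mult power_add)
    moreover have "z ^ n = 1" by (simp add: primitive_root_power_eq_1_iff)
    ultimately show ?thesis by simp
  qed
  have "i mod n = j mod n" using assms by (simp add: unique_euclidean_semiring_class.cong_def)
  thus ?thesis using red[of i] red[of j] by simp
qed

lemma primitive_root_inj: "inj_on (\<lambda>i. z ^ i) {..<n}"
proof (rule inj_onI)
  have *: "i = j" if "i \<le> j" "i < n" "j < n" "z ^ i = z ^ j" for i j
  proof -
    have "z ^ i * z ^ (j - i) = z ^ (i + (j - i))" by (rule power_add[symmetric])
    hence "z ^ i * z ^ (j - i) = z ^ i * 1"
      using that by simp
    hence "z ^ (j - i) = 1" using primitive_root_nonzero by simp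
    hence "n dvd j - i" by (simp add: primitive_root_power_eq_1_iff)
    thus ?thesis using that by (auto dest: dvd_imp_le)
  qed
  thus "i = j" if "i \<in> {..<n}" "j \<in> {..<n}" "z ^ i = z ^ j" for i j
    using that *[of i j] *[OF _ _ _ that(3)[symmetric]] nat_le_linear[of i j] unfolding lessThan_iff by blast
qed

lemma primitive_root_range: "(\<lambda>i. z ^ i) ` {..<n} = {s. s ^ n = 1}"
proof (rule card_subset_eq)
  show "finite {s::complex. s ^ n = 1}"
    using primitive_root_order_pos by (intro finite_roots_unity) simp
  show "(\<lambda>i. z ^ i) ` {..<n} \<subseteq> {s. s ^ n = 1}"
  proof
    fix s assume "s \<in> (\<lambda>i. z ^ i) ` {..<n}"
    then obtain i where "s = z ^ i" by blast
    hence "s ^ n = (z ^ n) ^ i" by (simp add: power_mult [symmetric] mult.commute)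
    thus "s \<in> {s. s ^ n = 1}" by (simp add: primitive_root_power_order)
  qed
  show "card ((\<lambda>i. z ^ i) ` {..<n}) = card {s::complex. s ^ n = 1}"
    using card_roots_unity_eq[OF primitive_root_order_pos] by (simp add: card_image primitive_root_inj)
qed

lemma primitive_root_power_coprime:
  assumes "coprime b n"
  shows "primitive_root_of_unity n (z ^ b)"
  unfolding primitive_root_of_unity_def
proof (intro conjI allI primitive_root_order_pos)
  fix k
  have "(z ^ b) ^ k = 1 \<longleftrightarrow> n dvd b * k"
    unfolding power_mult[symmetric] by (rule primitive_root_power_eq_1_iff)
  also have "\<dots> \<longleftrightarrow> n dvd k"
    using assms by (intro coprime_dvd_mult_right_iff) (simp add: coprime_commute)
  finally show "(z ^ b) ^ k = 1 \<longleftrightarrow> n dvd k" .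
qed

lemma primitive_root_power_dvd:
  assumes "n = d * n'"
  shows "primitive_root_of_unity n' (z ^ d)"
  unfolding primitive_root_of_unity_def
proof (intro conjI allI)
  show "n' > 0" using assms primitive_root_order_pos by (intro Nat.gr0I) auto
  fix k
  have "(z ^ d) ^ k = 1 \<longleftrightarrow> n dvd d * k"
    unfolding power_mult[symmetric] by (rule primitive_root_power_eq_1_iff)
  also have "\<dots> \<longleftrightarrow> n' dvd k"
    using assms primitive_root_order_pos by auto
  finally show "(z ^ d) ^ k = 1 \<longleftrightarrow> n' dvd k" .
qed

lemma primitive_root_prod: "(\<Prod>i<n. [:- (z ^ i), 1:]) = monom 1 n - 1"
proof -
  define q :: "complex poly" where "q = monom 1 n - 1"
  have cq: "coeff q n = 1" using primitive_root_order_pos by (simp add: q_def coeff_1)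
  have "degree q \<le> n" unfolding q_def by (intro degree_diff_le degree_monom_le) auto
  moreover have "degree q \<ge> n" by (rule le_degree) (simp add: cq)
  ultimately have lc: "Polynomial.lead_coeff q = 1" using cq by simp
  have "rsquarefree q"
    unfolding rsquarefree_roots
  proof (intro allI notI)
    fix a assume a: "poly q a = 0 \<and> poly (pderiv q) a = 0"
    hence "a = 0" using primitive_root_order_pos
      by (auto simp: q_def pderiv_diff pderiv_monom poly_monom)
    thus False using a primitive_root_order_pos by (auto simp: q_def poly_monom power_0_left)
  qed
  from complex_poly_decompose_rsquarefree[OF this]
  have "q = (\<Prod>a | poly q a = 0. [:- a, 1:])" using lc by simp
  also have "{a. poly q a = 0} = (\<lambda>i. z ^ i) ` {..<n}"
    unfolding primitive_root_range by (auto simp: q_def poly_monom)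
  also have "(\<Prod>a\<in>(\<lambda>i. z ^ i) ` {..<n}. [:- a, 1:]) = (\<Prod>i<n. [:- (z ^ i), 1:])"
    by (subst prod.reindex[OF primitive_root_inj]) simp
  finally show ?thesis by (simp add: q_def)
qed

text \<open>Both sides are the value at 1 of (X^n - 1)/(X - 1), once as a product over the
  nontrivial powers of z and once as 1 + X + ... + X^(n-1).\<close>

lemma primitive_root_prod_one_minus: "(\<Prod>i\<in>{1..<n}. 1 - z ^ i) = of_nat n"
proof -
  have "[:- 1, 1:] * (\<Sum>i<n. monom (1::complex) i) = monom 1 n - 1"
  proof (rule poly_ext)
    fix x :: complex
    show "poly ([:- 1, 1:] * (\<Sum>i<n. monom 1 i)) x = poly (monom 1 n - 1) x"
      using power_diff_1_eq[of x n] by (simp add: poly_sum poly_monom algebra_simps)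
  qed
  also have "monom 1 n - 1 = [:- 1, 1:] * (\<Prod>i\<in>{1..<n}. [:- (z ^ i), 1:])"
  proof -
    have "{..<n} = insert 0 {1..<n}" using primitive_root_order_pos by auto
    thus ?thesis unfolding primitive_root_prod[symmetric] by simp
  qed
  finally have "(\<Sum>i<n. monom (1::complex) i) = (\<Prod>i\<in>{1..<n}. [:- (z ^ i), 1:])"
    by (subst (asm) mult_left_cancel) auto
  from arg_cong[OF this, of "\<lambda>p. poly p 1"] show ?thesis
    by (simp add: poly_sum poly_prod poly_monom)
qed

lemma algebraic_int_primitive_root: "algebraic_int (z ^ k)"
proof (rule algebraic_int_root[of 1])
  have "(z ^ n) ^ k = 1" by (simp add: primitive_root_power_order)
  thus "poly (monom 1 n) (z ^ k) = 1"
    by (simp add: poly_monom power_mult[symmetric] mult.commute)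
  show "\<forall>i. coeff (monom (1::complex) n) i \<in> \<int>" by auto
  show "degree (monom (1::complex) n) > 0" "Polynomial.lead_coeff (monom (1::complex) n) = 1"
    using primitive_root_order_pos by (simp_all add: degree_monom_eq)
qed auto

text \<open>As b is invertible modulo n, z^a is a power of z^b and the quotient is a finite
  geometric sum. If a is coprime to n as well, 1 - z^a and 1 - z^b are associates.\<close>

lemma algebraic_int_cyclotomic_unit:
  assumes b: "coprime b n" and n: "n > 1"
  shows "algebraic_int ((1 - z ^ a) / (1 - z ^ b))"
proof -
  obtain x where x: "[b * x = Suc 0] (mod n)"
    using cong_solve_coprime_nat[OF b] by auto
  define c where "c = x * a"
  have c: "[b * c = a] (mod n)"
    using cong_scalar_right[OF x, of a] by (simp add: c_def mult.assoc)
  define w where "w = z ^ b"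
  have w1: "w \<noteq> 1"
    using b n by (auto simp: w_def primitive_root_power_eq_1_iff)
  have "z ^ a = w ^ c"
    using primitive_root_power_cong[OF c] by (simp add: w_def power_mult)
  hence "(1 - z ^ a) / (1 - z ^ b) = (\<Sum>i<c. w ^ i)"
    using w1 one_diff_power_eq[of w c] by (simp add: w_def[symmetric])
  also have "\<dots> \<in> {x. algebraic_int x}"
    using algebraic_int_primitive_root
    by (intro AlgInt.sum_closed) (simp add: w_def flip: power_mult)
  finally show ?thesis by simp
qed

end

section \<open>Absence of nilpotents modulo a prime\<close>

text \<open>Divisibility by p is taken in the ring of all algebraic integers, so the notion refers
  to no field and passes to conjugates.\<close>

definition nilpotent_mod :: "nat \<Rightarrow> complex set" where
  "nilpotent_mod p = {x. algebraic_int x \<and> (\<exists>n>0. algebraic_int (x ^ n / of_nat p))}"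

text \<open>For a number field \<open>F\<close> this says that \<open>O\<^sub>F / p O\<^sub>F\<close> is reduced, that is, \<open>p\<close> is unramified in \<open>F\<close>.\<close>

definition unramified :: "complex set \<Rightarrow> nat \<Rightarrow> bool" where
  "unramified F p \<longleftrightarrow> (\<forall>x \<in> F \<inter> nilpotent_mod p. algebraic_int (x / of_nat p))"

lemma nilpotent_mod_mult:
  assumes "x \<in> nilpotent_mod p" "algebraic_int y"
  shows "x * y \<in> nilpotent_mod p"
proof -
  obtain n where n: "n > 0" "algebraic_int (x ^ n / of_nat p)" "algebraic_int x"
    using assms(1) by (auto simp: nilpotent_mod_def)
  have "x ^ n / of_nat p * y ^ n \<in> {x. algebraic_int x}"
    by (rule AlgInt.mult_closed) (use n assms AlgInt.power_closed[of y n] in auto)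
  hence "algebraic_int ((x * y) ^ n / of_nat p)"
    by (simp add: power_mult_distrib)
  thus ?thesis
    using n(1,3) assms algebraic_int_plus_times by (auto simp: nilpotent_mod_def)
qed

text \<open>Every term in the binomial expansion of the power n + m contains x^n or y^m.\<close>

lemma nilpotent_mod_add:
  assumes "x \<in> nilpotent_mod p" "y \<in> nilpotent_mod p"
  shows "x + y \<in> nilpotent_mod p"
proof -
  obtain n where n: "n > 0" "x ^ n / of_nat p \<in> {x. algebraic_int x}" "x \<in> {x. algebraic_int x}"
    using assms(1) by (auto simp: nilpotent_mod_def)
  obtain m where m: "m > 0" "y ^ m / of_nat p \<in> {x. algebraic_int x}" "y \<in> {x. algebraic_int x}"
    using assms(2) by (auto simp: nilpotent_mod_def)
  have "(x + y) ^ (n + m) / of_nat p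
      = (\<Sum>k\<le>n + m. of_nat ((n + m) choose k) * (x ^ k * y ^ (n + m - k) / of_nat p))"
    by (simp add: binomial_ring sum_divide_distrib mult.assoc)
  also have "\<dots> \<in> {x. algebraic_int x}"
  proof (intro AlgInt.sum_closed)
    fix k
    have "x ^ k * y ^ (n + m - k) / of_nat p \<in> {x. algebraic_int x}"
    proof (cases "k \<ge> n")
      case True
      hence "x ^ k * y ^ (n + m - k) / of_nat p = (x ^ n / of_nat p) * (x ^ (k - n) * y ^ (n + m - k))"
        by (simp flip: power_add)
      also have "\<dots> \<in> {x. algebraic_int x}"
        by (rule AlgInt.mult_closed[OF n(2) AlgInt.mult_closed[OF AlgInt.power_closed[OF n(3)] AlgInt.power_closed[OF m(3)]]])
      finally show ?thesis .
    next
      case False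
      hence "n + m - k = m + (n - k)" by simp
      hence "x ^ k * y ^ (n + m - k) / of_nat p = (y ^ m / of_nat p) * (x ^ k * y ^ (n - k))"
        by (simp add: mult_ac power_add)
      also have "\<dots> \<in> {x. algebraic_int x}"
        by (rule AlgInt.mult_closed[OF m(2) AlgInt.mult_closed[OF AlgInt.power_closed[OF n(3)] AlgInt.power_closed[OF m(3)]]])
      finally show ?thesis .
    qed
    thus "of_nat ((n + m) choose k) * (x ^ k * y ^ (n + m - k) / of_nat p) \<in> {x. algebraic_int x}"
      by (rule AlgInt.mult_closed[OF AlgInt.of_nat_closed])
  qed
  finally show ?thesis
    using n m AlgInt.add_closed[OF n(3) m(3)] by (auto simp: nilpotent_mod_def intro!: exI[of _ "n + m"])
qed

lemma nilpotent_mod_sum: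
  assumes "\<And>i. i \<in> I \<Longrightarrow> f i \<in> nilpotent_mod p"
  shows "sum f I \<in> nilpotent_mod p"
proof -
  have "0 \<in> nilpotent_mod p" by (auto simp: nilpotent_mod_def intro!: exI[of _ 1])
  thus ?thesis using assms
    by (induction I rule: infinite_finite_induct) (auto intro: nilpotent_mod_add)
qed

context complex_subfield
begin

text \<open>A monic integer polynomial A that annihilates T(x) gives A(T(X)), a polynomial over
  \<open>R\<close> that vanishes at x and therefore at a.\<close>

lemma algebraic_int_conjugate:
  assumes g: "is_minpoly g x" "poly g a = 0" and T: "T \<in> polys_over R" "algebraic_int (poly T x)"
  shows "algebraic_int (poly T a)"
proof -
  obtain A where A: "Polynomial.lead_coeff A = 1" "\<forall>i. coeff A i \<in> \<int>" "poly A (poly T x) = 0"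
    using T(2) by (auto elim: algebraic_int.cases)
  have A': "A \<in> polys_over R" using A(2) Ints_subset by (auto simp: polys_over_def)
  have "poly (pcompose A T) a = 0"
    by (rule minpoly_conjugate_root[OF g]) (use A(3) A' T(1) in \<open>auto simp: poly_pcompose\<close>)
  thus ?thesis
    using A by (intro algebraic_int.intros[of A]) (auto simp: poly_pcompose)
qed

lemma nilpotent_mod_conjugate:
  assumes g: "is_minpoly g x" "poly g a = 0" and T: "T \<in> polys_over R" "poly T x \<in> nilpotent_mod p"
  shows "poly T a \<in> nilpotent_mod p"
proof -
  obtain n where n: "n > 0" "algebraic_int (poly T x ^ n / of_nat p)" "algebraic_int (poly T x)"
    using T(2) by (auto simp: nilpotent_mod_def)
  have "algebraic_int (poly (smult (1 / of_nat p) (T ^ n)) a)"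
    by (rule algebraic_int_conjugate[OF g]) (use T n in \<open>auto simp: poly_power\<close>)
  thus ?thesis
    using n algebraic_int_conjugate[OF g T(1)] by (auto simp: nilpotent_mod_def poly_power)
qed

definition adjoin :: "complex \<Rightarrow> complex set" where
  "adjoin a = {poly P a | P. P \<in> polys_over R}"

lemma subset_adjoin: "R \<subseteq> adjoin a"
proof
  fix c assume "c \<in> R"
  thus "c \<in> adjoin a" unfolding adjoin_def by (intro CollectI exI[of _ "[:c:]"]) auto
qed

lemma mem_adjoin: "a \<in> adjoin a"
proof -
  have "[:0, 1:] \<in> polys_over R" by (intro polys_over_pCons) auto
  thus ?thesis unfolding adjoin_def by (intro CollectI exI[of _ "[:0, 1:]"]) simp
qed

lemma inverse_eq_poly:
  assumes "is_minpoly h y" "y \<noteq> 0"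
  obtains Q where "Q \<in> polys_over R" "inverse y = poly Q y"
proof -
  obtain c h' where h: "h = pCons c h'" by (cases h)
  have h': "h \<in> polys_over R" "poly h y = 0" using assms(1) by (auto simp: is_minpoly_def)
  have "coeff h' i \<in> R" for i
    using polys_overD[OF h'(1), of "Suc i"] h by simp
  hence mem: "c \<in> R" "h' \<in> polys_over R"
    using polys_overD[OF h'(1), of 0] h by (auto simp: polys_over_def)
  have deg: "h' \<noteq> 0" "degree h' < degree h"
    using minpoly_degree_pos[OF assms(1)] h by (auto split: if_splits)
  have "c \<noteq> 0"
  proof
    assume "c = 0"
    hence "poly h' y = 0" using h h' assms(2) by simp
    thus False using deg mem assms(1) by (auto simp: is_minpoly_def)
  qed
  moreover have "c + y * poly h' y = 0" using h h' by simp
  ultimately have "inverse y = poly (smult (- inverse c) h') y"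
    using assms(2) by (simp add: field_simps add_eq_0_iff)
  moreover have "smult (- inverse c) h' \<in> polys_over R"
    by (rule polys_over_smult[OF uminus_closed[OF inverse_closed[OF mem(1)]] mem(2)])
  ultimately show ?thesis by (rule that[rotated])
qed

text \<open>For inverses: P(a) is a root of the product of X - P(s) over the conjugates s of a,
  which has coefficients in \<open>R\<close> because its power sums are traces. So P(a) has a
  minimal polynomial, and its inverse is a polynomial in P(a).\<close>

lemma complex_subfield_adjoin:
  assumes "is_minpoly g a"
  shows "complex_subfield (adjoin a)"
proof unfold_locales
  show "1 \<in> adjoin a" using subset_adjoin by auto
next
  fix x y assume "x \<in> adjoin a" "y \<in> adjoin a"
  then obtain P Q where PQ: "P \<in> polys_over R" "x = poly P a" "Q \<in> polys_over R" "y = poly Q a"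
    by (auto simp: adjoin_def)
  show "x - y \<in> adjoin a"
    unfolding adjoin_def using PQ by (intro CollectI exI[of _ "P - Q"]) auto
  show "x * y \<in> adjoin a"
    unfolding adjoin_def using PQ by (intro CollectI exI[of _ "P * Q"]) auto
next
  fix y assume "y \<in> adjoin a"
  then obtain P where P: "P \<in> polys_over R" "y = poly P a" by (auto simp: adjoin_def)
  show "inverse y \<in> adjoin a"
  proof (cases "y = 0")
    case False
    define q where "q = (\<Prod>s | poly g s = 0. [:- poly P s, 1:])"
    have q: "q \<in> polys_over R"
      unfolding q_def
    proof (rule prod_linear_closed)
      fix n show "(\<Sum>s | poly g s = 0. poly P s ^ n) \<in> R"
        using conjugate_trace_closed[OF assms, of "P ^ n"] P by (auto simp: poly_power)
    qed
    have fin: "finite {s. poly g s = 0}" by (rule minpoly_split(2)[OF assms])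
    have "q \<noteq> 0" using fin by (simp add: q_def)
    moreover have "poly q y = 0"
      using fin P assms by (auto simp: q_def poly_prod is_minpoly_def)
    ultimately obtain h where "is_minpoly h y" using minpoly_exists q by blast
    then obtain Q where "Q \<in> polys_over R" "inverse y = poly Q y" using inverse_eq_poly False by blast
    thus ?thesis unfolding adjoin_def using P
      by (auto simp: poly_pcompose intro!: exI[of _ "pcompose Q P"])
  qed (use subset_adjoin in auto)
qed

text \<open>
  The numbers \<open>m\<^sup>-\<^sup>1 c j\<close> below are the coefficients of the polynomial of degree less than \<open>m\<close> that takes the
  conjugates of \<open>poly P \<omega>\<close> as values at the conjugates of \<open>\<omega>\<close> and vanishes at the other \<open>m\<close>-th roots of unity.
\<close>

lemma unramified_adjoin_root_of_unity:
  assumes K: "unramified R p" and p: "p > 0" and m: "m > 0" "coprime m p"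
    and \<omega>: "\<omega> ^ m = 1" and g: "is_minpoly g \<omega>"
  shows "unramified (adjoin \<omega>) p"
  unfolding unramified_def
proof
  fix y assume "y \<in> adjoin \<omega> \<inter> nilpotent_mod p"
  hence y: "y \<in> nilpotent_mod p" and "y \<in> adjoin \<omega>" by simp_all
  then obtain P where P: "P \<in> polys_over R" "y = poly P \<omega>"
    unfolding adjoin_def by blast
  define S where "S = {s. poly g s = 0}"
  have fin: "finite S" using minpoly_split(2)[OF g] by (simp add: S_def)
  have \<omega>S: "\<omega> \<in> S" using g by (simp add: S_def is_minpoly_def)
  have root: "s ^ m = 1" if "s \<in> S" for s
  proof -
    have "poly (monom 1 m - 1) s = 0"
      by (rule minpoly_conjugate_root[OF g]) (use that \<omega> in \<open>auto simp: S_def poly_monom\<close>)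
    thus ?thesis by (simp add: poly_monom)
  qed
  \<comment> \<open>The trace of P(\<omega>) \<omega>^(-j), hence in \<open>R\<close>, and nilpotent
    modulo p as a sum of conjugates of nilpotent elements.\<close>
  define c where "c j = (\<Sum>s\<in>S. poly (P * monom 1 (m - j)) s)" for j
  have cR: "c j \<in> R" for j
    unfolding c_def S_def using P(1) by (intro conjugate_trace_closed[OF g]) auto
  have cnil: "c j \<in> nilpotent_mod p" for j
    unfolding c_def
  proof (rule nilpotent_mod_sum)
    fix s assume s: "s \<in> S"
    have "poly P s \<in> nilpotent_mod p"
      by (rule nilpotent_mod_conjugate[OF g]) (use s y P in \<open>auto simp: S_def\<close>)
    moreover have "algebraic_int s"
    proof (rule algebraic_int_root[of 1])
      show "poly (monom 1 m) s = 1" using root[OF s] by (simp add: poly_monom)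
      show "\<forall>i. coeff (monom (1::complex) m) i \<in> \<int>" by auto
      show "degree (monom (1::complex) m) > 0" "Polynomial.lead_coeff (monom (1::complex) m) = 1"
        using m by (simp_all add: degree_monom_eq)
    qed auto
    hence "algebraic_int (s ^ (m - j))"
      using AlgInt.power_closed[of s "m - j"] by simp
    ultimately show "poly (P * monom 1 (m - j)) s \<in> nilpotent_mod p"
      by (simp add: poly_monom nilpotent_mod_mult)
  qed
  \<comment> \<open>Inverse Fourier transform: the inner sum over j is m at s = \<omega> and 0 at
    every other conjugate.\<close>
  have "(\<Sum>j<m. c j / of_nat p * \<omega> ^ j) = (\<Sum>j<m. \<Sum>s\<in>S. poly P s / of_nat p * (s ^ (m - j) * \<omega> ^ j))"
    by (intro sum.cong refl)
      (simp add: c_def poly_monom sum_distrib_left sum_distrib_right sum_divide_distrib mult_ac)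
  also have "\<dots> = (\<Sum>s\<in>S. poly P s / of_nat p * (\<Sum>j<m. s ^ (m - j) * \<omega> ^ j))"
    by (subst sum.swap) (simp add: sum_distrib_left)
  also have "\<dots> = (\<Sum>s\<in>S. if s = \<omega> then poly P \<omega> / of_nat p * of_nat m else 0)"
  proof (intro sum.cong refl)
    fix s assume s: "s \<in> S"
    have s0: "s \<noteq> 0" using root[OF s] m by (auto simp: power_0_left)
    have "s ^ (m - j) * \<omega> ^ j = (\<omega> / s) ^ j" if "j < m" for j
    proof -
      have "s ^ (m - j) * s ^ j = 1" using that root[OF s] by (simp flip: power_add)
      hence "s ^ (m - j) = inverse (s ^ j)" using s0 by (simp add: field_simps)
      thus ?thesis using s0 by (simp add: power_divide field_simps)
    qed
    hence eq: "(\<Sum>j<m. s ^ (m - j) * \<omega> ^ j) = (\<Sum>j<m. (\<omega> / s) ^ j)" by simp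
    show "poly P s / of_nat p * (\<Sum>j<m. s ^ (m - j) * \<omega> ^ j)
        = (if s = \<omega> then poly P \<omega> / of_nat p * of_nat m else 0)"
    proof (cases "s = \<omega>")
      case True thus ?thesis using s0 unfolding eq by simp
    next
      case False
      hence "\<omega> / s \<noteq> 1" using s0 by simp
      moreover have "(\<omega> / s) ^ m = 1" using \<omega> root[OF s] by (simp add: power_divide)
      ultimately have "(\<Sum>j<m. (\<omega> / s) ^ j) = 0" by (simp add: geometric_sum)
      thus ?thesis using False unfolding eq by simp
    qed
  qed
  also have "\<dots> = of_nat m * (y / of_nat p)"
    using fin \<omega>S P by simp
  finally have "of_nat m * (y / of_nat p) = (\<Sum>j<m. c j / of_nat p * \<omega> ^ j)" by simp
  also have "\<dots> \<in> {x. algebraic_int x}"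
  proof (rule AlgInt.sum_closed, rule AlgInt.mult_closed)
    fix j
    show "c j / of_nat p \<in> {x. algebraic_int x}"
      using K cR cnil by (auto simp: unramified_def)
    have "algebraic_int \<omega>"
    proof (rule algebraic_int_root[of 1])
      show "poly (monom 1 m) \<omega> = 1" using \<omega> by (simp add: poly_monom)
      show "\<forall>i. coeff (monom (1::complex) m) i \<in> \<int>" by auto
      show "degree (monom (1::complex) m) > 0" "Polynomial.lead_coeff (monom (1::complex) m) = 1"
        using m by (simp_all add: degree_monom_eq)
    qed auto
    thus "\<omega> ^ j \<in> {x. algebraic_int x}" by (intro AlgInt.power_closed) simp
  qed
  finally have 1: "of_nat m * (y / of_nat p) \<in> {x. algebraic_int x}" .
  have 2: "of_nat p * (y / of_nat p) \<in> {x. algebraic_int x}"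
    using y p by (simp add: nilpotent_mod_def)
  \<comment> \<open>Both m (y/p) and p (y/p) = y are algebraic integers, and m is coprime to
    p.\<close>
  obtain u v :: int where uv: "u * int m + v * int p = 1"
    using m(2) bezout_int[of "int m" "int p"] by (auto simp: coprime_iff_gcd_eq_1)
  have "of_int u * (of_nat m * (y / of_nat p)) + of_int v * (of_nat p * (y / of_nat p))
      = of_int (u * int m + v * int p) * (y / of_nat p)"
    by (simp only: of_int_add of_int_mult of_int_of_nat_eq ring_distribs mult.assoc)
  moreover have "of_int u * (of_nat m * (y / of_nat p)) + of_int v * (of_nat p * (y / of_nat p)) \<in> {x. algebraic_int x}"
    by (rule AlgInt.add_closed[OF AlgInt.mult_closed[OF AlgInt.of_int_closed 1] AlgInt.mult_closed[OF AlgInt.of_int_closed 2]])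
  ultimately show "algebraic_int (y / of_nat p)" unfolding uv by simp
qed

section \<open>Irreducibility of cyclotomic polynomials over unramified fields\<close>

text \<open>The product over all nonzero exponents is p^(e+1). The multiples of p contribute p^e to
  it, since \<eta>^p is primitive of order p^e.\<close>

lemma primitive_root_prime_power_prod:
  assumes p: "prime p" and prim: "primitive_root_of_unity (p ^ Suc e) \<eta>"
  shows "(\<Prod>b\<in>{b\<in>{1..<p ^ Suc e}. coprime b p}. 1 - \<eta> ^ b) = of_nat p"
proof -
  define n where "n = p ^ Suc e"
  have p0: "p > 0" using p by (rule prime_gt_0_nat)
  have pow: "primitive_root_of_unity (p ^ e) (\<eta> ^ p)"
    using primitive_root_power_dvd[OF prim, of p "p ^ e"] by simp
  have "(\<Prod>b\<in>{b\<in>{1..<n}. \<not> coprime b p}. 1 - \<eta> ^ b) = (\<Prod>i\<in>{1..<p ^ e}. 1 - (\<eta> ^ p) ^ i)"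
  proof (rule prod.reindex_bij_witness[of _ "\<lambda>i. p * i" "\<lambda>b. b div p"])
    fix b assume b: "b \<in> {b\<in>{1..<n}. \<not> coprime b p}"
    hence "p dvd b" using p by (metis (no_types, lifting) coprime_commute mem_Collect_eq prime_imp_coprime_nat)
    thus "p * (b div p) = b" by simp
    have "p \<le> b" using b \<open>p dvd b\<close> by (intro dvd_imp_le) auto
    with b p0 show "b div p \<in> {1..<p ^ e}"
      by (auto simp: n_def Suc_le_eq div_greater_zero_iff intro!: less_mult_imp_div_less) (simp add: mult.commute)
    show "1 - (\<eta> ^ p) ^ (b div p) = 1 - \<eta> ^ b"
      using \<open>p dvd b\<close> by (simp flip: power_mult)
  next
    fix i assume "i \<in> {1..<p ^ e}"
    thus "p * i div p = i" "p * i \<in> {b\<in>{1..<n}. \<not> coprime b p}"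
      using p0 p by (auto simp: n_def dest: prime_gt_1_nat)
  qed
  also have "\<dots> = of_nat (p ^ e)"
    by (rule primitive_root_prod_one_minus[OF pow])
  finally have "(\<Prod>b\<in>{b\<in>{1..<n}. \<not> coprime b p}. 1 - \<eta> ^ b) = of_nat (p ^ e)" .
  moreover have "(\<Prod>b\<in>{1..<n}. 1 - \<eta> ^ b) = of_nat n"
    unfolding n_def by (rule primitive_root_prod_one_minus[OF prim])
  moreover have "(\<Prod>b\<in>{1..<n}. 1 - \<eta> ^ b) = (\<Prod>b\<in>{b\<in>{1..<n}. coprime b p}. 1 - \<eta> ^ b) * (\<Prod>b\<in>{b\<in>{1..<n}. \<not> coprime b p}. 1 - \<eta> ^ b)"
    by (subst prod.union_disjoint[symmetric]) (auto intro!: prod.cong)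
  ultimately show ?thesis
    using p0 by (simp add: n_def)
qed

text \<open>
  Total ramification of \<open>p\<close> in the field of \<open>p\<^sup>e\<close>-th roots of unity: if the minimal polynomial \<open>g\<close> of \<open>\<eta>\<close>
  missed some primitive root, \<open>poly g 1\<close> would be nilpotent modulo \<open>p\<close> without being divisible by \<open>p\<close>.
\<close>

lemma minpoly_root_of_unity_prime_power:
  assumes F: "unramified R p" and p: "prime p" and prim: "primitive_root_of_unity (p ^ Suc e) \<eta>"
    and g: "is_minpoly g \<eta>" and b: "coprime b p"
  shows "poly g (\<eta> ^ b) = 0"
proof -
  define n where "n = p ^ Suc e"
  \<comment> \<open>\<open>U\<close> indexes the primitive roots and \<open>T\<close> those among
    them that are roots of \<open>g\<close>; the aim is T = U.\<close>
  define U where "U = {b\<in>{1..<n}. coprime b p}"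
  define T where "T = {b\<in>U. poly g (\<eta> ^ b) = 0}"
  note prim' = prim[folded n_def]
  have p1: "p > 1" using p by (rule prime_gt_1_nat)
  have n1: "n > 1" unfolding n_def using p1 by (intro one_less_power) auto
  have cop: "coprime b n \<longleftrightarrow> coprime b p" for b
    unfolding n_def coprime_power_right_iff by simp
  have finU: "finite U" by (simp add: U_def)
  have U1: "1 \<in> U" using n1 by (simp add: U_def)
  have T1: "1 \<in> T" using U1 g by (simp add: T_def is_minpoly_def)
  have TU: "T \<subseteq> U" by (auto simp: T_def)
  have finT: "finite T" using TU finU finite_subset by blast
  have nz: "1 - \<eta> ^ b \<noteq> 0" if "b \<in> U" for b
    using that n1 by (auto simp: U_def primitive_root_power_eq_1_iff[OF prim'] dest: dvd_imp_le)
  have prodU: "(\<Prod>b\<in>U. 1 - \<eta> ^ b) = of_nat p"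
    unfolding U_def n_def by (rule primitive_root_prime_power_prod[OF p prim])
  have AI: "1 - \<eta> ^ b \<in> {x. algebraic_int x}" for b
    by (rule AlgInt.diff_closed[OF AlgInt.one_closed]) (simp add: algebraic_int_primitive_root[OF prim'])
  have roots: "{s. poly g s = 0} = (\<lambda>b. \<eta> ^ b) ` T"
  proof
    show "(\<lambda>b. \<eta> ^ b) ` T \<subseteq> {s. poly g s = 0}" by (auto simp: T_def)
    show "{s. poly g s = 0} \<subseteq> (\<lambda>b. \<eta> ^ b) ` T"
    proof
      fix s assume "s \<in> {s. poly g s = 0}"
      hence s: "poly g s = 0" by simp
      have \<eta>s: "poly g \<eta> = 0" using g by (simp add: is_minpoly_def)
      have "poly (monom 1 n - 1) s = 0"
        
        by (rule minpoly_conjugate_root[OF g s]) (use primitive_root_power_eq_1_iff[OF prim', of n] in \<open>auto simp: poly_monom\<close>)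
      hence "s \<in> {s. s ^ n = 1}" by (simp add: poly_monom)
      then obtain b where b: "b < n" "s = \<eta> ^ b"
        unfolding primitive_root_range[OF prim', symmetric] by auto
      \<comment> \<open>Conjugates have equal order: if s satisfied X^(p^e) = 1, so would
        \<eta>.\<close>
      have "coprime b p"
      proof (rule ccontr)
        assume "\<not> coprime b p"
        hence "p dvd b" using p by (metis coprime_commute prime_imp_coprime_nat)
        hence "n dvd b * p ^ e" by (auto simp: n_def intro: mult_dvd_mono)
        hence "s ^ (p ^ e) = 1"
          by (simp add: b(2) primitive_root_power_eq_1_iff[OF prim'] flip: power_mult)
        hence "poly (monom 1 (p ^ e) - 1) s = 0" by (simp add: poly_monom)
        hence "poly (monom 1 (p ^ e) - 1) \<eta> = 0"
          by (rule minpoly_conjugate_root[OF minpoly_conjugate[OF g s] \<eta>s, rotated]) auto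
        hence "n dvd p ^ e"
          by (simp add: poly_monom primitive_root_power_eq_1_iff[OF prim'])
        hence "p * p ^ e \<le> p ^ e" using p1 by (intro dvd_imp_le) (auto simp: n_def)
        thus False using p1 by simp
      qed
      moreover have "b \<noteq> 0" using \<open>coprime b p\<close> p1 by (cases "b = 0") auto
      ultimately have "b \<in> T" using b s by (auto simp: T_def U_def)
      thus "s \<in> (\<lambda>b. \<eta> ^ b) ` T" using b by blast
    qed
  qed
  define y where "y = poly g 1"
  have y_eq: "y = (\<Prod>b\<in>T. 1 - \<eta> ^ b)"
  proof -
    have inj: "inj_on (\<lambda>b. \<eta> ^ b) T"
      by (rule inj_on_subset[OF primitive_root_inj[OF prim']]) (auto simp: T_def U_def)
    have "g = (\<Prod>s\<in>(\<lambda>b. \<eta> ^ b) ` T. [:- s, 1:])"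
      using minpoly_split(1)[OF g] unfolding roots .
    thus ?thesis
      unfolding y_def by (simp add: poly_prod prod.reindex[OF inj])
  qed
  have yR: "y \<in> R" unfolding y_def using g by (auto simp: is_minpoly_def)
  have "T = U"
  proof (rule ccontr)
    assume "T \<noteq> U"
    then obtain b0 where b0: "b0 \<in> U" "b0 \<notin> T" using TU by blast
    \<comment> \<open>The factors 1 - \<eta>^b with b in U multiply to p, and each of them divides 1
      - \<eta>^a. So p divides the power of 1 - \<eta>^a with exponent \<open>card U\<close>; as 1 -
      \<eta> divides y, y is nilpotent modulo p.\<close>
    have quot: "(\<Prod>b\<in>U. (1 - \<eta> ^ a) / (1 - \<eta> ^ b)) \<in> {x. algebraic_int x}" for a
      using algebraic_int_cyclotomic_unit[OF prim' _ n1] by (intro AlgInt.prod_closed) (auto simp: U_def cop)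
    have "y \<in> {x. algebraic_int x}"
      unfolding y_eq by (intro AlgInt.prod_closed AI)
    moreover have "y ^ card U / of_nat p \<in> {x. algebraic_int x}"
    proof -
      have "y = (1 - \<eta>) * (\<Prod>b\<in>T - {1}. 1 - \<eta> ^ b)"
        unfolding y_eq using prod.remove[OF finT T1, of "\<lambda>b. 1 - \<eta> ^ b"] by simp
      hence "y ^ card U / of_nat p = (\<Prod>b\<in>T - {1}. 1 - \<eta> ^ b) ^ card U * (\<Prod>b\<in>U. (1 - \<eta> ^ 1) / (1 - \<eta> ^ b))"
        by (simp add: power_mult_distrib prod_dividef prodU)
      also have "\<dots> \<in> {x. algebraic_int x}"
        by (rule AlgInt.mult_closed[OF AlgInt.power_closed[OF AlgInt.prod_closed[OF AI]] quot])
      finally show ?thesis .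
    qed
    ultimately have "y \<in> nilpotent_mod p"
      using U1 finU by (auto simp: nilpotent_mod_def card_gt_0_iff intro!: exI[of _ "card U"])
    hence yp: "y / of_nat p \<in> {x. algebraic_int x}"
      using F yR by (auto simp: unramified_def)
    \<comment> \<open>On the other hand p is y (1 - \<eta>^b0) times an algebraic integer. If y/p
      were integral, 1 - \<eta>^b0 would be a unit, and then p as well.\<close>
    have "(\<Prod>b\<in>U. 1 - \<eta> ^ b) = y * (\<Prod>b\<in>U - T. 1 - \<eta> ^ b)"
      unfolding y_eq using prod.subset_diff[OF TU finU, of "\<lambda>b. 1 - \<eta> ^ b"] by (simp add: mult.commute)
    also have "(\<Prod>b\<in>U - T. 1 - \<eta> ^ b) = (1 - \<eta> ^ b0) * (\<Prod>b\<in>U - T - {b0}. 1 - \<eta> ^ b)"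
      using b0 finU by (subst prod.remove[of _ b0]) auto
    finally have "of_nat p = y * ((1 - \<eta> ^ b0) * (\<Prod>b\<in>U - T - {b0}. 1 - \<eta> ^ b))"
      by (simp add: prodU)
    hence "y / of_nat p * (\<Prod>b\<in>U - T - {b0}. 1 - \<eta> ^ b) = 1 / (1 - \<eta> ^ b0)"
      using p1 nz[OF b0(1)] by (simp add: field_simps)
    moreover have "y / of_nat p * (\<Prod>b\<in>U - T - {b0}. 1 - \<eta> ^ b) \<in> {x. algebraic_int x}"
      by (rule AlgInt.mult_closed[OF yp AlgInt.prod_closed[OF AI]])
    ultimately have inv: "1 / (1 - \<eta> ^ b0) \<in> {x. algebraic_int x}" by simp
    have "1 / of_nat p = (1 / (1 - \<eta> ^ b0)) ^ card U * (\<Prod>b\<in>U. (1 - \<eta> ^ b0) / (1 - \<eta> ^ b))"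
      using nz[OF b0(1)] by (simp add: prod_dividef prodU power_divide)
    also have "\<dots> \<in> {x. algebraic_int x}"
      by (rule AlgInt.mult_closed[OF AlgInt.power_closed[OF inv] quot])
    finally have "algebraic_int (1 / of_nat p :: complex)" by simp
    hence "(1 / of_nat p :: complex) \<in> \<int>"
      by (rule rational_algebraic_int_is_int) auto
    then obtain k where k: "1 / of_nat p = (of_int k :: complex)" by (elim Ints_cases)
    hence "of_int (k * int p) = (1 :: complex)" using p1 by (simp add: field_simps)
    hence "k * int p = 1" by (metis of_int_eq_1_iff)
    hence "int p = 1" using p1 by (simp add: zmult_eq_1_iff)
    thus False using p1 by simp
  qed
  have "\<eta> ^ b = \<eta> ^ (b mod n)"
    by (rule primitive_root_power_cong[OF prim']) (simp add: unique_euclidean_semiring_class.cong_def)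
  moreover have "b mod n \<in> U"
  proof -
    have "coprime b n" using b by (simp add: cop)
    hence "coprime (b mod n) n" using n1 by (subst coprime_mod_left_iff) auto
    moreover from this have "b mod n \<noteq> 0" using n1 by (cases "b mod n = 0") auto
    ultimately show ?thesis using n1 by (simp add: U_def cop)
  qed
  ultimately show ?thesis using \<open>T = U\<close> by (auto simp: T_def)
qed

text \<open>Write \<zeta> = \<omega> \<eta>, where \<omega>^m = 1 and \<eta> has order p^(e+1). As p
  does not divide m, R(\<omega>) is still unramified at p, and over it \<eta> is conjugate to
  \<eta>^b; the congruence modulo m keeps \<omega> fixed.\<close>

lemma root_of_unity_conjugate_step:
  assumes K: "unramified R p" and p: "prime p" and cop: "coprime p m"
    and prim: "primitive_root_of_unity (p ^ Suc e * m) \<zeta>"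
    and b: "[b = 1] (mod m)" "coprime b p"
    and P: "P \<in> polys_over R" "poly P \<zeta> = 0"
  shows "poly P (\<zeta> ^ b) = 0"
proof -
  define n where "n = p ^ Suc e"
  note prim' = prim[folded n_def]
  have cop': "coprime n m" unfolding n_def using cop by simp
  have m0: "m > 0" and n0: "n > 0" using primitive_root_order_pos[OF prim'] by auto
  obtain u where u: "[u = 0] (mod n)" "[u = 1] (mod m)"
    using binary_chinese_remainder_nat[OF cop'] by blast
  obtain v where v: "[v = 1] (mod n)" "[v = 0] (mod m)"
    using binary_chinese_remainder_nat[OF cop'] by blast
  define \<omega> where "\<omega> = \<zeta> ^ u"
  define \<eta> where "\<eta> = \<zeta> ^ v"
  have "[u + v = 1] (mod n * m)"
  proof (rule coprime_cong_mult_nat[OF _ _ cop'])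
    show "[u + v = 1] (mod n)" using cong_add[OF u(1) v(1)] by simp
    show "[u + v = 1] (mod m)" using cong_add[OF u(2) v(2)] by simp
  qed
  from primitive_root_power_cong[OF prim' this] have \<zeta>: "\<zeta> = \<omega> * \<eta>"
    by (simp add: \<omega>_def \<eta>_def power_add)
  have \<omega>m: "\<omega> ^ m = 1"
    using u(1) by (simp add: \<omega>_def primitive_root_power_eq_1_iff[OF prim'] cong_0_iff flip: power_mult)
  have prim\<eta>: "primitive_root_of_unity (p ^ Suc e) \<eta>"
    unfolding n_def[symmetric] primitive_root_of_unity_def
  proof (intro conjI allI n0)
    fix k
    have "\<eta> ^ k = 1 \<longleftrightarrow> n * m dvd v * k"
      by (simp add: \<eta>_def primitive_root_power_eq_1_iff[OF prim'] flip: power_mult)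
    also have "\<dots> \<longleftrightarrow> n dvd k"
    proof
      assume "n * m dvd v * k"
      hence "[v * k = 0] (mod n)" by (metis cong_0_iff dvd_mult_left)
      moreover have "[v * k = 1 * k] (mod n)" by (rule cong_scalar_right[OF v(1)])
      ultimately show "n dvd k" by (metis cong_0_iff cong_sym cong_trans mult_1)
    next
      assume "n dvd k"
      moreover have "m dvd v" using v(2) by (simp add: cong_0_iff)
      ultimately show "n * m dvd v * k" by (metis mult.commute mult_dvd_mono)
    qed
    finally show "\<eta> ^ k = 1 \<longleftrightarrow> n dvd k" .
  qed
  have xm: "monom 1 k - 1 \<in> polys_over R" "monom 1 k - (1 :: complex poly) \<noteq> 0" if "k > 0" for k
  proof -
    have "coeff (monom 1 k - (1 :: complex poly)) k = 1" using that by (simp add: coeff_1)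
    thus "monom 1 k - (1 :: complex poly) \<noteq> 0" by (metis coeff_0 zero_neq_one)
  qed auto
  obtain g where g: "is_minpoly g \<omega>"
    using minpoly_exists[OF xm[OF m0], of \<omega>] \<omega>m by (auto simp: poly_monom)
  interpret F: complex_subfield "adjoin \<omega>" by (rule complex_subfield_adjoin[OF g])
  have "unramified (adjoin \<omega>) p"
    using cop prime_gt_0_nat[OF p]
    by (intro unramified_adjoin_root_of_unity[OF K _ m0 _ \<omega>m g]) (auto simp: coprime_commute)
  moreover have "\<eta> ^ n = 1" by (simp add: n_def primitive_root_power_eq_1_iff[OF prim\<eta>])
  hence "poly (monom 1 n - 1) \<eta> = 0" by (simp add: poly_monom)
  with polys_over_mono[OF subset_adjoin xm(1)[OF n0]] xm(2)[OF n0]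
  obtain f where f: "F.is_minpoly f \<eta>" by (rule F.minpoly_exists)
  ultimately have "poly f (\<eta> ^ b) = 0"
    using F.minpoly_root_of_unity_prime_power[OF _ p prim\<eta> _ b(2)] by blast
  \<comment> \<open>P(\<omega> X) is a polynomial over R(\<omega>) with root \<eta>; its value at
    \<eta>^b is the wanted one because \<omega>^b = \<omega>.\<close>
  moreover have "pcompose P [:0, \<omega>:] \<in> polys_over (adjoin \<omega>)"
    using polys_over_mono[OF subset_adjoin P(1)] mem_adjoin by (intro F.polys_over_pcompose) auto
  moreover have "poly (pcompose P [:0, \<omega>:]) \<eta> = 0"
    using P(2) by (simp add: poly_pcompose \<zeta> mult.commute)
  ultimately have "poly (pcompose P [:0, \<omega>:]) (\<eta> ^ b) = 0"
    using F.minpoly_conjugate_root[OF f] by blast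
  moreover have "\<omega> ^ b = \<omega>"
  proof -
    have "[u * b = u * 1] (mod n * m)"
    proof (rule coprime_cong_mult_nat[OF _ _ cop'])
      show "[u * b = u * 1] (mod n)"
      proof (rule cong_trans[OF _ cong_sym])
        show "[u * b = 0] (mod n)" "[u * 1 = 0] (mod n)"
          using u(1) by (simp_all add: cong_0_iff)
      qed
      show "[u * b = u * 1] (mod m)" by (rule cong_scalar_left[OF b(1)])
    qed
    from primitive_root_power_cong[OF prim' this] show ?thesis by (simp add: \<omega>_def power_mult)
  qed
  ultimately show ?thesis
    by (simp add: poly_pcompose \<zeta> power_mult_distrib mult.commute)
qed

text \<open>By the Chinese remainder theorem, raising to the power b is a composition of power maps,
  each of which is nontrivial modulo a single prime power.\<close>

theorem root_of_unity_conjugate: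
  assumes K: "\<And>p. prime p \<Longrightarrow> p dvd m \<Longrightarrow> unramified R p"
    and prim: "primitive_root_of_unity m \<zeta>" and b: "coprime b m"
    and P: "P \<in> polys_over R" "poly P \<zeta> = 0"
  shows "poly P (\<zeta> ^ b) = 0"
proof -
  \<comment> \<open>In the induction n is the part of m on which b may differ from 1.\<close>
  have "poly P (\<zeta> ^ b) = 0" if "m = n * n'" "coprime n n'" "[b = 1] (mod n')" "coprime b m" for n n' b
    using that
  proof (induction n arbitrary: n' b rule: less_induct)
    case (less n)
    have m0: "m > 0" by (rule primitive_root_order_pos[OF prim])
    show ?case
    proof (cases "n = 1")
      case True
      hence "\<zeta> ^ b = \<zeta> ^ 1"
        using less.prems by (intro primitive_root_power_cong[OF prim]) auto
      thus ?thesis using P by simp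
    next
      case False
      then obtain p where p: "prime p" "p dvd n" by (metis prime_factor_nat)
      have n0: "n > 0" using less.prems m0 by (intro Nat.gr0I) auto
      then obtain e n1 where n: "n = p ^ e * n1" "\<not> p dvd n1"
        using p by (metis multiplicity_decompose' not_prime_unit gr_implies_not0)
      with p obtain e' where e: "e = Suc e'" by (cases e) auto
      have pn1: "coprime p n1" using p n by (simp add: prime_imp_coprime_nat)
      have n1: "n1 < n" "n1 > 0" using n n0 p e prime_gt_1_nat[OF p(1)]
        by (auto simp: less_1_mult intro!: Nat.gr0I) (metis One_nat_def less_1_mult one_less_power zero_less_Suc mult.commute mult.right_neutral mult_less_cancel1 power_Suc)
      have cn: "coprime (p ^ e) n'" "coprime n1 n'"
        using less.prems(2) by (auto simp: n(1))
      have c1: "coprime n1 (p ^ e * n')" and c2: "coprime (p ^ e) (n1 * n')"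
        using cn pn1 by (auto simp: coprime_commute)
      \<comment> \<open>\<open>d\<close> acts like b modulo n1 and \<open>c\<close> acts like b
        modulo p^e, so that d c = b modulo m; the prime power step is then applied at the primitive
        root \<zeta>^d.\<close>
      obtain d where d: "[d = b] (mod n1)" "[d = 1] (mod p ^ e * n')"
        using binary_chinese_remainder_nat[OF c1] by blast
      obtain c where c: "[c = b] (mod p ^ e)" "[c = 1] (mod n1 * n')"
        using binary_chinese_remainder_nat[OF c2] by blast
      have bn: "coprime b n1" "coprime b (p ^ e)"
        using less.prems(4) by (auto simp: less.prems(1) n(1))
      have m: "m = n1 * (p ^ e * n')" "m = p ^ Suc e' * (n1 * n')"
        by (simp_all add: less.prems(1) n(1) e)
      have "coprime d n1" using d(1) bn(1) by (metis cong_imp_coprime cong_sym)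
      moreover have "coprime d (p ^ e * n')" using d(2) by (metis cong_imp_coprime cong_sym coprime_1_left)
      ultimately have dm: "coprime d m" by (simp add: m(1))
      have "coprime c (p ^ e)" using c(1) bn(2) by (metis cong_imp_coprime cong_sym)
      hence cp: "coprime c p" by (simp add: e)
      have pm: "p dvd m" by (simp add: m(2))
      have pn: "coprime p (n1 * n')" using pn1 cn(1) by (simp add: e)
      have prim_d: "primitive_root_of_unity (p ^ Suc e' * (n1 * n')) (\<zeta> ^ d)"
        using primitive_root_power_coprime[OF prim dm] unfolding m(2) .
      have "poly P (\<zeta> ^ d) = 0"
        by (rule less.IH[OF n1(1) m(1) c1 d(2) dm])
      hence "poly P ((\<zeta> ^ d) ^ c) = 0"
        by (rule root_of_unity_conjugate_step[OF K[OF p(1) pm] p(1) pn prim_d c(2) cp P(1)])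
      moreover have "[d * c = b] (mod n1 * (p ^ e * n'))"
      proof (rule coprime_cong_mult_nat[OF _ _ c1])
        have "[c = 1] (mod n1)" using c(2) by (rule cong_modulus_mult_nat)
        thus "[d * c = b] (mod n1)" using cong_mult[OF d(1)] by fastforce
        show "[d * c = b] (mod p ^ e * n')"
        proof (rule coprime_cong_mult_nat[OF _ _ cn(1)])
          have "[d = 1] (mod p ^ e)" using d(2) by (rule cong_modulus_mult_nat)
          thus "[d * c = b] (mod p ^ e)" using cong_mult[OF _ c(1)] by fastforce
          have "[d = 1] (mod n')" using d(2) by (metis cong_modulus_mult_nat mult.commute)
          moreover have "[c = 1] (mod n')" using c(2) by (metis cong_modulus_mult_nat mult.commute)
          ultimately have "[d * c = 1 * 1] (mod n')" by (rule cong_mult)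
          thus "[d * c = b] (mod n')" using less.prems(3) by (metis cong_sym cong_trans mult_1)
        qed
      qed
      ultimately show ?thesis
        using primitive_root_power_cong[OF prim, of "d * c" b] by (simp add: m(1) power_mult)
    qed
  qed
  from this[of m 1 b] show ?thesis using b by simp
qed

end

section \<open>Number fields\<close>

interpretation CF: Ring.ring complex_field
  by (rule ring_from_type_algebra)

lemma complex_field_simps [simp]:
  "carrier complex_field = UNIV" "x \<otimes>\<^bsub>complex_field\<^esub> y = x * y" "x \<oplus>\<^bsub>complex_field\<^esub> y = x + y"
  "\<one>\<^bsub>complex_field\<^esub> = 1" "\<zero>\<^bsub>complex_field\<^esub> = 0"
  by (simp_all add: ring_of_type_algebra_def)

lemma complex_subfield_of_subfield:
  assumes "subfield K complex_field"
  shows "complex_subfield K"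
proof -
  have uminus: "\<ominus>\<^bsub>complex_field\<^esub> x = - x" for x :: complex
    by (rule CF.minus_equality) simp_all
  note K = subringE[OF subfieldE(1)[OF assms], simplified uminus complex_field_simps]
  show ?thesis
  proof unfold_locales
    show "1 \<in> K" by (rule K)
    fix x y assume xy: "x \<in> K" "y \<in> K"
    show "x * y \<in> K" by (rule K(6)[OF xy])
    have "x + - y \<in> K" by (rule K(7)[OF xy(1) K(5)[OF xy(2)]])
    thus "x - y \<in> K" by simp
  next
    fix x assume x: "x \<in> K"
    show "inverse x \<in> K"
    proof (cases "x = 0")
      case True
      thus ?thesis using x by simp
    next
      case False
      hence "x \<in> K - {\<zero>\<^bsub>complex_field\<^esub>}" using x by simp
      note inv = CF.subfield_m_inv[OF assms this, simplified]
      from inv(2) have "inv\<^bsub>complex_field\<^esub> x = inverse x"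
        using False by (simp add: field_simps)
      thus ?thesis using inv(1) by simp
    qed
  qed
qed

lemma combine_eq_sum:
  "length Ks = length Us \<Longrightarrow> CF.combine Ks Us = (\<Sum>i<length Us. Ks ! i * Us ! i)"
proof (induction Ks Us rule: list_induct2)
  case (Cons k Ks u Us)
  have "CF.combine (k # Ks) (u # Us) = k * u + (\<Sum>i<length Us. Ks ! i * Us ! i)"
    using Cons.IH by simp
  thus ?case by (simp add: sum.lessThan_Suc_shift del: sum.lessThan_Suc)
qed simp

lemma trivial_sum_imp_independent:
  assumes "subfield K complex_field"
    and triv: "\<And>c. (\<And>i. i < length Us \<Longrightarrow> c i \<in> K) \<Longrightarrow> (\<Sum>i<length Us. c i * Us ! i) = 0 \<Longrightarrow>
      (\<forall>i<length Us. c i = 0)"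
  shows "CF.independent K Us"
proof (rule CF.trivial_combine_imp_independent[OF assms(1)])
  interpret K: complex_subfield K by (rule complex_subfield_of_subfield[OF assms(1)])
  fix Ks assume Ks: "set Ks \<subseteq> K" "CF.combine Ks Us = \<zero>\<^bsub>complex_field\<^esub>"
  \<comment> \<open>Coefficient lists of any length may occur and \<open>combine\<close> ignores the
    surplus; cutting and padding with zeros gives them the length of \<open>Us\<close>.\<close>
  define Ks' where "Ks' = take (length Us) Ks @ replicate (length Us - length Ks) 0"
  have len: "length Ks' = length Us" by (simp add: Ks'_def)
  have "CF.combine Ks' Us = CF.combine Ks Us"
  proof -
    have "CF.combine (Ls @ replicate m 0) Vs = CF.combine Ls Vs"
      if "set Ls \<subseteq> K" for Ls Vs :: "complex list" and m
      using that
    proof (induction Ls arbitrary: Vs)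
      case Nil
      show ?case
      proof (induction m arbitrary: Vs)
        case (Suc m) thus ?case by (cases Vs) simp_all
      qed simp
    next
      case (Cons l Ls) thus ?case by (cases Vs) simp_all
    qed
    moreover have "set (take (length Us) Ks) \<subseteq> K" using Ks(1) set_take_subset by fast
    moreover have "CF.combine (take (length Us) Ks) Us = CF.combine Ks Us"
      using CF.combine_take[of Us Ks] by simp
    ultimately show ?thesis by (simp add: Ks'_def)
  qed
  hence "(\<Sum>i<length Us. Ks' ! i * Us ! i) = 0"
    using Ks(2) combine_eq_sum[OF len] by simp
  moreover have "Ks' ! i \<in> K" if "i < length Us" for i
  proof -
    have "Ks' ! i \<in> set Ks'" using that len by simp
    also have "\<dots> \<subseteq> K" using Ks(1) set_take_subset[of "length Us" Ks] by (auto simp: Ks'_def)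
    finally show ?thesis .
  qed
  ultimately have "\<forall>i<length Us. Ks' ! i = 0" by (intro triv) auto
  hence "set Ks' \<subseteq> {0}" using len by (auto simp: in_set_conv_nth)
  thus "set (take (length Us) Ks) \<subseteq> {\<zero>\<^bsub>complex_field\<^esub>}"
    by (auto simp: Ks'_def)
qed simp

lemma subfield_Rats: "subfield \<rat> complex_field"
proof (rule field.subfieldI'[OF field_from_type_algebra])
  have "\<ominus>\<^bsub>complex_field\<^esub> x = - x" for x :: complex
    by (rule CF.minus_equality) simp_all
  thus "subring \<rat> complex_field"
    by (intro CF.subringI) auto
  fix x :: complex assume x: "x \<in> \<rat> - {\<zero>\<^bsub>complex_field\<^esub>}"
  have "inv\<^bsub>complex_field\<^esub> x = inverse x"
    by (rule CF.inv_char) (use x in auto)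
  thus "inv\<^bsub>complex_field\<^esub> x \<in> \<rat>" using x by simp
qed

text \<open>The powers 1, x, ..., x^n of a transcendental x would be n + 1 independent elements in
  dimension n.\<close>

lemma number_field_imp_algebraic:
  assumes "number_field K" "x \<in> K"
  shows "algebraic x"
proof (rule ccontr)
  assume nalg: "\<not> algebraic x"
  interpret K: complex_subfield K
    using assms(1) by (intro complex_subfield_of_subfield) (simp add: number_field_def)
  obtain n where n: "CF.dimension n \<rat> K"
    using assms(1) by (auto simp: number_field_def CF.finite_dimension_def)
  define Us where "Us = map (\<lambda>i. x ^ i) [0..<Suc n]"
  have "CF.independent \<rat> Us"
  proof (rule trivial_sum_imp_independent[OF subfield_Rats])
    fix c :: "nat \<Rightarrow> complex"
    assume c: "\<And>i. i < length Us \<Longrightarrow> c i \<in> \<rat>" and sum: "(\<Sum>i<length Us. c i * Us ! i) = 0"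
    define p where "p = (\<Sum>i<Suc n. monom (c i) i)"
    have cp: "coeff p i = (if i < Suc n then c i else 0)" for i
      by (simp add: p_def coeff_sum del: sum.lessThan_Suc)
    have "poly p x = 0"
      using sum by (simp add: p_def poly_sum poly_monom Us_def del: upt_Suc sum.lessThan_Suc)
    moreover have "\<forall>i. coeff p i \<in> \<rat>" using c by (auto simp: cp Us_def)
    ultimately have "p = 0" using nalg by (auto simp: algebraic_altdef)
    hence "c i = 0" if "i < Suc n" for i
      using cp[of i] that by simp
    thus "\<forall>i<length Us. c i = 0" by (simp add: Us_def)
  qed
  moreover have "set Us \<subseteq> K" using assms(2) by (auto simp: Us_def)
  ultimately have "length Us \<le> n"
    using CF.independent_length_le_dimension[OF subfield_Rats n] by blast
  thus False by (simp add: Us_def)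
qed

text \<open>With \<gamma> = \<alpha> + c \<beta>, the number c is chosen so that g and f(\<gamma> -
  c X) share only the root \<beta>. The minimal polynomial of \<beta> over the field of \<gamma>
  divides both and is therefore linear.\<close>

lemma primitive_element:
  assumes "algebraic (\<alpha> :: complex)" "algebraic \<beta>"
  obtains c :: nat where "\<alpha> \<in> Rats.adjoin (\<alpha> + of_nat c * \<beta>)" "\<beta> \<in> Rats.adjoin (\<alpha> + of_nat c * \<beta>)"
proof -
  obtain f where f: "Rats.is_minpoly f \<alpha>" using algebraic_minpoly[OF assms(1)] .
  obtain g where g: "Rats.is_minpoly g \<beta>" using algebraic_minpoly[OF assms(2)] .
  \<comment> \<open>The finitely many values of c to avoid. Pairs with b = \<beta> give 0 by the
    convention on division, which merely forbids c = 0.\<close>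
  define A where "A = (\<lambda>(a, b). (a - \<alpha>) / (\<beta> - b)) ` ({a. poly f a = 0} \<times> {b. poly g b = 0})"
  have "finite A"
    unfolding A_def by (intro finite_imageI finite_cartesian_product Rats.minpoly_split(2)[OF f] Rats.minpoly_split(2)[OF g])
  moreover have "infinite (range (of_nat :: nat \<Rightarrow> complex))"
    by (rule range_inj_infinite) (simp add: inj_on_def)
  ultimately obtain c :: nat where c: "of_nat c \<notin> A"
    by (metis finite_subset image_subsetI)
  define \<gamma> where "\<gamma> = \<alpha> + of_nat c * \<beta>"
  have "of_nat c * \<beta> \<in> {x. algebraic x}"
    by (rule Alg.mult_closed[OF Alg.of_nat_closed]) (use assms in simp)
  hence "algebraic \<gamma>"
    using Alg.add_closed[of \<alpha>] assms by (simp add: \<gamma>_def)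
  then obtain h0 where "Rats.is_minpoly h0 \<gamma>" by (rule algebraic_minpoly)
  then interpret L: complex_subfield "Rats.adjoin \<gamma>" by (rule Rats.complex_subfield_adjoin)
  have over: "p \<in> polys_over (Rats.adjoin \<gamma>)" if "p \<in> polys_over \<rat>" for p
    using that by (rule polys_over_mono[OF Rats.subset_adjoin])
  have \<gamma>: "\<gamma> \<in> Rats.adjoin \<gamma>" by (rule Rats.mem_adjoin)
  have fg: "f \<in> polys_over \<rat>" "poly f \<alpha> = 0" "g \<in> polys_over \<rat>" "poly g \<beta> = 0" "g \<noteq> 0"
    using f g by (auto simp: Rats.is_minpoly_def)
  obtain h where h: "L.is_minpoly h \<beta>"
    using L.minpoly_exists[OF over[OF fg(3)] fg(5,4)] by blast
  have "{s. poly h s = 0} = {\<beta>}"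
  proof (intro equalityI subsetI)
    fix s assume "s \<in> {s. poly h s = 0}"
    hence s: "poly h s = 0" by simp
    have gs: "poly g s = 0"
      by (rule L.minpoly_conjugate_root[OF h s over[OF fg(3)] fg(4)])
    have "poly (pcompose f [:\<gamma>, - of_nat c:]) s = 0"
    proof (rule L.minpoly_conjugate_root[OF h s])
      show "pcompose f [:\<gamma>, - of_nat c:] \<in> polys_over (Rats.adjoin \<gamma>)"
        using over[OF fg(1)] \<gamma> by (intro L.polys_over_pcompose) auto
      show "poly (pcompose f [:\<gamma>, - of_nat c:]) \<beta> = 0"
        using fg(2) by (simp add: poly_pcompose \<gamma>_def mult.commute)
    qed
    hence fs: "poly f (\<gamma> - of_nat c * s) = 0"
      by (simp add: poly_pcompose mult.commute)
    have "s = \<beta>"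
    proof (rule ccontr)
      assume "s \<noteq> \<beta>"
      hence "of_nat c = (\<gamma> - of_nat c * s - \<alpha>) / (\<beta> - s)"
        by (simp add: \<gamma>_def field_simps)
      hence "of_nat c \<in> A"
        unfolding A_def using fs gs by (intro image_eqI[of _ _ "(\<gamma> - of_nat c * s, s)"]) auto
      thus False using c by simp
    qed
    thus "s \<in> {\<beta>}" by simp
  qed (use h in \<open>auto simp: L.is_minpoly_def\<close>)
  hence "h = [:- \<beta>, 1:]" using L.minpoly_split(1)[OF h] by simp
  moreover have "coeff h 0 \<in> Rats.adjoin \<gamma>"
    using h by (auto simp: L.is_minpoly_def polys_over_def)
  ultimately have \<beta>: "\<beta> \<in> Rats.adjoin \<gamma>"
    using L.uminus_closed[of "- \<beta>"] by simp
  moreover have "\<gamma> - of_nat c * \<beta> \<in> Rats.adjoin \<gamma>"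
    using \<gamma> \<beta> by (intro L.diff_closed L.mult_closed[OF L.of_nat_closed])
  hence "\<alpha> \<in> Rats.adjoin \<gamma>" by (simp add: \<gamma>_def)
  ultimately show ?thesis unfolding \<gamma>_def by (intro that)
qed

lemma (in complex_subfield) adjoin_subset:
  assumes "complex_subring L" "R \<subseteq> L" "a \<in> L"
  shows "adjoin a \<subseteq> L"
proof
  interpret L: complex_subring L by fact
  fix x assume "x \<in> adjoin a"
  then obtain P where P: "P \<in> polys_over R" "x = poly P a" by (auto simp: adjoin_def)
  thus "x \<in> L" using polys_over_mono[OF assms(2) P(1)] assms(3) by auto
qed

text \<open>The generator is made integral, by a denominator that does not change the field, so that
  its powers later form an integral family.\<close>

lemma number_field_primitive_element:
  assumes "number_field K"
  obtains \<theta> where "algebraic_int \<theta>" "K = Rats.adjoin \<theta>"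
proof -
  have sub: "subfield K complex_field" using assms by (simp add: number_field_def)
  interpret K: complex_subfield K by (rule complex_subfield_of_subfield[OF sub])
  obtain n where n: "CF.dimension n \<rat> K"
    using assms by (auto simp: number_field_def CF.finite_dimension_def)
  obtain vs where vs: "CF.Span \<rat> vs = K"
    using CF.exists_base[OF subfield_Rats n] by auto
  have vsK: "set vs \<subseteq> K"
    unfolding vs[symmetric] by (rule CF.Span_base_incl[OF subfield_Rats]) simp
  have "\<exists>\<theta>\<in>K. set ws \<subseteq> Rats.adjoin \<theta>" if "set ws \<subseteq> K" for ws
    using that
  proof (induction ws)
    case Nil thus ?case by (intro bexI[of _ 0]) auto
  next
    case (Cons w ws)
    then obtain \<theta> where \<theta>: "\<theta> \<in> K" "set ws \<subseteq> Rats.adjoin \<theta>" by auto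
    have w: "w \<in> K" using Cons.prems by simp
    obtain c :: nat where c: "\<theta> \<in> Rats.adjoin (\<theta> + of_nat c * w)" "w \<in> Rats.adjoin (\<theta> + of_nat c * w)"
      using primitive_element number_field_imp_algebraic[OF assms] \<theta>(1) w by metis
    define \<gamma> where "\<gamma> = \<theta> + of_nat c * w"
    have \<gamma>K: "\<gamma> \<in> K" unfolding \<gamma>_def using \<theta> w by (intro K.add_closed K.mult_closed K.of_nat_closed)
    obtain h0 where "Rats.is_minpoly h0 \<gamma>"
      using algebraic_minpoly[OF number_field_imp_algebraic[OF assms \<gamma>K]] .
    then interpret L: complex_subfield "Rats.adjoin \<gamma>" by (rule Rats.complex_subfield_adjoin)
    have "Rats.adjoin \<theta> \<subseteq> Rats.adjoin \<gamma>"
      using c by (intro Rats.adjoin_subset L.complex_subring_axioms Rats.subset_adjoin) (simp add: \<gamma>_def)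
    thus ?case using \<gamma>K \<theta> c by (intro bexI[of _ \<gamma>]) (auto simp: \<gamma>_def)
  qed
  from this[OF vsK] obtain \<theta> where \<theta>: "\<theta> \<in> K" "set vs \<subseteq> Rats.adjoin \<theta>" by blast
  obtain D :: nat where D: "D > 0" "algebraic_int (of_nat D * \<theta>)"
    using number_field_imp_algebraic[OF assms \<theta>(1)] algebraic_iff_algebraic_int by auto
  define \<eta> where "\<eta> = of_nat D * \<theta>"
  have \<eta>K: "\<eta> \<in> K" using \<theta>(1) by (simp add: \<eta>_def)
  obtain h0 where "Rats.is_minpoly h0 \<eta>"
    using algebraic_minpoly[OF number_field_imp_algebraic[OF assms \<eta>K]] .
  then interpret L: complex_subfield "Rats.adjoin \<eta>" by (rule Rats.complex_subfield_adjoin)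
  have "inverse (of_nat D) * \<eta> \<in> Rats.adjoin \<eta>"
    by (intro L.mult_closed L.inverse_closed L.of_nat_closed Rats.mem_adjoin)
  moreover have "inverse (of_nat D) * \<eta> = \<theta>" using D by (simp add: \<eta>_def)
  ultimately have "\<theta> \<in> Rats.adjoin \<eta>" by (simp only:)
  hence "set vs \<subseteq> Rats.adjoin \<eta>"
    using \<theta>(2) Rats.adjoin_subset[OF L.complex_subring_axioms Rats.subset_adjoin] by (meson order_trans)
  moreover have "CF.combine Ks us \<in> Rats.adjoin \<eta>"
    if "set Ks \<subseteq> \<rat>" "set us \<subseteq> Rats.adjoin \<eta>" for Ks us
    using that
  proof (induction Ks us rule: CF.combine.induct)
    case (1 k Ks u Us)
    thus ?case using Rats.subset_adjoin[of \<eta>] by auto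
  qed auto
  moreover have "K = {CF.combine Ks vs | Ks. set Ks \<subseteq> \<rat>}"
    using vs CF.Span_eq_combine_set[OF subfield_Rats, of vs] by simp
  ultimately have "K \<subseteq> Rats.adjoin \<eta>" by blast
  moreover have "Rats.adjoin \<eta> \<subseteq> K"
    by (intro Rats.adjoin_subset K.complex_subring_axioms K.Rats_subset \<eta>K)
  ultimately show ?thesis using D(2) by (intro that[of \<eta>]) (auto simp: \<eta>_def)
qed

section \<open>Embeddings into the complex numbers\<close>

lemma embedding_facts:
  assumes sub: "complex_subfield K" and \<sigma>: "\<sigma> \<in> embeddings K"
  shows embedding_add: "x \<in> K \<Longrightarrow> y \<in> K \<Longrightarrow> \<sigma> (x + y) = \<sigma> x + \<sigma> y"
    and embedding_mult: "x \<in> K \<Longrightarrow> y \<in> K \<Longrightarrow> \<sigma> (x * y) = \<sigma> x * \<sigma> y"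
    and embedding_undefined: "x \<notin> K \<Longrightarrow> \<sigma> x = undefined"
    and embedding_Rats: "q \<in> \<rat> \<Longrightarrow> \<sigma> q = q"
proof -
  interpret K: complex_subfield K by fact
  have hom: "\<sigma> \<in> Ring.ring_hom (complex_field\<lparr>carrier := K\<rparr>) complex_field"
    and ext: "\<sigma> \<in> extensional K" using \<sigma> by (auto simp: embeddings_def)
  note H = ring_hom_memE[OF hom, simplified]
  have add: "\<sigma> (x + y) = \<sigma> x + \<sigma> y" and mult: "\<sigma> (x * y) = \<sigma> x * \<sigma> y" if "x \<in> K" "y \<in> K" for x y
    using H that by auto
  have one: "\<sigma> 1 = 1" using H by auto
  show "x \<in> K \<Longrightarrow> y \<in> K \<Longrightarrow> \<sigma> (x + y) = \<sigma> x + \<sigma> y" "x \<in> K \<Longrightarrow> y \<in> K \<Longrightarrow> \<sigma> (x * y) = \<sigma> x * \<sigma> y"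
    by (rule add mult; assumption)+
  show "x \<notin> K \<Longrightarrow> \<sigma> x = undefined" using ext by (rule extensional_arb)
  have zero: "\<sigma> 0 = 0" using add[of 0 0] by simp
  have nat: "\<sigma> (of_nat n) = of_nat n" for n
    by (induction n) (simp_all add: zero one add)
  have uminus: "\<sigma> (- x) = - \<sigma> x" if "x \<in> K" for x
    using add[of x "- x"] that zero by (simp add: eq_neg_iff_add_eq_0 add.commute)
  have int: "\<sigma> (of_int m) = of_int m" for m
    by (cases m) (simp_all add: nat uminus del: of_nat_Suc)
  show "\<sigma> q = q" if q: "q \<in> \<rat>"
  proof -
    obtain D :: nat where D: "D > 0" "of_nat D * q \<in> \<int>"
      using Rats_common_denominator[of "{()}" "\<lambda>_. q"] q by auto
    from D(2) obtain a where a: "of_nat D * q = of_int a" by (elim Ints_cases)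
    have "q \<in> K" using q K.Rats_subset by blast
    hence "\<sigma> (of_nat D * q) = of_nat D * \<sigma> q" by (simp add: mult nat)
    hence "of_nat D * \<sigma> q = of_nat D * q" unfolding a by (simp add: int)
    thus ?thesis using D(1) by simp
  qed
qed

lemma embedding_poly:
  assumes sub: "complex_subfield K" and \<sigma>: "\<sigma> \<in> embeddings K" and Q: "Q \<in> polys_over \<rat>" and x: "x \<in> K"
  shows "\<sigma> (poly Q x) = poly Q (\<sigma> x)"
proof -
  interpret K: complex_subfield K by fact
  have "\<forall>i. coeff Q i \<in> \<rat> \<Longrightarrow> poly Q x \<in> K \<and> \<sigma> (poly Q x) = poly Q (\<sigma> x)"
  proof (induction Q)
    case 0 thus ?case using embedding_Rats[OF sub \<sigma>, of 0] by simp
  next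
    case (pCons a Q)
    have a: "a \<in> \<rat>" using pCons.prems by (metis coeff_pCons_0)
    moreover have "a \<in> K" using a K.Rats_subset by blast
    moreover have "\<forall>i. coeff Q i \<in> \<rat>" using pCons.prems by (metis coeff_pCons_Suc)
    ultimately show ?case
      using pCons.IH x by (simp add: embedding_add[OF sub \<sigma>] embedding_mult[OF sub \<sigma>] embedding_Rats[OF sub \<sigma>])
  qed
  thus ?thesis using Q by (simp add: polys_over_def)
qed

text \<open>The embedding that sends \<theta> to s. If s is a conjugate of \<theta>, the choice of P
  is immaterial: two choices differ by a polynomial that vanishes at \<theta>, hence at s.\<close>

definition embedding_at :: "complex \<Rightarrow> complex \<Rightarrow> complex \<Rightarrow> complex" where
  "embedding_at \<theta> s = restrict (\<lambda>x. poly (SOME P. P \<in> polys_over \<rat> \<and> x = poly P \<theta>) s) (Rats.adjoin \<theta>)"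

lemma embedding_at_poly:
  assumes g: "Rats.is_minpoly g \<theta>" and s: "poly g s = 0" and Q: "Q \<in> polys_over \<rat>"
  shows "embedding_at \<theta> s (poly Q \<theta>) = poly Q s"
proof -
  define P where "P = (SOME P. P \<in> polys_over \<rat> \<and> poly Q \<theta> = poly P \<theta>)"
  have "P \<in> polys_over \<rat> \<and> poly Q \<theta> = poly P \<theta>"
    unfolding P_def by (rule someI[of _ Q]) (simp add: Q)
  hence P: "P \<in> polys_over \<rat>" "poly (P - Q) \<theta> = 0" by auto
  have "poly (P - Q) s = 0"
    by (rule Rats.minpoly_conjugate_root[OF g s]) (use P Q in auto)
  moreover have "poly Q \<theta> \<in> Rats.adjoin \<theta>" using Q by (auto simp: Rats.adjoin_def)
  ultimately show ?thesis by (simp add: embedding_at_def P_def)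
qed

lemma embeddings_adjoin:
  assumes g: "Rats.is_minpoly g \<theta>"
  shows "bij_betw (embedding_at \<theta>) {s. poly g s = 0} (embeddings (Rats.adjoin \<theta>))"
proof -
  define K where "K = Rats.adjoin \<theta>"
  have sub: "complex_subfield K" unfolding K_def by (rule Rats.complex_subfield_adjoin[OF g])
  interpret K: complex_subfield K by (rule sub)
  have \<theta>K: "\<theta> \<in> K" unfolding K_def by (rule Rats.mem_adjoin)
  have \<theta>: "embedding_at \<theta> s \<theta> = s" if "poly g s = 0" for s
    using embedding_at_poly[OF g that, of "[:0, 1:]"] by (simp add: Rats.polys_over_pCons)
  show ?thesis
    unfolding bij_betw_def K_def[symmetric]
  proof (intro conjI equalityI subsetI)
    show "inj_on (embedding_at \<theta>) {s. poly g s = 0}"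
    proof (rule inj_onI)
      fix s t assume st: "s \<in> {s. poly g s = 0}" "t \<in> {s. poly g s = 0}" "embedding_at \<theta> s = embedding_at \<theta> t"
      have "s = embedding_at \<theta> s \<theta>" using \<theta>[of s] st(1) by simp
      also have "\<dots> = embedding_at \<theta> t \<theta>" by (simp only: st(3))
      also have "\<dots> = t" using \<theta>[of t] st(2) by simp
      finally show "s = t" .
    qed
  next
    fix \<sigma> assume "\<sigma> \<in> embedding_at \<theta> ` {s. poly g s = 0}"
    then obtain s where s: "poly g s = 0" and [simp]: "\<sigma> = embedding_at \<theta> s" by auto
    have "\<sigma> \<in> Ring.ring_hom (complex_field\<lparr>carrier := K\<rparr>) complex_field"
    proof (rule ring_hom_memI; simp)
      fix x y assume "x \<in> K" "y \<in> K"
      then obtain P Q where PQ: "P \<in> polys_over \<rat>" "x = poly P \<theta>" "Q \<in> polys_over \<rat>" "y = poly Q \<theta>"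
        unfolding K_def by (auto simp: Rats.adjoin_def)
      show "embedding_at \<theta> s (x * y) = embedding_at \<theta> s x * embedding_at \<theta> s y"
        using PQ embedding_at_poly[OF g s, of "P * Q"] by (simp add: embedding_at_poly[OF g s])
      show "embedding_at \<theta> s (x + y) = embedding_at \<theta> s x + embedding_at \<theta> s y"
        using PQ embedding_at_poly[OF g s, of "P + Q"] by (simp add: embedding_at_poly[OF g s])
    next
      show "embedding_at \<theta> s 1 = 1" using embedding_at_poly[OF g s, of 1] by simp
    qed
    moreover have "\<sigma> \<in> extensional K" by (simp add: embedding_at_def K_def)
    ultimately show "\<sigma> \<in> embeddings K" by (simp add: embeddings_def)
  next
    fix \<sigma> assume \<sigma>: "\<sigma> \<in> embeddings K"
    have grat: "g \<in> polys_over \<rat>" "poly g \<theta> = 0" using g by (auto simp: Rats.is_minpoly_def)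
    have s: "poly g (\<sigma> \<theta>) = 0"
      using embedding_poly[OF sub \<sigma> grat(1) \<theta>K] grat(2) embedding_Rats[OF sub \<sigma>, of 0] by simp
    have "\<sigma> x = embedding_at \<theta> (\<sigma> \<theta>) x" for x
    proof (cases "x \<in> K")
      case True
      then obtain Q where Q: "Q \<in> polys_over \<rat>" "x = poly Q \<theta>" unfolding K_def by (auto simp: Rats.adjoin_def)
      thus ?thesis using embedding_poly[OF sub \<sigma> Q(1) \<theta>K] embedding_at_poly[OF g s Q(1)] by simp
    next
      case False
      thus ?thesis using embedding_undefined[OF sub \<sigma>] by (simp add: embedding_at_def K_def)
    qed
    thus "\<sigma> \<in> embedding_at \<theta> ` {s. poly g s = 0}" using s by blast
  qed
qed

section \<open>The discriminant and unramified primes\<close>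

interpretation Reals: complex_subfield \<real>
  by unfold_locales auto

text \<open>The trace from K to the rationals.\<close>

definition conj_trace :: "complex set \<Rightarrow> complex \<Rightarrow> complex" where
  "conj_trace K x = (\<Sum>\<sigma>\<in>embeddings K. \<sigma> x)"

text \<open>The Gram matrix of the trace pairing. Its determinant is the square in the discriminant,
  but it needs no enumeration of the embeddings and, for elements of K, has rational
  entries.\<close>

definition trace_form :: "complex set \<Rightarrow> complex list \<Rightarrow> complex mat" where
  "trace_form K bs = Matrix.mat (length bs) (length bs) (\<lambda>(i, j). conj_trace K (bs ! i * bs ! j))"

definition embedding_mat :: "(complex \<Rightarrow> complex) list \<Rightarrow> complex list \<Rightarrow> complex mat" where
  "embedding_mat \<sigma>s bs = Matrix.mat (length \<sigma>s) (length bs) (\<lambda>(i, j). (\<sigma>s ! i) (bs ! j))"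

lemma (in complex_subring) adj_mat_closed:
  assumes A: "A \<in> carrier_mat n n" "\<And>i j. i < n \<Longrightarrow> j < n \<Longrightarrow> A $$ (i, j) \<in> R" and ij: "i < n" "j < n"
  shows "adj_mat A $$ (i, j) \<in> R"
proof -
  have "Determinant.det (mat_delete A j i) \<in> R"
    using A(1) ij by (intro det_closed[OF mat_delete_carrier[OF A(1)]]) (auto simp: mat_delete_def intro!: A(2))
  thus ?thesis
    using A(1) ij by (auto simp: adj_mat_def Determinant.cofactor_def)
qed

section \<open>Traces, integral bases and the discriminant of a fixed number field\<close>

context
  fixes K :: "complex set"
  assumes nf: "number_field K"
begin

lemma number_field_subfield: "complex_subfield K"
  using nf by (intro complex_subfield_of_subfield) (simp add: number_field_def)

interpretation K: complex_subfield K by (rule number_field_subfield)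

lemma number_field_embeddings:
  obtains \<theta> g where "algebraic_int \<theta>" "K = Rats.adjoin \<theta>" "Rats.is_minpoly g \<theta>"
    "bij_betw (embedding_at \<theta>) {s. poly g s = 0} (embeddings K)"
proof -
  obtain \<theta> where \<theta>: "algebraic_int \<theta>" "K = Rats.adjoin \<theta>"
    by (rule number_field_primitive_element[OF nf])
  obtain g where g: "Rats.is_minpoly g \<theta>"
    using algebraic_minpoly algebraic_int_imp_algebraic[OF \<theta>(1)] by blast
  show ?thesis using that[OF \<theta> g] embeddings_adjoin[OF g] \<theta>(2) by simp
qed

lemma finite_embeddings: "finite (embeddings K)"
proof -
  obtain \<theta> g where "Rats.is_minpoly g \<theta>" "bij_betw (embedding_at \<theta>) {s. poly g s = 0} (embeddings K)"
    by (rule number_field_embeddings)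
  thus ?thesis using Rats.minpoly_split(2) bij_betw_finite by blast
qed

lemma conj_trace_Rats:
  assumes "x \<in> K"
  shows "conj_trace K x \<in> \<rat>"
proof -
  obtain \<theta> g where \<theta>: "algebraic_int \<theta>" "K = Rats.adjoin \<theta>" and g: "Rats.is_minpoly g \<theta>"
    and bij: "bij_betw (embedding_at \<theta>) {s. poly g s = 0} (embeddings K)"
    by (rule number_field_embeddings)
  obtain Q where Q: "Q \<in> polys_over \<rat>" "x = poly Q \<theta>"
    using assms unfolding \<theta>(2) by (auto simp: Rats.adjoin_def)
  have "conj_trace K x = (\<Sum>s | poly g s = 0. embedding_at \<theta> s x)"
    unfolding conj_trace_def by (rule sum.reindex_bij_betw[OF bij, symmetric])
  also have "\<dots> = (\<Sum>s | poly g s = 0. poly Q s)"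
    using Q embedding_at_poly[OF g] by (intro sum.cong) auto
  also have "\<dots> \<in> \<rat>" by (rule Rats.conjugate_trace_closed[OF g Q(1)])
  finally show ?thesis .
qed

lemma embedding_algebraic_int:
  assumes "\<sigma> \<in> embeddings K" "x \<in> K" "algebraic_int x"
  shows "algebraic_int (\<sigma> x)"
proof -
  obtain \<theta> g where \<theta>: "algebraic_int \<theta>" "K = Rats.adjoin \<theta>" and g: "Rats.is_minpoly g \<theta>"
    and bij: "bij_betw (embedding_at \<theta>) {s. poly g s = 0} (embeddings K)"
    by (rule number_field_embeddings)
  obtain Q where Q: "Q \<in> polys_over \<rat>" "x = poly Q \<theta>"
    using assms(2) unfolding \<theta>(2) by (auto simp: Rats.adjoin_def)
  obtain s where s: "poly g s = 0" "\<sigma> = embedding_at \<theta> s"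
    using bij assms(1) by (auto simp: bij_betw_def)
  thus ?thesis
    using Rats.algebraic_int_conjugate[OF g s(1) Q(1)] assms(3) Q(2) embedding_at_poly[OF g s(1) Q(1)] by simp
qed

lemma identity_embedding: "\<exists>\<sigma>\<in>embeddings K. \<forall>x\<in>K. \<sigma> x = x"
proof -
  obtain \<theta> g where \<theta>: "algebraic_int \<theta>" "K = Rats.adjoin \<theta>" and g: "Rats.is_minpoly g \<theta>"
    and bij: "bij_betw (embedding_at \<theta>) {s. poly g s = 0} (embeddings K)"
    by (rule number_field_embeddings)
  have root: "poly g \<theta> = 0" using g by (simp add: Rats.is_minpoly_def)
  hence "embedding_at \<theta> \<theta> \<in> embeddings K" using bij by (auto simp: bij_betw_def)
  moreover have "embedding_at \<theta> \<theta> x = x" if "x \<in> K" for x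
    using that embedding_at_poly[OF g root] unfolding \<theta>(2) by (auto simp: Rats.adjoin_def)
  ultimately show ?thesis by blast
qed

lemma embedding_0: "\<sigma> \<in> embeddings K \<Longrightarrow> \<sigma> 0 = 0"
  using embedding_Rats[OF number_field_subfield, of \<sigma> 0] by simp

lemma embedding_sum:
  assumes "\<sigma> \<in> embeddings K" "\<And>i. i \<in> I \<Longrightarrow> f i \<in> K"
  shows "\<sigma> (\<Sum>i\<in>I. f i) = (\<Sum>i\<in>I. \<sigma> (f i))"
  using assms(2)
proof (induction I rule: infinite_finite_induct)
  case (insert i I)
  have "sum f I \<in> K" using insert.prems by (intro K.sum_closed) auto
  thus ?case using insert embedding_add[OF number_field_subfield assms(1)] by simp
qed (use embedding_0[OF assms(1)] in auto)

lemma conj_trace_combination: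
  assumes "\<And>i. i \<in> I \<Longrightarrow> c i \<in> \<rat>" "\<And>i. i \<in> I \<Longrightarrow> b i \<in> K" "y \<in> K"
  shows "conj_trace K ((\<Sum>i\<in>I. c i * b i) * y) = (\<Sum>i\<in>I. c i * conj_trace K (b i * y))"
proof -
  have c: "c i \<in> K" if "i \<in> I" for i using assms(1)[OF that] K.Rats_subset by blast
  have "\<sigma> ((\<Sum>i\<in>I. c i * b i) * y) = (\<Sum>i\<in>I. c i * \<sigma> (b i * y))" if \<sigma>: "\<sigma> \<in> embeddings K" for \<sigma>
  proof -
    have "\<sigma> ((\<Sum>i\<in>I. c i * b i) * y) = (\<Sum>i\<in>I. \<sigma> (c i * (b i * y)))"
      unfolding sum_distrib_right mult.assoc using assms c by (intro embedding_sum[OF \<sigma>]) auto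
    also have "\<dots> = (\<Sum>i\<in>I. c i * \<sigma> (b i * y))"
      using assms c by (intro sum.cong refl)
        (simp add: embedding_mult[OF number_field_subfield \<sigma>] embedding_Rats[OF number_field_subfield \<sigma>])
    finally show ?thesis .
  qed
  hence "conj_trace K ((\<Sum>i\<in>I. c i * b i) * y) = (\<Sum>\<sigma>\<in>embeddings K. \<Sum>i\<in>I. c i * \<sigma> (b i * y))"
    by (simp add: conj_trace_def)
  also have "\<dots> = (\<Sum>i\<in>I. c i * conj_trace K (b i * y))"
    unfolding conj_trace_def sum_distrib_left by (rule sum.swap)
  finally show ?thesis .
qed

lemma trace_form_eq:
  assumes "distinct \<sigma>s" "set \<sigma>s = embeddings K" "set bs \<subseteq> K"
  shows "trace_form K bs = transpose_mat (embedding_mat \<sigma>s bs) * embedding_mat \<sigma>s bs"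
proof (rule eq_matI)
  fix i j
  assume "i < dim_row (transpose_mat (embedding_mat \<sigma>s bs) * embedding_mat \<sigma>s bs)"
    "j < dim_col (transpose_mat (embedding_mat \<sigma>s bs) * embedding_mat \<sigma>s bs)"
  hence ij: "i < length bs" "j < length bs" by (auto simp: embedding_mat_def)
  have "(transpose_mat (embedding_mat \<sigma>s bs) * embedding_mat \<sigma>s bs) $$ (i, j)
      = (\<Sum>k\<in>{0..<length \<sigma>s}. (\<sigma>s ! k) (bs ! i) * (\<sigma>s ! k) (bs ! j))"
    using ij by (simp add: embedding_mat_def scalar_prod_def)
  also have "\<dots> = (\<Sum>\<sigma>\<in>embeddings K. \<sigma> (bs ! i) * \<sigma> (bs ! j))"
    using sum.reindex_bij_betw[OF bij_betw_nth[OF assms(1) refl assms(2)[symmetric]],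
        of "\<lambda>\<sigma>. \<sigma> (bs ! i) * \<sigma> (bs ! j)"] by (simp add: lessThan_atLeast0)
  also have "\<dots> = conj_trace K (bs ! i * bs ! j)"
    unfolding conj_trace_def
    by (intro sum.cong refl embedding_mult[OF number_field_subfield, symmetric]) (use ij assms(3) in auto)
  finally show "trace_form K bs $$ (i, j)
      = (transpose_mat (embedding_mat \<sigma>s bs) * embedding_mat \<sigma>s bs) $$ (i, j)"
    using ij by (simp add: trace_form_def)
qed (auto simp: trace_form_def embedding_mat_def)

lemma det_trace_form:
  assumes "distinct \<sigma>s" "set \<sigma>s = embeddings K" "set bs \<subseteq> K" "length bs = length \<sigma>s"
  shows "Determinant.det (trace_form K bs) = (Determinant.det (embedding_mat \<sigma>s bs))\<^sup>2"
proof -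
  have M: "embedding_mat \<sigma>s bs \<in> carrier_mat (length bs) (length bs)"
    using assms(4) by (simp add: embedding_mat_def)
  show ?thesis
    unfolding trace_form_eq[OF assms(1-3)] using M
    by (subst det_mult[of _ "length bs"]) (auto simp: det_transpose[OF M] power2_eq_square)
qed

lemma det_trace_form_int:
  assumes "set bs \<subseteq> ring_of_integers K"
  shows "Determinant.det (trace_form K bs) \<in> \<int>"
    and "i < length bs \<Longrightarrow> j < length bs \<Longrightarrow> trace_form K bs $$ (i, j) \<in> \<int>"
proof -
  have ent: "trace_form K bs $$ (i, j) \<in> \<int>" if "i < length bs" "j < length bs" for i j
  proof -
    have b: "bs ! i \<in> ring_of_integers K" "bs ! j \<in> ring_of_integers K"
      using assms that by auto
    have x: "bs ! i * bs ! j \<in> K" using b by (auto simp: ring_of_integers_def)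
    have "algebraic_int (bs ! i * bs ! j)"
      using b algebraic_int_plus_times by (auto simp: ring_of_integers_def)
    hence "conj_trace K (bs ! i * bs ! j) \<in> {x. algebraic_int x}"
      unfolding conj_trace_def using x by (intro AlgInt.sum_closed) (auto intro: embedding_algebraic_int)
    thus ?thesis
      using that rational_algebraic_int_is_int conj_trace_Rats[OF x] by (simp add: trace_form_def)
  qed
  show "Determinant.det (trace_form K bs) \<in> \<int>"
    by (rule Ints.det_closed[of _ "length bs"]) (use ent in \<open>auto simp: trace_form_def\<close>)
  show "i < length bs \<Longrightarrow> j < length bs \<Longrightarrow> trace_form K bs $$ (i, j) \<in> \<int>" by (rule ent)
qed

lemma embeddings_list:
  obtains \<sigma>s where "distinct \<sigma>s" "set \<sigma>s = embeddings K" "length \<sigma>s = card (embeddings K)"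
  using finite_distinct_list[OF finite_embeddings] distinct_card by metis

text \<open>Powers of an integral generator: a kernel vector of their Vandermonde matrix would be a
  nonzero polynomial of degree below n that has the n conjugates of \<theta> as roots.\<close>

lemma nondegenerate_integral_family:
  obtains ws where "length ws = card (embeddings K)" "set ws \<subseteq> ring_of_integers K"
    "Determinant.det (trace_form K ws) \<noteq> 0"
proof -
  obtain \<theta> g where \<theta>: "algebraic_int \<theta>" "K = Rats.adjoin \<theta>" and g: "Rats.is_minpoly g \<theta>"
    and bij: "bij_betw (embedding_at \<theta>) {s. poly g s = 0} (embeddings K)"
    by (rule number_field_embeddings)
  define n where "n = card (embeddings K)"
  obtain \<sigma>s where \<sigma>s: "distinct \<sigma>s" "set \<sigma>s = embeddings K" "length \<sigma>s = n"
    unfolding n_def by (rule embeddings_list)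
  define ws where "ws = map (\<lambda>j. \<theta> ^ j) [0..<n]"
  have \<theta>K: "\<theta> \<in> K" unfolding \<theta>(2) by (rule Rats.mem_adjoin)
  have ws: "set ws \<subseteq> ring_of_integers K"
    using \<theta>K \<theta>(1) AlgInt.power_closed[of \<theta>] by (auto simp: ws_def ring_of_integers_def)
  have wsK: "set ws \<subseteq> K" using ws by (auto simp: ring_of_integers_def)
  have M: "embedding_mat \<sigma>s ws \<in> carrier_mat n n"
    using \<sigma>s by (simp add: embedding_mat_def ws_def)
  have "Determinant.det (embedding_mat \<sigma>s ws) \<noteq> 0"
  proof
    assume "Determinant.det (embedding_mat \<sigma>s ws) = 0"
    then obtain v where v: "v \<in> carrier_vec n" "v \<noteq> 0\<^sub>v n" "embedding_mat \<sigma>s ws *\<^sub>v v = 0\<^sub>v n"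
      using det_0_iff_vec_prod_zero[OF M] by blast
    define p where "p = (\<Sum>j<n. monom (vec_index v j) j)"
    have cp: "coeff p j = (if j < n then vec_index v j else 0)" for j
      by (simp add: p_def coeff_sum)
    have "p \<noteq> 0"
    proof
      assume "p = 0"
      hence "vec_index v j = 0" if "j < n" for j using cp[of j] that by simp
      hence "v = 0\<^sub>v n" using v(1) by (intro eq_vecI) auto
      thus False using v(2) by simp
    qed
    have "(\<lambda>\<sigma>. \<sigma> \<theta>) ` embeddings K \<subseteq> {x. poly p x = 0}"
    proof
      fix x assume "x \<in> (\<lambda>\<sigma>. \<sigma> \<theta>) ` embeddings K"
      then obtain i where i: "i < n" "x = (\<sigma>s ! i) \<theta>"
        using \<sigma>s by (metis imageE in_set_conv_nth)
      have \<sigma>i: "\<sigma>s ! i \<in> embeddings K" using i \<sigma>s by (metis nth_mem)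
      have pow: "(\<sigma>s ! i) (\<theta> ^ j) = x ^ j" for j
        using embedding_poly[OF number_field_subfield \<sigma>i _ \<theta>K, of "monom 1 j"]
        by (simp add: poly_monom i(2) Rats.polys_over_monom)
      have "0 = vec_index (embedding_mat \<sigma>s ws *\<^sub>v v) i"
        using v(3) i by simp
      also have "\<dots> = (\<Sum>j<n. x ^ j * vec_index v j)"
        using i \<sigma>s v(1) by (simp add: embedding_mat_def ws_def scalar_prod_def pow lessThan_atLeast0)
      also have "\<dots> = poly p x"
        by (simp add: p_def poly_sum poly_monom mult.commute)
      finally show "x \<in> {x. poly p x = 0}" by simp
    qed
    moreover have "inj_on (\<lambda>\<sigma>. \<sigma> \<theta>) (embeddings K)"
    proof (rule inj_onI)
      fix \<sigma> \<tau> assume "\<sigma> \<in> embeddings K" "\<tau> \<in> embeddings K" and eq: "\<sigma> \<theta> = \<tau> \<theta>"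
      moreover have "embeddings K = embedding_at \<theta> ` {s. poly g s = 0}"
        using bij by (simp add: bij_betw_def)
      ultimately obtain s t where st: "poly g s = 0" "\<sigma> = embedding_at \<theta> s" "poly g t = 0" "\<tau> = embedding_at \<theta> t"
        by blast
      have "embedding_at \<theta> s \<theta> = s" "embedding_at \<theta> t \<theta> = t"
        using embedding_at_poly[OF g st(1), of "[:0, 1:]"] embedding_at_poly[OF g st(3), of "[:0, 1:]"]
        by (simp_all add: Rats.polys_over_pCons)
      thus "\<sigma> = \<tau>" using eq st by simp
    qed
    ultimately have "n \<le> card {x. poly p x = 0}"
      using card_mono[OF poly_roots_finite[OF \<open>p \<noteq> 0\<close>]] by (metis card_image n_def)
    also have "\<dots> \<le> degree p" by (rule card_poly_roots_bound[OF \<open>p \<noteq> 0\<close>])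
    also have "degree p < n"
    proof -
      have "n > 0" using v(1,2) by (intro Nat.gr0I) auto
      thus ?thesis by (intro degree_lessI) (auto simp: cp)
    qed
    finally show False by simp
  qed
  hence "Determinant.det (trace_form K ws) \<noteq> 0"
    using det_trace_form[OF \<sigma>s(1,2), of ws] wsK \<sigma>s(3) by (simp add: ws_def)
  thus ?thesis using ws by (intro that[of ws]) (auto simp: ws_def n_def)
qed

text \<open>The adjugate yields a rational combination with the same traces against the b_i as x.
  The difference y has all these traces zero, and invertibility of the embedding matrix makes every
  conjugate of y vanish.\<close>

lemma rational_coordinates:
  assumes bs: "set bs \<subseteq> K" "length bs = card (embeddings K)" "Determinant.det (trace_form K bs) \<noteq> 0"
    and x: "x \<in> K"
  obtains c where "\<And>j. j < length bs \<Longrightarrow> c j \<in> \<rat>" "x = (\<Sum>j<length bs. c j * bs ! j)"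
proof -
  define n where "n = length bs"
  obtain \<sigma>s where \<sigma>s: "distinct \<sigma>s" "set \<sigma>s = embeddings K" "length \<sigma>s = n"
    using embeddings_list bs(2) unfolding n_def by metis
  define T where "T = trace_form K bs"
  have T: "T \<in> carrier_mat n n" by (simp add: T_def n_def trace_form_def)
  have bK: "bs ! i \<in> K" if "i < n" for i using bs(1) that by (auto simp: n_def)
  have Trat: "T $$ (i, j) \<in> \<rat>" if "i < n" "j < n" for i j
    using that bK conj_trace_Rats by (simp add: T_def trace_form_def n_def)
  have d: "Determinant.det T \<noteq> 0" using bs(3) by (simp add: T_def)
  have drat: "Determinant.det T \<in> \<rat>" by (rule Rats.det_closed[OF T Trat])
  define v where "v = Matrix.vec n (\<lambda>i. conj_trace K (x * bs ! i))"
  have v: "v \<in> carrier_vec n" by (simp add: v_def)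
  define c where "c = (1 / Determinant.det T) \<cdot>\<^sub>v (adj_mat T *\<^sub>v v)"
  have adj: "adj_mat T \<in> carrier_mat n n" "T * adj_mat T = Determinant.det T \<cdot>\<^sub>m 1\<^sub>m n"
    using adj_mat[OF T] by auto
  have c: "c \<in> carrier_vec n" using adj(1) v by (simp add: c_def)
  have crat: "vec_index c j \<in> \<rat>" if "j < n" for j
  proof -
    have "vec_index c j = (1 / Determinant.det T) * (\<Sum>i\<in>{0..<n}. adj_mat T $$ (j, i) * vec_index v i)"
      using that adj(1) v by (simp add: c_def scalar_prod_def)
    also have "\<dots> \<in> \<rat>"
      using that drat x bK conj_trace_Rats Rats.adj_mat_closed[OF T Trat]
      by (intro Rats.mult_closed Rats.sum_closed) (auto simp: v_def)
    finally show ?thesis .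
  qed
  have Tc: "T *\<^sub>v c = v"
  proof -
    have "T *\<^sub>v c = (1 / Determinant.det T) \<cdot>\<^sub>v (T *\<^sub>v (adj_mat T *\<^sub>v v))"
      unfolding c_def using T adj(1) v by (intro mult_mat_vec) auto
    also have "T *\<^sub>v (adj_mat T *\<^sub>v v) = (T * adj_mat T) *\<^sub>v v"
      using T adj(1) v by (intro assoc_mult_mat_vec[symmetric]) auto
    also have "\<dots> = Determinant.det T \<cdot>\<^sub>v v"
      unfolding adj(2) using v by (intro eq_vecI) auto
    also have "(1 / Determinant.det T) \<cdot>\<^sub>v (Determinant.det T \<cdot>\<^sub>v v) = v"
      using d v by (intro eq_vecI) auto
    finally show ?thesis .
  qed
  define y where "y = x - (\<Sum>j<n. vec_index c j * bs ! j)"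
  have cK: "vec_index c j \<in> K" if "j < n" for j using crat[OF that] K.Rats_subset by blast
  have sK: "(\<Sum>j<n. vec_index c j * bs ! j) \<in> K" using cK bK by (intro K.sum_closed) auto
  have yK: "y \<in> K" unfolding y_def using x sK by auto
  have ytr: "conj_trace K (y * bs ! i) = 0" if i: "i < n" for i
  proof -
    have "conj_trace K ((\<Sum>j<n. vec_index c j * bs ! j) * bs ! i) = (\<Sum>j<n. vec_index c j * conj_trace K (bs ! j * bs ! i))"
      using crat bK i by (intro conj_trace_combination) auto
    also have "\<dots> = vec_index (T *\<^sub>v c) i"
      using i c T by (simp add: scalar_prod_def T_def trace_form_def n_def lessThan_atLeast0 mult.commute)
    also have "\<dots> = conj_trace K (x * bs ! i)" using i by (simp add: Tc v_def)
    finally have "conj_trace K ((\<Sum>j<n. vec_index c j * bs ! j) * bs ! i) = conj_trace K (x * bs ! i)" .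
    moreover have "conj_trace K (x * bs ! i)
        = conj_trace K (y * bs ! i) + conj_trace K ((\<Sum>j<n. vec_index c j * bs ! j) * bs ! i)"
    proof -
      have eq: "x * bs ! i = y * bs ! i + (\<Sum>j<n. vec_index c j * bs ! j) * bs ! i"
        by (simp add: y_def algebra_simps)
      have "\<sigma> (x * bs ! i) = \<sigma> (y * bs ! i) + \<sigma> ((\<Sum>j<n. vec_index c j * bs ! j) * bs ! i)"
        if "\<sigma> \<in> embeddings K" for \<sigma>
        unfolding eq by (rule embedding_add[OF number_field_subfield that]) (use yK sK bK[OF i] in auto)
      thus ?thesis unfolding conj_trace_def sum.distrib[symmetric] by (rule sum.cong[OF refl])
    qed
    ultimately show ?thesis by simp
  qed
  have M: "embedding_mat \<sigma>s bs \<in> carrier_mat n n" using \<sigma>s by (simp add: embedding_mat_def n_def)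
  define w where "w = Matrix.vec n (\<lambda>i. (\<sigma>s ! i) y)"
  have "transpose_mat (embedding_mat \<sigma>s bs) *\<^sub>v w = 0\<^sub>v n"
  proof (rule eq_vecI)
    fix i assume "i < dim_vec (0\<^sub>v n :: complex Matrix.vec)"
    hence i: "i < n" by simp
    have "vec_index (transpose_mat (embedding_mat \<sigma>s bs) *\<^sub>v w) i = (\<Sum>k<n. (\<sigma>s ! k) (bs ! i) * (\<sigma>s ! k) y)"
      using i \<sigma>s by (simp add: embedding_mat_def n_def w_def scalar_prod_def lessThan_atLeast0)
    also have "\<dots> = (\<Sum>\<sigma>\<in>embeddings K. \<sigma> (bs ! i) * \<sigma> y)"
      using sum.reindex_bij_betw[OF bij_betw_nth[OF \<sigma>s(1) refl \<sigma>s(2)[symmetric]],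
          of "\<lambda>\<sigma>. \<sigma> (bs ! i) * \<sigma> y"] \<sigma>s(3) by simp
    also have "\<dots> = conj_trace K (y * bs ! i)"
      unfolding conj_trace_def using yK bK[OF i]
      by (intro sum.cong refl) (simp add: embedding_mult[OF number_field_subfield] mult.commute)
    finally show "vec_index (transpose_mat (embedding_mat \<sigma>s bs) *\<^sub>v w) i = vec_index (0\<^sub>v n) i"
      using ytr[OF i] i by simp
  qed (use M in auto)
  moreover have "Determinant.det (transpose_mat (embedding_mat \<sigma>s bs)) \<noteq> 0"
    using d det_trace_form[OF \<sigma>s(1,2) bs(1)] \<sigma>s(3) unfolding det_transpose[OF M] by (auto simp: T_def n_def)
  moreover have "transpose_mat (embedding_mat \<sigma>s bs) \<in> carrier_mat n n" "w \<in> carrier_vec n"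
    using M by (simp_all add: w_def)
  ultimately have "w = 0\<^sub>v n"
    using det_0_iff_vec_prod_zero by blast
  \<comment> \<open>The identity is one of the embeddings, so y itself is an entry of w.\<close>
  obtain \<sigma> where \<sigma>: "\<sigma> \<in> embeddings K" "\<forall>x\<in>K. \<sigma> x = x" using identity_embedding by blast
  then obtain i where i: "i < n" "\<sigma> = \<sigma>s ! i" using \<sigma>s by (metis in_set_conv_nth)
  have "\<sigma> y = vec_index w i" using i by (simp add: w_def)
  hence "y = 0" using \<open>w = 0\<^sub>v n\<close> \<sigma>(2) yK i by simp
  hence "x = (\<Sum>j<n. vec_index c j * bs ! j)" by (simp add: y_def)
  thus ?thesis using crat by (intro that[of "vec_index c"]) (auto simp: n_def)
qed

lemma rational_coordinates_unique:
  assumes bs: "set bs \<subseteq> K" "length bs = card (embeddings K)" "Determinant.det (trace_form K bs) \<noteq> 0"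
    and c: "\<And>j. j < length bs \<Longrightarrow> c j \<in> \<rat>" "(\<Sum>j<length bs. c j * bs ! j) = 0" and j: "j < length bs"
  shows "c j = 0"
proof -
  define n where "n = length bs"
  have bK: "bs ! i \<in> K" if "i < n" for i using bs(1) that by (auto simp: n_def)
  have T: "trace_form K bs \<in> carrier_mat n n" by (simp add: n_def trace_form_def)
  have "trace_form K bs *\<^sub>v Matrix.vec n c = 0\<^sub>v n"
  proof (rule eq_vecI)
    fix i assume "i < dim_vec (0\<^sub>v n :: complex Matrix.vec)"
    hence i: "i < n" by simp
    have "vec_index (trace_form K bs *\<^sub>v Matrix.vec n c) i = (\<Sum>j<n. c j * conj_trace K (bs ! j * bs ! i))"
      using i by (simp add: trace_form_def n_def scalar_prod_def lessThan_atLeast0 mult.commute)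
    also have "\<dots> = conj_trace K ((\<Sum>j<n. c j * bs ! j) * bs ! i)"
      using c bK i by (intro conj_trace_combination[symmetric]) (auto simp: n_def)
    also have "(\<Sum>j<n. c j * bs ! j) = 0" using c(2) by (simp add: n_def)
    also have "conj_trace K (0 * bs ! i) = 0"
      unfolding conj_trace_def by (rule sum.neutral) (simp add: embedding_0)
    finally show "vec_index (trace_form K bs *\<^sub>v Matrix.vec n c) i = vec_index (0\<^sub>v n) i" using i by simp
  qed (use T in auto)
  moreover have "Matrix.vec n c \<in> carrier_vec n" by simp
  ultimately have "Matrix.vec n c = 0\<^sub>v n"
    using det_0_iff_vec_prod_zero[OF T] bs(3) by blast
  hence "vec_index (Matrix.vec n c) j = 0" using j by (simp add: n_def)
  thus ?thesis using j by (simp add: n_def)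
qed


text \<open>Among the integral families of nonzero discriminant take one with the least absolute
  value. If a coordinate c_k of an integer x had a nonzero fractional part t, exchanging b_k for x -
  floor(c_k) b_k would multiply the discriminant by t^2 < 1.\<close>

lemma integral_basis_exists:
  obtains bs where "integral_basis K bs" "length bs = card (embeddings K)" "Determinant.det (trace_form K bs) \<noteq> 0"
proof -
  define n where "n = card (embeddings K)"
  define P where "P bs \<longleftrightarrow> length bs = n \<and> set bs \<subseteq> ring_of_integers K \<and> Determinant.det (trace_form K bs) \<noteq> 0" for bs
  \<comment> \<open>For families satisfying \<open>P\<close> the determinant is a rational integer,
    so the floor loses nothing.\<close>
  define m where "m bs = nat \<lfloor>norm (Determinant.det (trace_form K bs))\<rfloor>" for bs
  have norm_m: "norm (Determinant.det (trace_form K bs)) = real (m bs)" if "P bs" for bs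
  proof -
    have "Determinant.det (trace_form K bs) \<in> \<int>" using det_trace_form_int(1) that by (simp add: P_def)
    then obtain z where "Determinant.det (trace_form K bs) = of_int z" by (elim Ints_cases)
    thus ?thesis by (simp add: m_def)
  qed
  obtain ws where "P ws"
    using nondegenerate_integral_family unfolding P_def n_def by metis
  then obtain bs where bs: "P bs" and least: "\<And>cs. P cs \<Longrightarrow> m bs \<le> m cs"
    using ex_has_least_nat[of P ws m] by blast
  have len: "length bs = n" and bsO: "set bs \<subseteq> ring_of_integers K" and det: "Determinant.det (trace_form K bs) \<noteq> 0"
    using bs by (auto simp: P_def)
  have bsK: "set bs \<subseteq> K" using bsO by (auto simp: ring_of_integers_def)
  have bO: "bs ! i \<in> K" "algebraic_int (bs ! i)" if "i < n" for i
    using bsO that len by (auto simp: ring_of_integers_def subset_iff)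
  obtain \<sigma>s where \<sigma>s: "distinct \<sigma>s" "set \<sigma>s = embeddings K" "length \<sigma>s = n"
    unfolding n_def by (rule embeddings_list)
  have integral: "\<exists>c::nat \<Rightarrow> int. x = (\<Sum>j<n. of_int (c j) * bs ! j)" if x: "x \<in> ring_of_integers K" for x
  proof -
    have xK: "x \<in> K" "algebraic_int x" using x by (auto simp: ring_of_integers_def)
    obtain c where c: "\<And>j. j < n \<Longrightarrow> c j \<in> \<rat>" "x = (\<Sum>j<n. c j * bs ! j)"
      using rational_coordinates[OF bsK len[unfolded n_def] det xK(1)] unfolding len by metis
    have "c k \<in> \<int>" if k: "k < n" for k
    proof (rule ccontr)
      assume nint: "c k \<notin> \<int>"
      define f where "f = \<lfloor>Re (c k)\<rfloor>"
      define t where "t = c k - of_int f"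
      have re: "c k = of_real (Re (c k))"
        using c(1)[OF k] Reals.Rats_subset by (auto simp: complex_is_Real_iff complex_eq_iff)
      have t: "t = of_real (Re (c k) - of_int f)"
        unfolding t_def by (subst re) simp
      have "t \<noteq> 0" using nint by (auto simp: t_def)
      have "norm t = \<bar>Re (c k) - of_int f\<bar>" unfolding t norm_of_real ..
      hence "norm t < 1" unfolding f_def by linarith
      define x' where "x' = x - of_int f * bs ! k"
      have "of_int f * bs ! k \<in> {x. algebraic_int x}"
        by (rule AlgInt.mult_closed[OF AlgInt.of_int_closed]) (use bO[OF k] in simp)
      hence x'O: "x' \<in> ring_of_integers K"
        using xK bO[OF k] AlgInt.diff_closed[of x] K.diff_closed[OF xK(1) K.mult_closed[OF K.of_int_closed bO(1)[OF k]]]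
        by (auto simp: x'_def ring_of_integers_def)
      define bs' where "bs' = bs[k := x']"
      define c' where "c' j = (if j = k then t else c j)" for j
      have c'rat: "c' j \<in> \<rat>" if "j < n" for j
        using c(1)[OF that] c(1)[OF k] by (auto simp: c'_def t_def)
      have c'K: "c' j \<in> K" if "j < n" for j using c'rat[OF that] K.Rats_subset by blast
      have x': "x' = (\<Sum>j<n. c' j * bs ! j)"
      proof -
        have "(\<Sum>j<n. c' j * bs ! j) = (\<Sum>j<n. c j * bs ! j - (if j = k then of_int f * bs ! k else 0))"
          by (intro sum.cong refl) (auto simp: c'_def t_def algebra_simps)
        thus ?thesis using k by (simp add: sum_subtractf c(2)[symmetric] x'_def)
      qed
      define M where "M = embedding_mat \<sigma>s bs"
      have M: "M \<in> carrier_mat n n" using \<sigma>s len by (simp add: M_def embedding_mat_def)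
      \<comment> \<open>The exchange replaces column k by M c', so Cramer's rule yields the factor
        c'_k = t.\<close>
      have "embedding_mat \<sigma>s bs' = replace_col M (M *\<^sub>v Matrix.vec n c') k"
      proof (rule eq_matI)
        fix i j assume "i < dim_row (replace_col M (M *\<^sub>v Matrix.vec n c') k)"
          "j < dim_col (replace_col M (M *\<^sub>v Matrix.vec n c') k)"
        hence ij: "i < n" "j < n" using M by (auto simp: replace_col_def)
        have \<sigma>i: "\<sigma>s ! i \<in> embeddings K" using ij \<sigma>s by (metis nth_mem)
        have "(\<sigma>s ! i) x' = (\<Sum>j<n. (\<sigma>s ! i) (bs ! j) * c' j)"
        proof -
          have "(\<sigma>s ! i) x' = (\<Sum>j<n. (\<sigma>s ! i) (c' j * bs ! j))"
            unfolding x' using c'K bO by (intro embedding_sum[OF \<sigma>i]) auto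
          also have "\<dots> = (\<Sum>j<n. (\<sigma>s ! i) (bs ! j) * c' j)"
            using c'K c'rat bO by (intro sum.cong refl)
              (simp add: embedding_mult[OF number_field_subfield \<sigma>i] embedding_Rats[OF number_field_subfield \<sigma>i] mult.commute)
          finally show ?thesis .
        qed
        thus "embedding_mat \<sigma>s bs' $$ (i, j) = replace_col M (M *\<^sub>v Matrix.vec n c') k $$ (i, j)"
          using ij M k \<sigma>s len
          by (simp add: replace_col_def bs'_def embedding_mat_def M_def scalar_prod_def lessThan_atLeast0)
      qed (use M \<sigma>s len in \<open>auto simp: replace_col_def embedding_mat_def bs'_def\<close>)
      hence "Determinant.det (embedding_mat \<sigma>s bs') = t * Determinant.det M"
        using cramer_lemma_mat[OF M, of "Matrix.vec n c'" k] k by (simp add: c'_def)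
      moreover have bs'O: "set bs' \<subseteq> ring_of_integers K"
        using bsO x'O set_update_subset_insert[of bs k x'] unfolding bs'_def by blast
      moreover have "set bs' \<subseteq> K" using bs'O by (auto simp: ring_of_integers_def)
      ultimately have det': "Determinant.det (trace_form K bs') = t\<^sup>2 * Determinant.det (trace_form K bs)"
        using \<sigma>s len bsK by (simp add: det_trace_form[OF \<sigma>s(1,2)] bs'_def M_def power_mult_distrib)
      hence "P bs'"
        using bs'O det \<open>t \<noteq> 0\<close> len by (auto simp: P_def bs'_def)
      hence "real (m bs) \<le> norm (Determinant.det (trace_form K bs'))"
        using least norm_m by simp
      also have "\<dots> = norm t ^ 2 * real (m bs)"
        unfolding det' by (simp add: norm_mult norm_power norm_m[OF bs])
      also have "\<dots> < 1 * real (m bs)"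
      proof (rule mult_strict_right_mono)
        show "norm t ^ 2 < 1" using \<open>norm t < 1\<close> by (simp add: power_less_one_iff)
        show "0 < real (m bs)" using norm_m[OF bs] det by (metis zero_less_norm_iff)
      qed
      finally show False by simp
    qed
    hence "\<forall>j. \<exists>z. j < n \<longrightarrow> c j = of_int z" by (auto elim: Ints_cases)
    then obtain z where "\<And>j. j < n \<Longrightarrow> c j = of_int (z j)" by metis
    thus ?thesis unfolding c(2) by (intro exI[of _ z] sum.cong) auto
  qed
  have "\<exists>!cs :: int list. length cs = length bs \<and> x = (\<Sum>i<length bs. of_int (cs ! i) * bs ! i)"
    if x: "x \<in> ring_of_integers K" for x
  proof -
    obtain c :: "nat \<Rightarrow> int" where c: "x = (\<Sum>j<n. of_int (c j) * bs ! j)" using integral[OF x] by blast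
    show ?thesis
    proof (rule ex1I[of _ "map c [0..<n]"])
      show "length (map c [0..<n]) = length bs \<and> x = (\<Sum>i<length bs. of_int (map c [0..<n] ! i) * bs ! i)"
        by (simp add: len c)
      fix cs :: "int list" assume cs: "length cs = length bs \<and> x = (\<Sum>i<length bs. of_int (cs ! i) * bs ! i)"
      show "cs = map c [0..<n]"
      proof (rule nth_equalityI)
        fix j assume "j < length cs"
        hence j: "j < length bs" using cs by simp
        have "(\<Sum>j<length bs. (of_int (cs ! j) - of_int (c j)) * bs ! j) = 0"
          using cs c len by (simp add: left_diff_distrib sum_subtractf)
        hence "of_int (cs ! j) - of_int (c j) = (0 :: complex)"
          using rational_coordinates_unique[OF bsK len[unfolded n_def] det _ _ j,
              of "\<lambda>j. of_int (cs ! j) - of_int (c j)"] by simp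
        thus "cs ! j = map c [0..<n] ! j" using j len by simp
      qed (use cs len in simp)
    qed
  qed
  hence "integral_basis K bs" using bsO by (auto simp: integral_basis_def)
  thus ?thesis using len det by (intro that) (auto simp: n_def)
qed

section \<open>Independence of the discriminant from the integral basis\<close>

lemma integral_basis_coordinates:
  assumes "integral_basis K bs" "x \<in> ring_of_integers K"
  shows "\<exists>c::nat \<Rightarrow> int. x = (\<Sum>j<length bs. of_int (c j) * bs ! j)"
  using assms unfolding integral_basis_def by (metis (no_types))

lemma integral_basis_independent:
  fixes c :: "nat \<Rightarrow> int"
  assumes bs: "integral_basis K bs" and c: "(\<Sum>j<length bs. of_int (c j) * bs ! j) = 0" and j: "j < length bs"
  shows "c j = 0"
proof -
  have "0 \<in> ring_of_integers K" by (simp add: ring_of_integers_def)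
  hence ex1: "\<exists>!cs :: int list. length cs = length bs \<and> 0 = (\<Sum>i<length bs. of_int (cs ! i) * bs ! i)"
    using bs unfolding integral_basis_def by blast
  have "map c [0..<length bs] = replicate (length bs) 0"
  proof -
    have "a = b" if "length a = length bs \<and> 0 = (\<Sum>i<length bs. of_int (a ! i) * bs ! i)"
      "length b = length bs \<and> 0 = (\<Sum>i<length bs. of_int (b ! i) * bs ! i)" for a b :: "int list"
      using ex1 that by blast
    thus ?thesis using c by simp
  qed
  hence "map c [0..<length bs] ! j = replicate (length bs) 0 ! j" by (simp only:)
  thus ?thesis using j by simp
qed

text \<open>Passing to the other basis and back is the identity, since coordinates are unique; the
  diagonal entries are what comparing lengths requires.\<close>

lemma integral_basis_change_diagonal:
  fixes A B :: "nat \<Rightarrow> nat \<Rightarrow> int"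
  assumes bs: "integral_basis K bs"
    and A: "\<And>j. j < length bs' \<Longrightarrow> bs' ! j = (\<Sum>i<length bs. of_int (A i j) * bs ! i)"
    and B: "\<And>i. i < length bs \<Longrightarrow> bs ! i = (\<Sum>j<length bs'. of_int (B j i) * bs' ! j)"
    and i: "i < length bs"
  shows "(\<Sum>j<length bs'. A i j * B j i) = 1"
proof -
  define c where "c i' = (\<Sum>j<length bs'. A i' j * B j i) - (if i' = i then 1 else 0)" for i'
  have "bs ! i = (\<Sum>j<length bs'. \<Sum>i'<length bs. of_int (A i' j * B j i) * bs ! i')"
    by (subst B[OF i], intro sum.cong refl) (simp add: A sum_distrib_left mult_ac)
  also have "\<dots> = (\<Sum>i'<length bs. of_int (\<Sum>j<length bs'. A i' j * B j i) * bs ! i')"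
    by (subst sum.swap) (simp add: sum_distrib_right)
  finally have eq: "bs ! i = (\<Sum>i'<length bs. of_int (\<Sum>j<length bs'. A i' j * B j i) * bs ! i')" .
  have "(\<Sum>i'<length bs. of_int (c i') * bs ! i')
      = (\<Sum>i'<length bs. of_int (\<Sum>j<length bs'. A i' j * B j i) * bs ! i') - (\<Sum>i'<length bs. if i' = i then bs ! i else 0)"
    unfolding sum_subtractf[symmetric] by (intro sum.cong refl) (auto simp: c_def left_diff_distrib)
  also have "\<dots> = 0" unfolding eq[symmetric] using i by simp
  finally have "c i = 0" by (rule integral_basis_independent[OF bs _ i])
  thus ?thesis by (simp add: c_def)
qed

lemma integral_basis_change:
  assumes bs: "integral_basis K bs" and bs': "integral_basis K bs'"
  obtains A :: "nat \<Rightarrow> nat \<Rightarrow> int"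
    where "\<And>j. j < length bs' \<Longrightarrow> bs' ! j = (\<Sum>i<length bs. of_int (A i j) * bs ! i)"
proof -
  have "\<forall>j. \<exists>c::nat \<Rightarrow> int. j < length bs' \<longrightarrow> bs' ! j = (\<Sum>i<length bs. of_int (c i) * bs ! i)"
    using integral_basis_coordinates[OF bs] bs' unfolding integral_basis_def by (meson nth_mem subsetD)
  then obtain C :: "nat \<Rightarrow> nat \<Rightarrow> int"
    where "\<And>j. j < length bs' \<Longrightarrow> bs' ! j = (\<Sum>i<length bs. of_int (C j i) * bs ! i)" by metis
  thus ?thesis by (rule that[of "\<lambda>i j. C j i"])
qed

text \<open>The two lengths are the traces of A B and of B A. \<open>integral_basis\<close> itself
  prescribes no length, so this is what makes the matrix in the discriminant square.\<close>

lemma integral_basis_length_unique: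
  assumes bs: "integral_basis K bs" and bs': "integral_basis K bs'"
  shows "length bs = length bs'"
proof -
  obtain A :: "nat \<Rightarrow> nat \<Rightarrow> int"
    where A: "\<And>j. j < length bs' \<Longrightarrow> bs' ! j = (\<Sum>i<length bs. of_int (A i j) * bs ! i)"
    using integral_basis_change[OF bs bs'] by blast
  obtain B :: "nat \<Rightarrow> nat \<Rightarrow> int"
    where B: "\<And>i. i < length bs \<Longrightarrow> bs ! i = (\<Sum>j<length bs'. of_int (B j i) * bs' ! j)"
    using integral_basis_change[OF bs' bs] by blast
  have "int (length bs) = (\<Sum>i<length bs. \<Sum>j<length bs'. A i j * B j i)"
    using integral_basis_change_diagonal[OF bs A B] by simp
  also have "\<dots> = (\<Sum>j<length bs'. \<Sum>i<length bs. B j i * A i j)"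
    by (subst sum.swap) (simp add: mult.commute)
  also have "\<dots> = int (length bs')"
    using integral_basis_change_diagonal[OF bs' B A] by simp
  finally show ?thesis by simp
qed

lemma integral_basis_length:
  assumes "integral_basis K bs"
  shows "length bs = card (embeddings K)"
proof -
  obtain bs' where "integral_basis K bs'" "length bs' = card (embeddings K)"
    by (rule integral_basis_exists)
  thus ?thesis using integral_basis_length_unique[OF assms] by simp
qed

lemma integral_basis_subset: "integral_basis K bs \<Longrightarrow> set bs \<subseteq> K"
  by (auto simp: integral_basis_def ring_of_integers_def)

lemma det_trace_form_change:
  assumes bs: "integral_basis K bs" and bs': "integral_basis K bs'"
  shows "\<exists>z::int. Determinant.det (trace_form K bs') = of_int z ^ 2 * Determinant.det (trace_form K bs)"
proof -
  define n where "n = card (embeddings K)"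
  have len: "length bs = n" "length bs' = n" using assms integral_basis_length by (auto simp: n_def)
  obtain \<sigma>s where \<sigma>s: "distinct \<sigma>s" "set \<sigma>s = embeddings K" "length \<sigma>s = n"
    unfolding n_def by (rule embeddings_list)
  obtain A :: "nat \<Rightarrow> nat \<Rightarrow> int"
    where A: "\<And>j. j < n \<Longrightarrow> bs' ! j = (\<Sum>i<n. of_int (A i j) * bs ! i)"
    using integral_basis_change[OF bs bs'] unfolding len by blast
  define C :: "complex mat" where "C = Matrix.mat n n (\<lambda>(i, j). of_int (A i j))"
  have C: "C \<in> carrier_mat n n" by (simp add: C_def)
  have M: "embedding_mat \<sigma>s bs \<in> carrier_mat n n" using \<sigma>s len by (simp add: embedding_mat_def)
  have bK: "bs ! i \<in> K" if "i < n" for i using integral_basis_subset[OF bs] that len by auto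
  have "embedding_mat \<sigma>s bs' = embedding_mat \<sigma>s bs * C"
  proof (rule eq_matI)
    fix i j assume "i < dim_row (embedding_mat \<sigma>s bs * C)" "j < dim_col (embedding_mat \<sigma>s bs * C)"
    hence ij: "i < n" "j < n" using M C by auto
    have \<sigma>i: "\<sigma>s ! i \<in> embeddings K" using ij \<sigma>s by (metis nth_mem)
    have "(\<sigma>s ! i) (bs' ! j) = (\<Sum>k<n. (\<sigma>s ! i) (of_int (A k j) * bs ! k))"
      unfolding A[OF ij(2)] using bK by (intro embedding_sum[OF \<sigma>i]) auto
    also have "\<dots> = (\<Sum>k<n. (\<sigma>s ! i) (bs ! k) * of_int (A k j))"
      using bK by (intro sum.cong refl)
        (simp add: embedding_mult[OF number_field_subfield \<sigma>i] embedding_Rats[OF number_field_subfield \<sigma>i] mult.commute)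
    finally show "embedding_mat \<sigma>s bs' $$ (i, j) = (embedding_mat \<sigma>s bs * C) $$ (i, j)"
      using ij \<sigma>s len by (simp add: embedding_mat_def C_def scalar_prod_def lessThan_atLeast0)
  qed (use \<sigma>s len in \<open>auto simp: embedding_mat_def C_def\<close>)
  hence "Determinant.det (embedding_mat \<sigma>s bs') = Determinant.det (embedding_mat \<sigma>s bs) * Determinant.det C"
    using det_mult[OF M C] by simp
  moreover have "Determinant.det C \<in> \<int>" by (rule Ints.det_closed[OF C]) (simp add: C_def)
  then obtain z where "Determinant.det C = of_int z" by (elim Ints_cases)
  ultimately show ?thesis
    using \<sigma>s len integral_basis_subset[OF bs] integral_basis_subset[OF bs']
    by (intro exI[of _ z]) (simp add: det_trace_form[OF \<sigma>s(1,2)] power_mult_distrib mult.commute)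
qed

text \<open>Both base changes have integer determinants, z and w; for a nonzero discriminant (w z)^2
  = 1, whence z^2 = 1.\<close>

lemma det_trace_form_integral_basis:
  assumes bs: "integral_basis K bs" and bs': "integral_basis K bs'"
  shows "Determinant.det (trace_form K bs') = Determinant.det (trace_form K bs)"
proof -
  obtain z :: int where z: "Determinant.det (trace_form K bs') = of_int z ^ 2 * Determinant.det (trace_form K bs)"
    using det_trace_form_change[OF bs bs'] by blast
  obtain w :: int where w: "Determinant.det (trace_form K bs) = of_int w ^ 2 * Determinant.det (trace_form K bs')"
    using det_trace_form_change[OF bs' bs] by blast
  show ?thesis
  proof (cases "Determinant.det (trace_form K bs) = 0")
    case False
    have "Determinant.det (trace_form K bs) = of_int ((w * z)\<^sup>2) * Determinant.det (trace_form K bs)"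
      by (subst w, subst z) (simp add: power_mult_distrib mult.assoc)
    hence "of_int ((w * z)\<^sup>2) = (1 :: complex)" using False by simp
    hence "(w * z)\<^sup>2 = 1" by (simp only: of_int_eq_1_iff)
    hence "w * z = 1 \<or> w * z = - 1" by (simp only: power2_eq_1_iff)
    hence "z dvd 1" by (metis dvd_minus_iff dvd_triv_right)
    hence "z\<^sup>2 = 1" by (auto simp: zdvd1_eq abs_if power2_eq_1_iff split: if_splits)
    hence "(of_int z :: complex)\<^sup>2 = 1" by (metis of_int_1 of_int_power)
    thus ?thesis using z by simp
  qed (use z in simp)
qed

lemma number_field_discriminant_eq:
  assumes bs: "integral_basis K bs"
  shows "of_int (number_field_discriminant K) = Determinant.det (trace_form K bs)"
proof -
  obtain \<sigma>s where \<sigma>s: "distinct \<sigma>s" "set \<sigma>s = embeddings K" "length \<sigma>s = card (embeddings K)"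
    by (rule embeddings_list)
  have "Determinant.det (trace_form K bs) \<in> \<int>"
    using det_trace_form_int(1) bs by (simp add: integral_basis_def)
  then obtain d where d: "Determinant.det (trace_form K bs) = of_int d" by (elim Ints_cases)
  have "number_field_discriminant K = d"
    unfolding number_field_discriminant_def embedding_mat_def[symmetric]
  proof (rule the_equality)
    show "\<exists>\<sigma>s bs. distinct \<sigma>s \<and> set \<sigma>s = embeddings K \<and> integral_basis K bs \<and> of_int d = (Determinant.det (embedding_mat \<sigma>s bs))\<^sup>2"
      using \<sigma>s bs integral_basis_length[OF bs] det_trace_form[OF \<sigma>s(1,2) integral_basis_subset[OF bs]]
      by (intro exI[of _ \<sigma>s] exI[of _ bs]) (simp add: d)
  next
    fix d' assume "\<exists>\<sigma>s bs. distinct \<sigma>s \<and> set \<sigma>s = embeddings K \<and> integral_basis K bs \<and> of_int d' = (Determinant.det (embedding_mat \<sigma>s bs))\<^sup>2"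
    then obtain \<sigma>s' bs' where h: "distinct \<sigma>s'" "set \<sigma>s' = embeddings K" "integral_basis K bs'"
      "of_int d' = (Determinant.det (embedding_mat \<sigma>s' bs'))\<^sup>2" by blast
    have "length bs' = length \<sigma>s'"
      using integral_basis_length[OF h(3)] distinct_card[OF h(1)] h(2) by simp
    hence "of_int d' = Determinant.det (trace_form K bs')"
      using det_trace_form[OF h(1,2) integral_basis_subset[OF h(3)]] h(4) by simp
    also have "\<dots> = of_int d" using det_trace_form_integral_basis[OF bs h(3)] d by simp
    finally show "d' = d" by simp
  qed
  thus ?thesis using d by simp
qed

text \<open>The trace form is nondegenerate modulo p. For x nilpotent modulo p, the traces of the x
  b_i are rational integers nilpotent modulo p, hence divisible by p; the adjugate then shows that p
  divides d c_j for every coordinate c_j, where d is the discriminant.\<close>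

theorem unramified_of_not_dvd_discriminant:
  assumes p: "prime p" and dvd: "\<not> int p dvd number_field_discriminant K"
  shows "unramified K p"
  unfolding unramified_def
proof
  fix x assume "x \<in> K \<inter> nilpotent_mod p"
  hence xK: "x \<in> K" and nil: "x \<in> nilpotent_mod p" by auto
  have xint: "algebraic_int x" using nil by (simp add: nilpotent_mod_def)
  have p0: "p > 0" using p by (rule prime_gt_0_nat)
  obtain bs where bs: "integral_basis K bs" by (rule integral_basis_exists)
  define n where "n = length bs"
  define T where "T = trace_form K bs"
  have T: "T \<in> carrier_mat n n" by (simp add: T_def n_def trace_form_def)
  have bsO: "set bs \<subseteq> ring_of_integers K" using bs by (simp add: integral_basis_def)
  have Tint: "T $$ (i, j) \<in> \<int>" if "i < n" "j < n" for i j
    using det_trace_form_int(2)[OF bsO] that by (simp add: T_def n_def)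
  have bK: "bs ! i \<in> K" "algebraic_int (bs ! i)" if "i < n" for i
    using bsO that by (auto simp: ring_of_integers_def subset_iff n_def)
  obtain c :: "nat \<Rightarrow> int" where c: "x = (\<Sum>j<n. of_int (c j) * bs ! j)"
    using integral_basis_coordinates[OF bs, of x] xK xint by (auto simp: ring_of_integers_def n_def)
  have tr: "\<exists>z::int. conj_trace K (x * bs ! i) = of_int (int p * z)" if i: "i < n" for i
  proof -
    have xbK: "x * bs ! i \<in> K" using xK bK i by auto
    have nil': "\<sigma> (x * bs ! i) \<in> nilpotent_mod p" if \<sigma>: "\<sigma> \<in> embeddings K" for \<sigma>
    proof -
      obtain k where k: "k > 0" "algebraic_int (x ^ k / of_nat p)" using nil by (auto simp: nilpotent_mod_def)
      have pow: "\<sigma> (poly (monom (1 / of_nat p) k) x) = poly (monom (1 / of_nat p) k) (\<sigma> x)"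
        by (rule embedding_poly[OF number_field_subfield \<sigma> _ xK]) (auto intro!: Rats.polys_over_monom)
      have "algebraic_int (\<sigma> (x ^ k / of_nat p))"
        using k xK by (intro embedding_algebraic_int[OF \<sigma>]) auto
      hence "algebraic_int (\<sigma> x ^ k / of_nat p)" using pow by (simp add: poly_monom)
      hence "\<sigma> x \<in> nilpotent_mod p"
        using k(1) embedding_algebraic_int[OF \<sigma> xK xint] by (auto simp: nilpotent_mod_def)
      thus ?thesis
        using embedding_algebraic_int[OF \<sigma> bK[OF i]] xK bK(1)[OF i]
        by (simp add: embedding_mult[OF number_field_subfield \<sigma>] nilpotent_mod_mult)
    qed
    define y where "y = conj_trace K (x * bs ! i)"
    have y: "y \<in> nilpotent_mod p" "y \<in> \<rat>"
      unfolding y_def using conj_trace_Rats[OF xbK] nil' by (auto simp: conj_trace_def intro: nilpotent_mod_sum)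
    hence "y \<in> \<int>" using rational_algebraic_int_is_int by (auto simp: nilpotent_mod_def)
    then obtain a where a: "y = of_int a" by (elim Ints_cases)
    obtain k where k: "k > 0" "algebraic_int (y ^ k / of_nat p)" using y(1) by (auto simp: nilpotent_mod_def)
    have "y ^ k / of_nat p \<in> \<int>" using k(2) y(2) by (intro rational_algebraic_int_is_int) auto
    then obtain b where "y ^ k / of_nat p = of_int b" by (elim Ints_cases)
    hence "of_int (a ^ k) = (of_int (int p * b) :: complex)" using a p0 by (simp add: field_simps)
    hence "a ^ k = int p * b" by (simp only: of_int_eq_iff)
    moreover have "prime (int p)" using p by simp
    ultimately have "int p dvd a" by (metis dvd_triv_left prime_dvd_power)
    thus ?thesis using a by (auto simp: y_def)
  qed
  then obtain z :: "nat \<Rightarrow> int" where z: "\<And>i. i < n \<Longrightarrow> conj_trace K (x * bs ! i) = of_int (int p * z i)" by metis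
  define v :: "complex Matrix.vec" where "v = Matrix.vec n (\<lambda>i. of_int (z i))"
  define cv :: "complex Matrix.vec" where "cv = Matrix.vec n (\<lambda>i. of_int (c i))"
  have Tc: "T *\<^sub>v cv = of_nat p \<cdot>\<^sub>v v"
  proof (rule eq_vecI)
    fix i assume "i < dim_vec (of_nat p \<cdot>\<^sub>v v)"
    hence i: "i < n" by (simp add: v_def)
    have "vec_index (T *\<^sub>v cv) i = (\<Sum>j<n. of_int (c j) * conj_trace K (bs ! j * bs ! i))"
      using i by (simp add: T_def trace_form_def n_def cv_def scalar_prod_def lessThan_atLeast0 mult.commute)
    also have "\<dots> = conj_trace K (x * bs ! i)"
      unfolding c using bK i by (intro conj_trace_combination[symmetric]) auto
    also have "\<dots> = vec_index (of_nat p \<cdot>\<^sub>v v) i" using i by (simp add: z v_def)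
    finally show "vec_index (T *\<^sub>v cv) i = vec_index (of_nat p \<cdot>\<^sub>v v) i" .
  qed (use T in \<open>auto simp: v_def\<close>)
  obtain d where d: "number_field_discriminant K = d" "Determinant.det T = of_int d"
    using number_field_discriminant_eq[OF bs] by (simp add: T_def)
  have "int p dvd c j" if j: "j < n" for j
  proof -
    have adj: "adj_mat T \<in> carrier_mat n n" "adj_mat T * T = Determinant.det T \<cdot>\<^sub>m 1\<^sub>m n"
      using adj_mat[OF T] by auto
    have "of_int d \<cdot>\<^sub>v cv = (adj_mat T * T) *\<^sub>v cv"
      unfolding adj(2) d(2) by (intro eq_vecI) (auto simp: cv_def)
    also have "\<dots> = adj_mat T *\<^sub>v (of_nat p \<cdot>\<^sub>v v)"
      unfolding Tc[symmetric] using adj(1) T by (intro assoc_mult_mat_vec) (auto simp: cv_def)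
    finally have "vec_index (of_int d \<cdot>\<^sub>v cv) j = vec_index (adj_mat T *\<^sub>v (of_nat p \<cdot>\<^sub>v v)) j" by simp
    hence "of_int (d * c j) = of_nat p * (\<Sum>i\<in>{0..<n}. adj_mat T $$ (j, i) * of_int (z i))"
      using j adj(1) by (simp add: cv_def v_def scalar_prod_def sum_distrib_left mult_ac)
    moreover have "(\<Sum>i\<in>{0..<n}. adj_mat T $$ (j, i) * of_int (z i)) \<in> \<int>"
      using j Ints.adj_mat_closed[OF T Tint] by (intro Ints.sum_closed Ints.mult_closed) auto
    then obtain b where "(\<Sum>i\<in>{0..<n}. adj_mat T $$ (j, i) * of_int (z i)) = of_int b" by (elim Ints_cases)
    ultimately have "of_int (d * c j) = (of_int (int p * b) :: complex)" by simp
    hence "d * c j = int p * b" by (simp only: of_int_eq_iff)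
    moreover have "prime (int p)" using p by simp
    ultimately show ?thesis using dvd d(1) by (metis dvd_triv_left prime_dvd_mult_iff)
  qed
  hence "\<forall>j. \<exists>e. j < n \<longrightarrow> c j = int p * e" by (auto simp: dvd_def)
  then obtain e where e: "\<And>j. j < n \<Longrightarrow> c j = int p * e j" by metis
  have "x / of_nat p = (\<Sum>j<n. of_int (e j) * bs ! j)"
    unfolding c sum_divide_distrib using p0 by (intro sum.cong refl) (simp add: e)
  also have "\<dots> \<in> {x. algebraic_int x}"
    using bK by (intro AlgInt.sum_closed AlgInt.mult_closed[OF AlgInt.of_int_closed]) auto
  finally show "algebraic_int (x / of_nat p)" by simp
qed

end

section \<open>Odd combinations of Hurwitz zeta values\<close>

text \<open>The series in the form in which it occurs in \<open>Polygamma\<close>.\<close>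

definition hurwitz_sum :: "nat \<Rightarrow> real \<Rightarrow> real" where
  "hurwitz_sum k x = suminf (\<lambda>n. inverse ((x + real n) ^ k))"

lemma summable_hurwitz_sum: "x > 0 \<Longrightarrow> k \<ge> 2 \<Longrightarrow> summable (\<lambda>n. inverse ((x + real n) ^ k))"
  by (rule Polygamma_converges') auto

lemma hurwitz_zeta_of_nat:
  assumes "x > 0" "k \<ge> 2"
  shows "hurwitz_zeta (of_nat k) x = of_real (hurwitz_sum k x)"
proof -
  have "complex_of_real (real n + x) powr (- of_nat k) = of_real (inverse ((x + real n) ^ k))" for n
  proof -
    have "real n + x > 0" using assms(1) by simp
    hence "complex_of_real (real n + x) \<noteq> 0" by (metis less_irrefl of_real_eq_0_iff)
    thus ?thesis by (simp add: powr_minus powr_nat' add.commute)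
  qed
  thus ?thesis
    unfolding hurwitz_zeta_def hurwitz_sum_def
    by (simp only: suminf_of_real[OF summable_hurwitz_sum[OF assms]])
qed

lemma Polygamma_hurwitz_sum:
  assumes "x > 0" "j > 0"
  shows "Polygamma j (of_real x :: complex) = (-1) ^ Suc j * fact j * of_real (hurwitz_sum (Suc j) x)"
proof -
  have "Polygamma j x = (-1) ^ Suc j * fact j * hurwitz_sum (Suc j) x"
    using assms(2) by (simp add: Polygamma_def hurwitz_sum_def)
  thus ?thesis
    using assms(1) by (subst Polygamma_of_real) auto
qed

lemma sin_pi_times_nonzero: "z \<notin> \<int> \<Longrightarrow> sin (of_real pi * z :: complex) \<noteq> 0"
  by (auto simp: sin_eq_0 mult.commute)

text \<open>Logarithmic derivative of the reflection formula for the Gamma function.\<close>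

lemma Digamma_reflection:
  fixes z :: complex
  assumes z: "z \<notin> \<int>"
  shows "Digamma z - Digamma (1 - z) = - of_real pi * cot (of_real pi * z)"
proof -
  have z1: "z \<notin> \<int>\<^sub>\<le>\<^sub>0" and z2: "1 - z \<notin> \<int>\<^sub>\<le>\<^sub>0"
    using z nonpos_Ints_subset_Ints Ints_diff[of 1 "1 - z"] by auto
  have s: "sin (of_real pi * z) \<noteq> 0" using z by (rule sin_pi_times_nonzero)
  have "((\<lambda>z. Gamma z * Gamma (1 - z)) has_field_derivative
      Gamma z * Gamma (1 - z) * (Digamma z - Digamma (1 - z))) (at z)"
    using z1 z2 by (auto intro!: derivative_eq_intros simp: algebra_simps)
  hence "((\<lambda>z. of_real pi / sin (of_real pi * z)) has_field_derivative
      of_real pi / sin (of_real pi * z) * (Digamma z - Digamma (1 - z))) (at z)"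
    unfolding Gamma_reflection_complex .
  moreover have "((\<lambda>z. of_real pi / sin (of_real pi * z)) has_field_derivative
      of_real pi / sin (of_real pi * z) * (- of_real pi * cot (of_real pi * z))) (at z)"
    using s by (auto intro!: derivative_eq_intros simp: cot_def field_simps power2_eq_square)
  ultimately have "of_real pi / sin (of_real pi * z) * (Digamma z - Digamma (1 - z))
      = of_real pi / sin (of_real pi * z) * (- of_real pi * cot (of_real pi * z))"
    by (rule DERIV_unique)
  moreover have "of_real pi / sin (of_real pi * z) \<noteq> 0" using s by simp
  ultimately show ?thesis by (metis mult_left_cancel)
qed

text \<open>The polynomials expressing the derivatives of \<open>v = - \<i> cot (\<pi> z)\<close> through \<open>v\<close>, as \<open>v' = \<pi> \<i> (1 - v\<^sup>2)\<close>.\<close>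

primrec cot_deriv_poly :: "nat \<Rightarrow> complex poly" where
  "cot_deriv_poly 0 = [:0, 1:]"
| "cot_deriv_poly (Suc j) = [:1, 0, - 1:] * pderiv (cot_deriv_poly j)"

lemma cot_deriv_poly_Rats: "cot_deriv_poly j \<in> polys_over \<rat>"
proof (induction j)
  case (Suc j)
  have "[:1, 0, - 1:] \<in> polys_over \<rat>" by (intro Rats.polys_over_pCons) auto
  thus ?case using Suc unfolding cot_deriv_poly.simps by (intro Rats.polys_over_mult Rats.polys_over_pderiv)
qed (auto intro!: Rats.polys_over_pCons)

text \<open>Each differentiation flips the sign of the term at 1 - z. For even j, that is for odd k
  = j + 1, the left-hand side is a difference, which is why k has to be odd.\<close>

lemma Polygamma_reflection:
  fixes z :: complex
  assumes "z \<notin> \<int>"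
  shows "Polygamma j z + (-1) ^ Suc j * Polygamma j (1 - z)
    = - ((of_real pi * \<i>) ^ Suc j) * poly (cot_deriv_poly j) (- \<i> * cot (of_real pi * z))"
  using assms
proof (induction j arbitrary: z)
  case 0
  thus ?case using Digamma_reflection[of z] by (simp add: mult.assoc)
next
  case (Suc j)
  define v where "v z = - \<i> * cot (of_real pi * z :: complex)" for z
  have z1: "z \<notin> \<int>\<^sub>\<le>\<^sub>0" and z2: "1 - z \<notin> \<int>\<^sub>\<le>\<^sub>0"
    using Suc.prems nonpos_Ints_subset_Ints Ints_diff[of 1 "1 - z"] by auto
  have s: "sin (of_real pi * z) \<noteq> 0" using Suc.prems by (rule sin_pi_times_nonzero)
  have v2: "1 - v z ^ 2 = inverse (sin (of_real pi * z) ^ 2)"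
  proof -
    have "1 - v z ^ 2 = 1 + cot (of_real pi * z) ^ 2" by (simp add: v_def power_mult_distrib)
    also have "\<dots> = (sin (of_real pi * z) ^ 2 + cos (of_real pi * z) ^ 2) / sin (of_real pi * z) ^ 2"
      using s by (simp add: cot_def power_divide field_simps)
    finally show ?thesis by (simp add: divide_inverse)
  qed
  have dv: "(v has_field_derivative of_real pi * \<i> * (1 - v z ^ 2)) (at z)"
    unfolding v2 unfolding v_def
    using s by (auto intro!: derivative_eq_intros DERIV_chain2[OF DERIV_cot] simp: mult_ac)
  have "((\<lambda>z. Polygamma j z + (-1) ^ Suc j * Polygamma j (1 - z)) has_field_derivative
      Polygamma (Suc j) z + (-1) ^ Suc (Suc j) * Polygamma (Suc j) (1 - z)) (at z)"
    using z1 z2 by (auto intro!: derivative_eq_intros DERIV_chain2[OF has_field_derivative_Polygamma])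
  moreover have "((\<lambda>z. Polygamma j z + (-1) ^ Suc j * Polygamma j (1 - z)) has_field_derivative
      - ((of_real pi * \<i>) ^ Suc (Suc j)) * poly (cot_deriv_poly (Suc j)) (v z)) (at z)"
  \<comment> \<open>The induction hypothesis holds off the integers only, an open set around z,
    which suffices for differentiating it.\<close>
  proof (rule has_field_derivative_transform_within_open[of "\<lambda>z. - ((of_real pi * \<i>) ^ Suc j) * poly (cot_deriv_poly j) (v z)"])
    have "((\<lambda>z. poly (cot_deriv_poly j) (v z)) has_field_derivative
        poly (pderiv (cot_deriv_poly j)) (v z) * (of_real pi * \<i> * (1 - v z ^ 2))) (at z)"
      by (rule DERIV_chain2[OF poly_DERIV dv])
    from DERIV_cmult[OF this, of "- ((of_real pi * \<i>) ^ Suc j)"]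
    show "((\<lambda>z. - ((of_real pi * \<i>) ^ Suc j) * poly (cot_deriv_poly j) (v z)) has_field_derivative
        - ((of_real pi * \<i>) ^ Suc (Suc j)) * poly (cot_deriv_poly (Suc j)) (v z)) (at z)"
      by (simp add: algebra_simps power2_eq_square)
    show "open (- (\<int> :: complex set))" by (simp add: open_Compl closed_Ints)
    show "z \<in> - \<int>" using Suc.prems by simp
    fix y :: complex assume "y \<in> - \<int>"
    thus "- ((of_real pi * \<i>) ^ Suc j) * poly (cot_deriv_poly j) (v y) = Polygamma j y + (-1) ^ Suc j * Polygamma j (1 - y)"
      using Suc.IH[of y] by (simp add: v_def)
  qed
  ultimately have "Polygamma (Suc j) z + (-1) ^ Suc (Suc j) * Polygamma (Suc j) (1 - z)
      = - ((of_real pi * \<i>) ^ Suc (Suc j)) * poly (cot_deriv_poly (Suc j)) (v z)"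
    by (rule DERIV_unique)
  thus ?case by (simp only: v_def)
qed

lemma cot_eq_cis:
  assumes "sin (of_real x :: complex) \<noteq> 0"
  shows "cis (2 * x) \<noteq> 1" and "- \<i> * cot (of_real x) = (cis (2 * x) + 1) / (cis (2 * x) - 1)"
proof -
  define e where "e = cis x"
  have e0: "e \<noteq> 0" by (simp add: e_def)
  have e2: "cis (2 * x) = e ^ 2" by (simp add: e_def Complex.DeMoivre)
  have ex: "exp (\<i> * of_real x) = e" by (simp add: e_def cis_conv_exp)
  have ex': "exp (- (\<i> * of_real x)) = inverse e" by (simp add: exp_minus ex)
  have s: "sin (of_real x :: complex) = (e - inverse e) / (2 * \<i>)" and c: "cos (of_real x :: complex) = (e + inverse e) / 2"
    by (simp_all only: sin_exp_eq cos_exp_eq ex ex')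
  have ne: "e ^ 2 \<noteq> 1"
  proof
    assume "e ^ 2 = 1"
    hence "e = inverse e" using e0 by (simp add: field_simps power2_eq_square)
    thus False using assms s by simp
  qed
  thus "cis (2 * x) \<noteq> 1" using e2 by simp
  have "(e - inverse e) = (e ^ 2 - 1) / e" "(e + inverse e) = (e ^ 2 + 1) / e"
    using e0 by (simp_all add: power2_eq_square diff_divide_distrib add_divide_distrib inverse_eq_divide)
  hence "cot (of_real x) = ((e ^ 2 + 1) / e / 2) / ((e ^ 2 - 1) / e / (2 * \<i>))"
    unfolding cot_def s c by simp
  also have "\<dots> = \<i> * ((e ^ 2 + 1) / (e ^ 2 - 1))"
  proof -
    have "(p / e / 2) / (q / e / (2 * \<i>)) = \<i> * (p / q)" if "q \<noteq> 0" for p q :: complex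
      using e0 that by (simp add: field_simps)
    thus ?thesis using ne by simp
  qed
  finally show "- \<i> * cot (of_real x) = (cis (2 * x) + 1) / (cis (2 * x) - 1)"
    using e2 by simp
qed

text \<open>For an m-th root of unity w distinct from 1 the right-hand side is m. This turns 1/(w -
  1) into a rational polynomial in w, the same one for all such w.\<close>

lemma sum_times_power:
  fixes w :: complex
  shows "(w - 1) * (\<Sum>t<m. of_nat t * w ^ t) = of_nat m * w ^ m - w * (\<Sum>t<m. w ^ t)"
  by (induction m) (simp_all add: algebra_simps)

text \<open>One polynomial A serves all a, and this is what allows relations between these numbers
  to be conjugated.\<close>

lemma hurwitz_zeta_odd_difference:
  assumes k: "odd k" "k > 1" and m: "m > 0"
  obtains A where "A \<in> polys_over \<rat>"
    "\<And>a. 0 < a \<Longrightarrow> a < m \<Longrightarrow> of_real (hurwitz_sum k (real a / real m) - hurwitz_sum k (1 - real a / real m))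
       = \<i> * of_real pi ^ k * poly A (cis (2 * pi / real m) ^ a)"
proof -
  obtain l where l: "k = 2 * l + 1" using k(1) by (elim oddE)
  define j where "j = k - 1"
  have kj: "k = Suc j" "j > 0" "even j" using k by (auto simp: j_def)
  \<comment> \<open>At w = cis (2 pi a / m) its value is (w + 1)/(w - 1), which is - i cot (pi a /
    m).\<close>
  define V :: "complex poly" where "V = smult (1 / of_nat m) ([:1, 1:] * (\<Sum>t<m. monom (of_nat t) t))"
  have Vrat: "V \<in> polys_over \<rat>"
    unfolding V_def by (intro Rats.polys_over_smult Rats.polys_over_mult Rats.polys_over_sum Rats.polys_over_monom
        Rats.polys_over_pCons Rats.polys_over_0 Rats.of_nat_closed Rats.one_closed Rats.divide_closed)
  define A where "A = smult ((-1) ^ l / fact j) (pcompose (cot_deriv_poly j) V)"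
  have "(-1) ^ l / fact j = (of_int ((-1) ^ l) / of_nat (fact j) :: complex)" by simp
  also have "\<dots> \<in> \<rat>" by (intro Rats.divide_closed Rats.of_int_closed Rats.of_nat_closed)
  finally have A: "A \<in> polys_over \<rat>"
    unfolding A_def by (intro Rats.polys_over_smult Rats.polys_over_pcompose cot_deriv_poly_Rats Vrat)
  have "of_real (hurwitz_sum k (real a / real m) - hurwitz_sum k (1 - real a / real m))
       = \<i> * of_real pi ^ k * poly A (cis (2 * pi / real m) ^ a)" if a: "0 < a" "a < m" for a
  proof -
    define x where "x = real a / real m"
    have x: "0 < x" "x < 1" using a by (auto simp: x_def)
    have xint: "complex_of_real x \<notin> \<int>"
    proof
      assume "complex_of_real x \<in> \<int>"
      then obtain i where "complex_of_real x = of_int i" by (elim Ints_cases)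
      hence "x = of_int i" by (metis of_real_of_int_eq of_real_eq_iff)
      thus False using x by simp
    qed
    define w where "w = cis (2 * pi / real m) ^ a"
    have w: "w = cis (2 * (pi * x))" by (simp add: w_def Complex.DeMoivre x_def mult_ac)
    have wm: "w ^ m = 1"
      using primitive_root_power_order[OF primitive_root_of_unity_cis[OF m]]
      by (simp add: w_def power_mult[symmetric] mult.commute[of a]) (simp add: power_mult)
    have sin0: "sin (of_real (pi * x) :: complex) \<noteq> 0"
      using sin_pi_times_nonzero[OF xint] by simp
    have w1: "w \<noteq> 1" and v: "- \<i> * cot (of_real (pi * x)) = (w + 1) / (w - 1)"
      using cot_eq_cis[OF sin0] by (simp_all add: w)
    have "poly V w = (w + 1) / (w - 1)"
    proof -
      have "(\<Sum>t<m. w ^ t) = 0" using w1 wm by (simp add: geometric_sum)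
      hence "(w - 1) * (\<Sum>t<m. of_nat t * w ^ t) = of_nat m" using sum_times_power[of w m] wm by simp
      hence "(\<Sum>t<m. of_nat t * w ^ t) = of_nat m / (w - 1)" using w1 by (simp add: field_simps)
      moreover have "poly V w = 1 / of_nat m * ((w + 1) * (\<Sum>t<m. of_nat t * w ^ t))"
        by (simp add: V_def poly_sum poly_monom algebra_simps)
      ultimately show ?thesis using m by simp
    qed
    hence Aw: "poly A w = (-1) ^ l / fact j * poly (cot_deriv_poly j) (- \<i> * cot (of_real (pi * x)))"
      unfolding v by (simp add: A_def poly_pcompose)
    have "Polygamma j (complex_of_real x) + (-1) ^ Suc j * Polygamma j (1 - complex_of_real x)
        = - (fact j * of_real (hurwitz_sum k x - hurwitz_sum k (1 - x)))"
    proof -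
      have "Polygamma j (complex_of_real (1 - x)) = (-1) ^ Suc j * fact j * of_real (hurwitz_sum (Suc j) (1 - x))"
        by (rule Polygamma_hurwitz_sum) (use x kj in auto)
      thus ?thesis
        using kj x by (simp add: Polygamma_hurwitz_sum algebra_simps)
    qed
    hence "fact j * of_real (hurwitz_sum k x - hurwitz_sum k (1 - x))
        = (of_real pi * \<i>) ^ k * poly (cot_deriv_poly j) (- \<i> * cot (of_real (pi * x)))"
      using Polygamma_reflection[OF xint, of j] kj(1) by simp
    also have "(of_real pi * \<i>) ^ k = \<i> * of_real pi ^ k * (-1) ^ l"
    proof -
      have "\<i> ^ k = \<i> * (-1) ^ l" unfolding l by (simp add: power_mult power_add)
      thus ?thesis by (simp only: power_mult_distrib mult_ac)
    qed
    finally have F: "fact j * of_real (hurwitz_sum k x - hurwitz_sum k (1 - x))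
        = \<i> * of_real pi ^ k * (-1) ^ l * poly (cot_deriv_poly j) (- \<i> * cot (of_real (pi * x)))" .
    have "complex_of_real (hurwitz_sum k x - hurwitz_sum k (1 - x))
        = fact j * of_real (hurwitz_sum k x - hurwitz_sum k (1 - x)) / fact j" by simp
    also have "\<dots> = \<i> * of_real pi ^ k * ((-1) ^ l / fact j * poly (cot_deriv_poly j) (- \<i> * cot (of_real (pi * x))))"
      unfolding F by simp
    finally have "of_real (hurwitz_sum k x - hurwitz_sum k (1 - x))
        = \<i> * of_real pi ^ k * ((-1) ^ l / fact j * poly (cot_deriv_poly j) (- \<i> * cot (of_real (pi * x))))" .
    thus ?thesis by (simp only: Aw[symmetric] w_def[symmetric] x_def[symmetric])
  qed
  with A show ?thesis by (rule that)
qed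

section \<open>Okada's theorem: linear independence of the odd combinations\<close>

definition progression_sum :: "nat \<Rightarrow> nat \<Rightarrow> nat \<Rightarrow> real" where
  "progression_sum k m r = suminf (\<lambda>n. inverse (real (n * m + r) ^ k))"

lemma progression_sum:
  assumes "k \<ge> 2" "m > 0" "r > 0"
  shows "summable (\<lambda>n. inverse (real (n * m + r) ^ k))"
    and "hurwitz_sum k (real r / real m) = real m ^ k * progression_sum k m r"
proof -
  have eq: "inverse (real (n * m + r) ^ k) = inverse (real m ^ k) * inverse ((real r / real m + real n) ^ k)" for n
  proof -
    have "real r / real m + real n = real (n * m + r) / real m"
      using assms(2) by (simp add: add_divide_distrib)
    thus ?thesis using assms(2) by (simp only: power_divide) (simp add: inverse_eq_divide)
  qed
  have sm: "summable (\<lambda>n. inverse ((real r / real m + real n) ^ k))"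
    using assms by (intro summable_hurwitz_sum) auto
  show "summable (\<lambda>n. inverse (real (n * m + r) ^ k))"
    unfolding eq by (rule summable_mult[OF sm])
  show "hurwitz_sum k (real r / real m) = real m ^ k * progression_sum k m r"
    unfolding progression_sum_def eq hurwitz_sum_def using assms(2) by (simp add: suminf_mult[OF sm])
qed

text \<open>1/N^3 is at most 1/(2 (N - 1) N), and these bounds telescope to at most 1/2 over N >=
  2.\<close>

lemma sum_inverse_powers_le:
  assumes "finite F" "\<And>N. N \<in> F \<Longrightarrow> N \<ge> 2" "k \<ge> 3"
  shows "(\<Sum>N\<in>F. inverse (real N ^ k)) \<le> 1 / 2"
proof -
  have tele: "(\<Sum>N\<in>{2..<M + 2}. inverse (real N ^ 3)) \<le> 1 / 2 * (1 - 1 / (real M + 1))" for M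
  proof (induction M)
    case (Suc M)
    have "{2..<Suc M + 2} = insert (M + 2) {2..<M + 2}" by auto
    hence "(\<Sum>N\<in>{2..<Suc M + 2}. inverse (real N ^ 3)) = inverse (real (M + 2) ^ 3) + (\<Sum>N\<in>{2..<M + 2}. inverse (real N ^ 3))"
      by simp
    also have "\<dots> \<le> 1 / (2 * (real M + 1) * (real M + 2)) + 1 / 2 * (1 - 1 / (real M + 1))"
    proof (intro add_mono Suc.IH)
      have "2 * (real M + 1) * (real M + 2) \<le> real (M + 2) ^ 3"
        by (simp add: power3_eq_cube algebra_simps)
      thus "inverse (real (M + 2) ^ 3) \<le> 1 / (2 * (real M + 1) * (real M + 2))"
        unfolding inverse_eq_divide by (intro divide_left_mono) auto
    qed
    also have "\<dots> = 1 / 2 * (1 - 1 / (real (Suc M) + 1))"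
    proof -
      have "1 / (2 * x * (x + 1)) + 1 / 2 * (1 - 1 / x) = 1 / 2 * (1 - 1 / (x + 1))" if "x > 0" for x :: real
      proof -
        have "1 / x - 1 / (x + 1) = 1 / (x * (x + 1))" using that by (simp add: diff_frac_eq)
        moreover have "1 / (2 * x * (x + 1)) = 1 / 2 * (1 / (x * (x + 1)))" by simp
        ultimately have "1 / (2 * x * (x + 1)) = 1 / 2 * (1 / x - 1 / (x + 1))" by (simp only:)
        thus ?thesis by (simp only: right_diff_distrib)
      qed
      from this[of "real M + 1"] have "1 / (2 * (real M + 1) * (real M + 1 + 1)) + 1 / 2 * (1 - 1 / (real M + 1))
          = 1 / 2 * (1 - 1 / (real M + 1 + 1))" by simp
      moreover have "real M + 1 + 1 = real M + 2" "real (Suc M) + 1 = real M + 2" by simp_all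
      ultimately show ?thesis by (simp only:)
    qed
    finally show ?case .
  qed simp
  obtain M where M: "F \<subseteq> {..<M}" using assms(1) finite_nat_bounded by blast
  have "(\<Sum>N\<in>F. inverse (real N ^ k)) \<le> (\<Sum>N\<in>F. inverse (real N ^ 3))"
  proof (rule sum_mono)
    fix N assume "N \<in> F"
    hence "real N \<ge> 1" using assms(2)[of N] by simp
    thus "inverse (real N ^ k) \<le> inverse (real N ^ 3)"
      using assms(3) by (intro le_imp_inverse_le power_increasing) auto
  qed
  also have "\<dots> \<le> (\<Sum>N\<in>{2..<M + 2}. inverse (real N ^ 3))"
    using M assms(2) by (intro sum_mono2) (auto simp: subset_iff less_Suc_eq)
  also have "\<dots> \<le> 1 / 2 * (1 - 1 / (real M + 1))" by (rule tele)
  also have "\<dots> \<le> 1 / 2" by simp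
  finally show ?thesis .
qed

text \<open>Distinct residues from 2 to m - 1 give disjoint progressions of integers that are all at
  least 2.\<close>

lemma sum_progression_sums_le:
  assumes "k \<ge> 3" "finite S" "\<And>r. r \<in> S \<Longrightarrow> 2 \<le> r \<and> r < m"
  shows "(\<Sum>r\<in>S. progression_sum k m r) \<le> 1 / 2"
proof (cases "S = {}")
  case False
  then obtain r0 where "r0 \<in> S" by blast
  hence m: "m > 0" using assms(3)[of r0] by simp
  have sm: "summable (\<lambda>n. inverse (real (n * m + r) ^ k))" if "r \<in> S" for r
    using assms(1) assms(3)[OF that] m by (intro progression_sum(1)) auto
  have "(\<Sum>r\<in>S. progression_sum k m r) = suminf (\<lambda>n. \<Sum>r\<in>S. inverse (real (n * m + r) ^ k))"
    unfolding progression_sum_def using sm by (rule suminf_sum[symmetric])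
  also have "\<dots> \<le> 1 / 2"
  proof (rule suminf_le_const)
    show "summable (\<lambda>n. \<Sum>r\<in>S. inverse (real (n * m + r) ^ k))"
      using sm by (rule summable_sum)
    fix L
    have inj: "inj_on (\<lambda>(n, r). n * m + r) ({..<L} \<times> S)"
    proof (rule inj_onI, clarify)
      fix n r n' r' assume *: "r \<in> S" "r' \<in> S" "n * m + r = n' * m + r'"
      have r: "r < m" "r' < m" using assms(3) * by auto
      have "(n * m + r) div m = (n' * m + r') div m" "(n * m + r) mod m = (n' * m + r') mod m"
        using *(3) by simp_all
      thus "n = n' \<and> r = r'" using r m by simp
    qed
    have "(\<Sum>n<L. \<Sum>r\<in>S. inverse (real (n * m + r) ^ k)) = (\<Sum>N\<in>(\<lambda>(n, r). n * m + r) ` ({..<L} \<times> S). inverse (real N ^ k))"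
      unfolding sum.cartesian_product sum.reindex[OF inj] by (intro sum.cong) auto
    also have "\<dots> \<le> 1 / 2"
      using assms by (intro sum_inverse_powers_le) (auto dest!: assms(3))
    finally show "(\<Sum>n<L. \<Sum>r\<in>S. inverse (real (n * m + r) ^ k)) \<le> 1 / 2" .
  qed
  finally show ?thesis .
qed simp

text \<open>For m > 2, representatives of the residues prime to m modulo sign.\<close>

definition half_residues :: "nat \<Rightarrow> nat set" where
  "half_residues m = {a. 0 < a \<and> 2 * a < m \<and> coprime a m}"

lemma finite_half_residues: "finite (half_residues m)"
  by (rule finite_subset[of _ "{..<m}"]) (auto simp: half_residues_def)

definition odd_difference :: "nat \<Rightarrow> nat \<Rightarrow> nat \<Rightarrow> real" where
  "odd_difference k m a = hurwitz_sum k (real a / real m) - hurwitz_sum k (1 - real a / real m)"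

lemma odd_difference_eq:
  assumes "k \<ge> 2" "0 < a" "a < m"
  shows "odd_difference k m a = real m ^ k * (progression_sum k m a - progression_sum k m (m - a))"
proof -
  have "1 - real a / real m = real (m - a) / real m" using assms by (simp add: field_simps of_nat_diff)
  thus ?thesis
    using assms progression_sum(2)[of k m a] progression_sum(2)[of k m "m - a"]
    by (simp only: odd_difference_def right_diff_distrib zero_less_diff)
qed

text \<open>Up to the factor m^k the value at 1 is s 1 - s (m - 1) with s 1 >= 1, and the value at h
  is at most s h. As m - 1 is a further residue, the s h and s (m - 1) together sum to at most 1/2,
  so s (m - 1) cancels in the comparison.\<close>

lemma odd_difference_dominant:
  assumes k: "k \<ge> 3" and m: "m > 2"
  shows "(\<Sum>h\<in>half_residues m - {1}. \<bar>odd_difference k m h\<bar>) < odd_difference k m 1"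
proof -
  define s where "s = progression_sum k m"
  have sm: "summable (\<lambda>n. inverse (real (n * m + r) ^ k))" if "r > 0" for r
    using progression_sum(1)[of k m r] that k m by simp
  have s0: "s r \<ge> 0" if "r > 0" for r
    unfolding s_def progression_sum_def using sm[OF that] by (intro suminf_nonneg) auto
  have s1: "s 1 \<ge> 1"
  proof -
    have "(\<Sum>n\<in>{0}. inverse (real (n * m + 1) ^ k)) \<le> s 1"
      unfolding s_def progression_sum_def by (rule sum_le_suminf[OF sm]) auto
    thus ?thesis by simp
  qed
  have le: "\<bar>odd_difference k m h\<bar> \<le> real m ^ k * s h" if h: "h \<in> half_residues m - {1}" for h
  proof -
    have h': "0 < h" "2 * h < m" using h by (auto simp: half_residues_def)
    have "s (m - h) \<le> s h"
      unfolding s_def progression_sum_def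
    proof (rule suminf_le)
      show "summable (\<lambda>n. inverse (real (n * m + h) ^ k))" by (rule sm) (use h' in auto)
      show "summable (\<lambda>n. inverse (real (n * m + (m - h)) ^ k))" by (rule sm) (use h' in auto)
      fix n show "inverse (real (n * m + (m - h)) ^ k) \<le> inverse (real (n * m + h) ^ k)"
        using h' by (intro le_imp_inverse_le power_mono) (auto intro!: zero_less_power add_nonneg_pos)
    qed
    moreover have "s (m - h) \<ge> 0" using h' by (intro s0) auto
    moreover have "odd_difference k m h = real m ^ k * (s h - s (m - h))"
      unfolding s_def using h' k by (intro odd_difference_eq) auto
    ultimately show ?thesis by (auto simp: abs_mult intro!: mult_left_mono)
  qed
  have "(\<Sum>h\<in>half_residues m - {1}. \<bar>odd_difference k m h\<bar>) \<le> real m ^ k * (\<Sum>h\<in>half_residues m - {1}. s h)"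
    unfolding sum_distrib_left using le by (rule sum_mono)
  also have "(\<Sum>h\<in>half_residues m - {1}. s h) \<le> 1 / 2 - s (m - 1)"
  proof -
    have "m - 1 \<notin> half_residues m - {1}" using m by (auto simp: half_residues_def)
    hence "s (m - 1) + (\<Sum>h\<in>half_residues m - {1}. s h) = (\<Sum>h\<in>insert (m - 1) (half_residues m - {1}). s h)"
      using finite_half_residues by (subst sum.insert) auto
    also have "\<dots> \<le> 1 / 2"
      unfolding s_def
    proof (rule sum_progression_sums_le[OF k])
      fix r assume "r \<in> insert (m - 1) (half_residues m - {1})"
      thus "2 \<le> r \<and> r < m" using m by (auto simp: half_residues_def)
    qed (use finite_half_residues in auto)
    finally show ?thesis by simp
  qed
  also have "real m ^ k * (1 / 2 - s (m - 1)) < real m ^ k * (s 1 - s (m - 1))"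
    using s1 m by (intro mult_strict_left_mono) auto
  also have "\<dots> = odd_difference k m 1"
    unfolding s_def using k m by (intro odd_difference_eq[symmetric]) auto
  finally show ?thesis using m by (simp add: mult_left_mono)
qed

section \<open>Multiplication on the residues modulo sign\<close>

lemma half_residue_cases:
  assumes m: "m > 2" and r: "coprime r m" "r < m"
  shows "(if 2 * r < m then r else m - r) \<in> half_residues m"
proof -
  have "r > 0" using r m by (intro Nat.gr0I) auto
  have "2 * r \<noteq> m"
  proof
    assume "2 * r = m"
    hence "r dvd 1" using r(1) by (metis coprime_common_divisor dvd_refl dvd_triv_right)
    thus False using \<open>2 * r = m\<close> m by simp
  qed
  moreover have "coprime (m - r) m" using r by (simp add: coprime_iff_gcd_eq_1 gcd_diff2_nat)
  ultimately show ?thesis using r \<open>r > 0\<close> by (auto simp: half_residues_def)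
qed

lemma totient_le_half_residues:
  assumes m: "m > 2"
  shows "totient m \<le> 2 * card (half_residues m)"
proof -
  have "totatives m \<subseteq> half_residues m \<union> (\<lambda>a. m - a) ` half_residues m"
  proof
    fix a assume "a \<in> totatives m"
    hence a: "a \<le> m" "coprime a m" by (auto simp: totatives_def)
    hence "a < m" using m by (cases "a = m") auto
    show "a \<in> half_residues m \<union> (\<lambda>a. m - a) ` half_residues m"
    proof (cases "2 * a < m")
      case True
      thus ?thesis using half_residue_cases[OF m a(2) \<open>a < m\<close>] by simp
    next
      case False
      hence "m - a \<in> half_residues m" using half_residue_cases[OF m a(2) \<open>a < m\<close>] by simp
      moreover have "a = m - (m - a)" using a(1) by simp
      ultimately show ?thesis by blast
    qed
  qed
  hence "totient m \<le> card (half_residues m \<union> (\<lambda>a. m - a) ` half_residues m)"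
    unfolding totient_def by (intro card_mono) (auto simp: finite_half_residues)
  also have "\<dots> \<le> card (half_residues m) + card ((\<lambda>a. m - a) ` half_residues m)"
    by (rule card_Un_le)
  also have "\<dots> \<le> 2 * card (half_residues m)"
    using card_image_le[OF finite_half_residues, of "\<lambda>a. m - a" m] by simp
  finally show ?thesis .
qed

text \<open>A unit b permutes the residues up to sign, which is enough because
  \<open>odd_difference\<close> only changes its sign when a becomes m - a.\<close>

lemma half_residue_reduction:
  assumes m: "m > 2" and b: "coprime b m"
  shows "\<exists>\<rho>. inj_on \<rho> (half_residues m) \<and> \<rho> ` half_residues m \<subseteq> half_residues m \<and>
    (\<forall>a\<in>half_residues m. \<rho> a = a * b mod m \<or> \<rho> a = m - a * b mod m)"
proof -
  define \<rho> where "\<rho> a = (if 2 * (a * b mod m) < m then a * b mod m else m - a * b mod m)" for a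
  have cop: "coprime (a * b mod m) m" if "a \<in> half_residues m" for a
  proof -
    have "coprime (a * b) m" using that b by (simp add: half_residues_def)
    thus ?thesis using m by (subst coprime_mod_left_iff) auto
  qed
  have \<rho>: "\<rho> a \<in> half_residues m" if a: "a \<in> half_residues m" for a
  proof -
    have "coprime (a * b mod m) m" "a * b mod m < m" using cop[OF a] m by auto
    from half_residue_cases[OF m this] show ?thesis by (simp add: \<rho>_def)
  qed
  have inj: "inj_on \<rho> (half_residues m)"
  proof (rule inj_onI)
    fix a a' assume a: "a \<in> half_residues m" "a' \<in> half_residues m" and eq: "\<rho> a = \<rho> a'"
    define r where "r = a * b mod m"
    define r' where "r' = a' * b mod m"
    have rm: "r < m" "r' < m" using m by (auto simp: r_def r'_def)
    have ir: "[int r = int a * int b] (mod int m)" "[int r' = int a' * int b] (mod int m)"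
      by (simp_all add: r_def r'_def zmod_int unique_euclidean_semiring_class.cong_def)
    have cb: "coprime (int m) (int b)" using b by (simp add: coprime_commute)
    from eq have "r = r' \<or> r + r' = m"
      unfolding \<rho>_def r_def[symmetric] r'_def[symmetric] using rm by (auto split: if_splits)
    thus "a = a'"
    proof
      assume "r = r'"
      hence "[int a * int b = int a' * int b] (mod int m)"
        by (intro cong_trans[OF cong_sym[OF ir(1)]]) (use ir(2) in simp)
      hence "int m dvd (int a - int a') * int b"
        by (simp add: cong_iff_dvd_diff left_diff_distrib)
      hence "int m dvd int a - int a'" using cb by (simp add: coprime_dvd_mult_left_iff)
      moreover have "\<bar>int a - int a'\<bar> < int m" using a by (auto simp: half_residues_def)
      ultimately show ?thesis using dvd_imp_le_int[of "int a - int a'" "int m"] by auto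
    next
      assume rr: "r + r' = m"
      have "[int r + int r' = int a * int b + int a' * int b] (mod int m)" by (rule cong_add[OF ir])
      hence "int m dvd (int a + int a') * int b"
      proof -
        assume "[int r + int r' = int a * int b + int a' * int b] (mod int m)"
        hence "int m dvd int r + int r' \<longleftrightarrow> int m dvd int a * int b + int a' * int b" by (rule cong_dvd_iff)
        moreover have "int r + int r' = int m" using rr by simp
        ultimately show ?thesis by (simp add: distrib_right)
      qed
      hence "int m dvd int a + int a'" using cb by (simp add: coprime_dvd_mult_left_iff)
      hence "m dvd a + a'" by (simp flip: of_nat_add)
      moreover have "0 < a + a'" "a + a' < m" using a by (auto simp: half_residues_def)
      ultimately show ?thesis by (auto dest: dvd_imp_le)
    qed
  qed
  show ?thesis
  proof (intro exI[of _ \<rho>] conjI ballI)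
    show "inj_on \<rho> (half_residues m)" by (rule inj)
    show "\<rho> ` half_residues m \<subseteq> half_residues m" using \<rho> by blast
    show "\<rho> a = a * b mod m \<or> \<rho> a = m - a * b mod m" for a by (simp add: \<rho>_def)
  qed
qed

theorem (in complex_subfield) odd_differences_independent:
  assumes ur: "\<And>p. prime p \<Longrightarrow> p dvd m \<Longrightarrow> unramified R p"
    and m: "m > 2" and k: "k \<ge> 3"
    and A: "A \<in> polys_over \<rat>" "\<And>a. 0 < a \<Longrightarrow> a < m \<Longrightarrow>
      of_real (odd_difference k m a) = \<i> * of_real pi ^ k * poly A (cis (2 * pi / real m) ^ a)"
    and c: "\<And>a. a \<in> half_residues m \<Longrightarrow> c a \<in> R"
      "(\<Sum>a\<in>half_residues m. c a * poly A (cis (2 * pi / real m) ^ a)) = 0"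
    and a: "a \<in> half_residues m"
  shows "c a = 0"
proof -
  define \<zeta> where "\<zeta> = cis (2 * pi / real m)"
  define H where "H = half_residues m"
  have fin: "finite H" unfolding H_def by (rule finite_half_residues)
  have prim: "primitive_root_of_unity m \<zeta>"
    unfolding \<zeta>_def using m by (intro primitive_root_of_unity_cis) simp
  have "Max ((\<lambda>a. norm (c a)) ` H) \<in> (\<lambda>a. norm (c a)) ` H"
    using fin a by (intro Max_in) (auto simp: H_def)
  then obtain a0 where a0H: "a0 \<in> H" and "Max ((\<lambda>a. norm (c a)) ` H) = norm (c a0)" by blast
  hence a0: "a0 \<in> H" "\<And>a. a \<in> H \<Longrightarrow> norm (c a) \<le> norm (c a0)"
    using fin Max_ge[of "(\<lambda>a. norm (c a)) ` H"] by auto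
  \<comment> \<open>Raising to the power b, the inverse of a0, moves the index of the largest
    coefficient to 1; the coefficients themselves lie in \<open>R\<close> and are not
    affected.\<close>
  obtain b where b: "[a0 * b = 1] (mod m)"
    using cong_solve_coprime_nat[of a0 m] a0(1) by (auto simp: H_def half_residues_def)
  have bm: "coprime b m"
  proof -
    have "coprime (a0 * b) m" using b by (metis cong_imp_coprime cong_sym coprime_1_left)
    thus ?thesis by simp
  qed
  define P where "P = (\<Sum>a\<in>H. smult (c a) (pcompose A (monom 1 a)))"
  have AR: "A \<in> polys_over R" using polys_over_mono[OF Rats_subset A(1)] .
  have PR: "P \<in> polys_over R"
    unfolding P_def using c(1) AR by (intro polys_over_sum polys_over_smult polys_over_pcompose) (auto simp: H_def)
  have polyP: "poly P z = (\<Sum>a\<in>H. c a * poly A (z ^ a))" for z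
    by (simp add: P_def poly_sum poly_pcompose poly_monom)
  have "poly P (\<zeta> ^ b) = 0"
    by (rule root_of_unity_conjugate[OF ur prim bm PR]) (use c(2) in \<open>auto simp: polyP H_def \<zeta>_def\<close>)
  hence rel: "(\<Sum>a\<in>H. c a * poly A (\<zeta> ^ (a * b))) = 0"
    by (simp add: polyP power_mult[symmetric] mult.commute)
  define Y where "Y a = \<i> * of_real pi ^ k * poly A (\<zeta> ^ (a * b))" for a
  have "(\<Sum>a\<in>H. c a * Y a) = \<i> * of_real pi ^ k * (\<Sum>a\<in>H. c a * poly A (\<zeta> ^ (a * b)))"
    by (simp add: Y_def sum_distrib_left mult_ac)
  hence relY: "(\<Sum>a\<in>H. c a * Y a) = 0" using rel by simp
  have Y: "Y a = of_real (odd_difference k m (a * b mod m))" if "a \<in> H" for a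
  proof -
    have "coprime (a * b) m" using that bm by (simp add: H_def half_residues_def)
    hence "coprime (a * b mod m) m" using m by (subst coprime_mod_left_iff) auto
    hence "a * b mod m > 0" using m by (intro Nat.gr0I) auto
    moreover have "a * b mod m < m" using m by simp
    moreover have "\<zeta> ^ (a * b) = \<zeta> ^ (a * b mod m)"
      by (rule primitive_root_power_cong[OF prim]) (simp add: unique_euclidean_semiring_class.cong_def)
    ultimately show ?thesis using A(2) by (simp add: Y_def \<zeta>_def)
  qed
  obtain \<rho> where \<rho>: "inj_on \<rho> H" "\<rho> ` H \<subseteq> H" "\<And>a. a \<in> H \<Longrightarrow> \<rho> a = a * b mod m \<or> \<rho> a = m - a * b mod m"
    using half_residue_reduction[OF m bm, folded H_def] by blast
  have H: "0 < a \<and> a < m \<and> 2 * a < m" if "a \<in> H" for a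
    using that by (simp add: H_def half_residues_def)
  have normY: "norm (Y a) = \<bar>odd_difference k m (\<rho> a)\<bar>" if "a \<in> H" for a
  proof -
    define r where "r = a * b mod m"
    have "\<rho> a \<in> H" using \<rho>(2) that by blast
    hence \<rho>H: "0 < \<rho> a" "\<rho> a < m" using H by blast+
    have "\<bar>odd_difference k m r\<bar> = \<bar>odd_difference k m (\<rho> a)\<bar>"
      using \<rho>(3)[OF that] unfolding r_def[symmetric]
    proof
      assume eq: "\<rho> a = m - r"
      have r: "0 < r" "r < m" using eq \<rho>H by auto
      have "odd_difference k m (\<rho> a) = - odd_difference k m r"
        using r k by (simp add: eq odd_difference_eq algebra_simps)
      thus ?thesis by simp
    qed simp
    thus ?thesis using Y[OF that] by (simp add: r_def)
  qed
  have Ya0: "Y a0 = of_real (odd_difference k m 1)"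
  proof -
    have "a0 * b mod m = 1" using b m by (simp add: unique_euclidean_semiring_class.cong_def)
    thus ?thesis using Y[OF a0(1)] by simp
  qed
  have \<rho>a0: "\<rho> a0 = 1"
  proof -
    have "a0 * b mod m = 1" using b m by (simp add: unique_euclidean_semiring_class.cong_def)
    moreover have "\<rho> a0 \<in> H" using \<rho>(2) a0(1) by blast
    hence "2 * \<rho> a0 < m" using H by blast
    hence "\<rho> a0 \<noteq> m - 1" using m by linarith
    ultimately show ?thesis using \<rho>(3)[OF a0(1)] by simp
  qed
  have dom: "(\<Sum>h\<in>H - {1}. \<bar>odd_difference k m h\<bar>) < odd_difference k m 1"
    unfolding H_def by (rule odd_difference_dominant[OF k m])
  have "c a0 * Y a0 = - (\<Sum>a\<in>H - {a0}. c a * Y a)"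
    using relY sum.remove[OF fin a0(1), of "\<lambda>a. c a * Y a"] by (simp add: eq_neg_iff_add_eq_0)
  hence "norm (c a0) * norm (Y a0) = norm (\<Sum>a\<in>H - {a0}. c a * Y a)"
    by (metis norm_minus_cancel norm_mult)
  also have "\<dots> \<le> (\<Sum>a\<in>H - {a0}. norm (c a0) * \<bar>odd_difference k m (\<rho> a)\<bar>)"
  proof (rule sum_norm_le)
    fix a assume "a \<in> H - {a0}"
    thus "norm (c a * Y a) \<le> norm (c a0) * \<bar>odd_difference k m (\<rho> a)\<bar>"
      using a0(2) normY by (auto simp: norm_mult intro!: mult_right_mono)
  qed
  also have "\<dots> = norm (c a0) * (\<Sum>h\<in>\<rho> ` (H - {a0}). \<bar>odd_difference k m h\<bar>)"
  proof -
    have "inj_on \<rho> (H - {a0})" by (rule inj_on_subset[OF \<rho>(1)]) auto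
    thus ?thesis by (simp add: sum.reindex sum_distrib_left)
  qed
  \<comment> \<open>As \<rho> is injective with \<rho> a0 = 1, the remaining indices are sent to
    distinct residues other than 1.\<close>
  also have "\<dots> \<le> norm (c a0) * (\<Sum>h\<in>H - {1}. \<bar>odd_difference k m h\<bar>)"
  proof (intro mult_left_mono sum_mono2)
    show "\<rho> ` (H - {a0}) \<subseteq> H - {1}"
    proof (rule image_subsetI)
      fix a assume a: "a \<in> H - {a0}"
      hence "\<rho> a \<noteq> 1" using inj_onD[OF \<rho>(1) _ _ a0(1), of a] \<rho>a0 by auto
      moreover have "\<rho> a \<in> H" by (rule subsetD[OF \<rho>(2) imageI]) (use a in simp)
      ultimately show "\<rho> a \<in> H - {1}" by simp
    qed
  qed (use fin in auto)
  finally have le: "norm (c a0) * odd_difference k m 1 \<le> norm (c a0) * (\<Sum>h\<in>H - {1}. \<bar>odd_difference k m h\<bar>)"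
  proof -
    assume *: "norm (c a0) * norm (Y a0) \<le> norm (c a0) * (\<Sum>h\<in>H - {1}. \<bar>odd_difference k m h\<bar>)"
    have "odd_difference k m 1 \<le> norm (Y a0)" unfolding Ya0 norm_of_real by simp
    hence "norm (c a0) * odd_difference k m 1 \<le> norm (c a0) * norm (Y a0)" by (intro mult_left_mono) auto
    with * show ?thesis by simp
  qed
  have "norm (c a0) = 0"
  proof (rule ccontr)
    assume "norm (c a0) \<noteq> 0"
    hence "norm (c a0) > 0" by simp
    from mult_strict_left_mono[OF dom this] le show False by simp
  qed
  thus ?thesis using a0(2)[of a] a by (simp add: H_def)
qed

section \<open>The value \<open>\<zeta>(k)\<close> as a combination of Hurwitz zeta values\<close>

text \<open>The zeta series without the Euler factors of the primes dividing m. Index 0 contributes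
  nothing for k > 0: it is coprime to m only for m = 1, and there the term is inverse 0 = 0.\<close>

definition coprime_sum :: "nat \<Rightarrow> nat \<Rightarrow> real" where
  "coprime_sum k m = suminf (\<lambda>n. if coprime n m then inverse (real n ^ k) else 0)"

lemma summable_coprime_sum:
  assumes "k \<ge> 2"
  shows "summable (\<lambda>n. if coprime n m then inverse (real n ^ k) else 0)"
proof (rule summable_comparison_test'[OF inverse_power_summable[OF assms]])
  fix n show "norm (if coprime n m then inverse (real n ^ k) else 0) \<le> inverse (real n ^ k)" by simp
qed

text \<open>The terms with index divisible by p form the same series scaled by p^(-k).\<close>

lemma coprime_sum_prime_mult:
  assumes k: "k \<ge> 2" and p: "prime p" and pm: "\<not> p dvd m"
  shows "coprime_sum k (p * m) = (1 - inverse (real p ^ k)) * coprime_sum k m"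
proof -
  define f where "f n = (if coprime n m then inverse (real n ^ k) else 0)" for n
  define g where "g n = (if coprime n (p * m) then inverse (real n ^ k) else 0)" for n
  define h where "h n = (if p dvd n then f n else 0)" for n
  have f: "f sums coprime_sum k m" and g: "g sums coprime_sum k (p * m)"
    unfolding f_def g_def coprime_sum_def by (rule summable_sums[OF summable_coprime_sum[OF k]])+
  have p0: "p > 0" using p by (rule prime_gt_0_nat)
  have cpm: "coprime p m" using p pm by (rule prime_imp_coprime_nat)
  have "(\<lambda>n. h (p * n)) = (\<lambda>n. inverse (real p ^ k) * f n)"
    using cpm by (auto simp: h_def f_def power_mult_distrib)
  moreover have "(\<lambda>n. inverse (real p ^ k) * f n) sums (inverse (real p ^ k) * coprime_sum k m)"
    by (rule sums_mult[OF f])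
  ultimately have "(\<lambda>n. h (p * n)) sums (inverse (real p ^ k) * coprime_sum k m)" by simp
  hence "h sums (inverse (real p ^ k) * coprime_sum k m)"
    using p0 by (subst (asm) sums_mono_reindex) (auto simp: strict_mono_def h_def image_iff dvd_def)
  from sums_diff[OF f this] have "(\<lambda>n. f n - h n) sums ((1 - inverse (real p ^ k)) * coprime_sum k m)"
    by (simp add: left_diff_distrib)
  moreover have "(\<lambda>n. f n - h n) = g"
  proof
    fix n
    have "coprime n p \<longleftrightarrow> \<not> p dvd n"
      using p by (metis coprime_commute prime_imp_coprime_nat coprime_absorb_left not_prime_unit)
    thus "f n - h n = g n" by (auto simp: f_def g_def h_def)
  qed
  ultimately show ?thesis using g sums_unique2 by simp
qed

text \<open>A new prime p brings the nonzero factor 1 - p^(-k), a repeated one changes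
  nothing.\<close>

lemma coprime_sum_rational_multiple:
  assumes k: "k \<ge> 2"
  shows "m > 0 \<Longrightarrow> \<exists>\<rho>\<in>\<rat>. \<rho> \<noteq> 0 \<and> coprime_sum k m = \<rho> * coprime_sum k 1"
proof (induction m rule: prime_divisors_induct)
  case (factor p m)
  hence m: "m > 0" by simp
  then obtain \<rho> where \<rho>: "\<rho> \<in> \<rat>" "\<rho> \<noteq> 0" "coprime_sum k m = \<rho> * coprime_sum k 1" using factor by auto
  show ?case
  proof (cases "p dvd m")
    case True
    have "coprime n (p * m) \<longleftrightarrow> coprime n m" for n
      using True by (metis coprime_divisors coprime_mult_right_iff dvd_refl)
    hence "coprime_sum k (p * m) = coprime_sum k m" by (simp add: coprime_sum_def)
    thus ?thesis using \<rho> by auto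
  next
    case False
    have "real p ^ k > 1" using factor(1) k by (intro one_less_power) (auto dest: prime_gt_1_nat)
    hence "1 - inverse (real p ^ k) \<noteq> 0" by (auto simp: field_simps)
    moreover have "1 - inverse (real p ^ k) \<in> \<rat>" by (intro Rats_diff Rats_inverse Rats_power) auto
    ultimately show ?thesis
      using \<rho> coprime_sum_prime_mult[OF k factor(1) False] by (intro bexI[of _ "(1 - inverse (real p ^ k)) * \<rho>"]) auto
  qed
qed (auto intro: bexI[of _ 1])

lemma coprime_sum_one:
  assumes "k \<ge> 2"
  shows "coprime_sum k 1 = hurwitz_sum k 1"
proof -
  have "summable (\<lambda>n. inverse (real n ^ k))" by (rule inverse_power_summable[OF assms])
  from suminf_split_head[OF this] show ?thesis
    using assms by (simp add: coprime_sum_def hurwitz_sum_def power_0_left add.commute)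
qed

lemma sum_progression_sums_coprime:
  assumes k: "k \<ge> 2" and m: "m > 1"
  shows "(\<Sum>r | 0 < r \<and> r < m \<and> coprime r m. progression_sum k m r) = coprime_sum k m"
proof -
  define f where "f n = (if coprime n m then inverse (real n ^ k) else 0)" for n
  have "f sums coprime_sum k m"
    unfolding f_def coprime_sum_def using summable_coprime_sum[OF k] by (rule summable_sums)
  hence "(\<lambda>n. sum f {n * m ..< n * m + m}) sums coprime_sum k m" using m by (intro sums_group) auto
  moreover have "sum f {n * m ..< n * m + m} = (\<Sum>r | 0 < r \<and> r < m \<and> coprime r m. inverse (real (n * m + r) ^ k))" for n
  proof -
    have "sum f {n * m ..< n * m + m} = (\<Sum>r\<in>{0..<m}. f (n * m + r))"
      using sum.shift_bounds_nat_ivl[of f 0 "n * m" m] by (simp add: add.commute)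
    also have "\<dots> = (\<Sum>r | 0 < r \<and> r < m \<and> coprime r m. inverse (real (n * m + r) ^ k))"
    proof (rule sum.mono_neutral_cong_right)
      have cop: "coprime (n * m + r) m \<longleftrightarrow> coprime r m" for r
        by (metis coprime_iff_gcd_eq_1 gcd.commute gcd_add_mult)
      show "\<forall>r\<in>{0..<m} - {r. 0 < r \<and> r < m \<and> coprime r m}. f (n * m + r) = 0"
        using m by (auto simp: f_def cop)
      show "f (n * m + r) = inverse (real (n * m + r) ^ k)" if "r \<in> {r. 0 < r \<and> r < m \<and> coprime r m}" for r
        using that by (simp add: f_def cop)
    qed auto
    finally show ?thesis .
  qed
  ultimately have "(\<lambda>n. \<Sum>r | 0 < r \<and> r < m \<and> coprime r m. inverse (real (n * m + r) ^ k)) sums coprime_sum k m" by simp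
  moreover have "(\<lambda>n. \<Sum>r | 0 < r \<and> r < m \<and> coprime r m. inverse (real (n * m + r) ^ k)) sums
      (\<Sum>r | 0 < r \<and> r < m \<and> coprime r m. progression_sum k m r)"
    unfolding progression_sum_def
    using progression_sum(1)[OF k] m by (intro sums_sum summable_sums) auto
  ultimately show ?thesis using sums_unique2 by blast
qed

text \<open>Places zeta(k) in the rational span of the Hurwitz values for every conductor, so that
  the spaces for q and r share it.\<close>

lemma riemann_zeta_combination:
  assumes k: "k \<ge> 2" and m: "m > 1"
  obtains \<rho> :: real where "\<rho> \<in> \<rat>" "hurwitz_sum k 1 = \<rho> * (\<Sum>r | 0 < r \<and> r < m \<and> coprime r m. hurwitz_sum k (real r / real m))"
proof -
  obtain \<rho> where \<rho>: "\<rho> \<in> \<rat>" "\<rho> \<noteq> 0" "coprime_sum k m = \<rho> * coprime_sum k 1"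
    using coprime_sum_rational_multiple[OF k, of m] m by auto
  have "(\<Sum>r | 0 < r \<and> r < m \<and> coprime r m. hurwitz_sum k (real r / real m))
      = real m ^ k * (\<Sum>r | 0 < r \<and> r < m \<and> coprime r m. progression_sum k m r)"
    unfolding sum_distrib_left using k m by (intro sum.cong refl progression_sum(2)) auto
  also have "\<dots> = real m ^ k * \<rho> * hurwitz_sum k 1"
    using sum_progression_sums_coprime[OF k m] \<rho>(3) coprime_sum_one[OF k] by simp
  finally have S: "(\<Sum>r | 0 < r \<and> r < m \<and> coprime r m. hurwitz_sum k (real r / real m)) = real m ^ k * \<rho> * hurwitz_sum k 1" .
  have nz: "real m ^ k * \<rho> \<noteq> 0" using \<rho>(2) m by simp
  have cancel: "y = inverse x * (x * y)" if "x \<noteq> 0" for x y :: real using that by simp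
  have "hurwitz_sum k 1 = inverse (real m ^ k * \<rho>) * (\<Sum>r | 0 < r \<and> r < m \<and> coprime r m. hurwitz_sum k (real r / real m))"
    unfolding S by (rule cancel[OF nz])
  moreover have "inverse (real m ^ k * \<rho>) \<in> \<rat>" using \<rho>(1) by (intro Rats_inverse Rats_mult Rats_power) auto
  ultimately show ?thesis using that by blast
qed

section \<open>Relations forced by a small dimension\<close>

lemma chowla_milnor_relation:
  assumes K: "number_field K"
    and ur: "\<And>p. prime p \<Longrightarrow> p dvd m \<Longrightarrow> unramified K p"
    and k: "odd k" "k > 1" and m: "m > 2"
    and dim: "real (ring.dim complex_field K (chowla_milnor_space k m K)) < real (totient m) / 2 + 2"
  obtains c0 c1 B where "c0 \<in> K" "c1 \<in> K" "(c0, c1) \<noteq> (0, 0)" "B \<in> polys_over K"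
    "c0 + c1 * of_real (hurwitz_sum k 1) = \<i> * of_real pi ^ k * poly B (cis (2 * pi / real m))"
proof -
  interpret K: complex_subfield K by (rule number_field_subfield[OF K])
  have sf: "subfield K complex_field" using K by (simp add: number_field_def)
  have k2: "k \<ge> 2" using k by simp
  have k3: "k \<ge> 3" using k by (cases "k = 2") auto
  have m0: "m > 0" using m by simp
  obtain A where A: "A \<in> polys_over \<rat>" "\<And>a. 0 < a \<Longrightarrow> a < m \<Longrightarrow>
      of_real (odd_difference k m a) = \<i> * of_real pi ^ k * poly A (cis (2 * pi / real m) ^ a)"
    using hurwitz_zeta_odd_difference[OF k m0, folded odd_difference_def] by blast
  define \<zeta> where "\<zeta> = cis (2 * pi / real m)"
  define H where "H = half_residues m"
  define hs where "hs = sorted_list_of_set H"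
  define Z where "Z = complex_of_real (hurwitz_sum k 1)"
  define y where "y a = complex_of_real (odd_difference k m a)" for a
  define hz where "hz a = complex_of_real (hurwitz_sum k (real a / real m))" for a
  define Vs where "Vs = 1 # map (\<lambda>a. hurwitz_zeta (of_nat k) (real a / real m)) (filter (\<lambda>a. coprime a m) [1..<m])"
  define Us where "Us = 1 # Z # map y hs"
  define V where "V = CF.Span K Vs"
  have V: "chowla_milnor_space k m K = V" by (simp add: chowla_milnor_space_def V_def Vs_def)
  have fin: "finite H" unfolding H_def by (rule finite_half_residues)
  have hs: "distinct hs" "set hs = H" "length hs = card H" using fin by (simp_all add: hs_def)
  have carr: "set Vs \<subseteq> carrier complex_field" by simp
  have base: "set Vs \<subseteq> V" unfolding V_def by (rule CF.Span_base_incl[OF sf carr])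
  have one: "1 \<in> V" using base by (simp add: Vs_def)
  have hz: "hz a \<in> V" if "0 < a" "a < m" "coprime a m" for a
  proof -
    have "hurwitz_zeta (of_nat k) (real a / real m) = hz a"
      unfolding hz_def using that k2 by (intro hurwitz_zeta_of_nat) auto
    moreover have "hurwitz_zeta (of_nat k) (real a / real m) \<in> set Vs" using that by (auto simp: Vs_def)
    ultimately show ?thesis using base by auto
  qed
  have zero: "0 \<in> V" using CF.Span_subgroup_props(2)[OF sf carr] by (simp add: V_def)
  have add: "u + v \<in> V" if "u \<in> V" "v \<in> V" for u v
    using CF.Span_subgroup_props(3)[OF sf carr, of u v] that by (simp add: V_def)
  have smult: "c * v \<in> V" if "c \<in> K" "v \<in> V" for c v
    using CF.Span_smult_closed[OF sf carr, of c v] that by (simp add: V_def)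
  have diff: "u - v \<in> V" if "u \<in> V" "v \<in> V" for u v
    using add[OF that(1) smult[OF K.uminus_closed[OF K.one_closed] that(2)]] by simp
  have sum: "finite S \<Longrightarrow> (\<And>a. a \<in> S \<Longrightarrow> f a \<in> V) \<Longrightarrow> sum f S \<in> V" for f :: "nat \<Rightarrow> complex" and S
    by (induction S rule: finite_induct) (auto simp: zero add)
  have "Z \<in> V"
  proof -
    obtain \<rho> where \<rho>: "\<rho> \<in> \<rat>" "hurwitz_sum k 1 = \<rho> * (\<Sum>r | 0 < r \<and> r < m \<and> coprime r m. hurwitz_sum k (real r / real m))"
      using riemann_zeta_combination[OF k2, of m] m by auto
    have "of_real \<rho> \<in> K" using \<rho>(1) K.Rats_subset by (auto elim!: Rats_cases')
    moreover have "(\<Sum>r | 0 < r \<and> r < m \<and> coprime r m. hz r) \<in> V" by (intro sum hz) auto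
    ultimately have "of_real \<rho> * (\<Sum>r | 0 < r \<and> r < m \<and> coprime r m. hz r) \<in> V" by (rule smult)
    thus ?thesis by (simp add: Z_def \<rho>(2) hz_def)
  qed
  have y: "y a \<in> V" if "a \<in> H" for a
  proof -
    have a: "0 < a" "2 * a < m" "coprime a m" using that by (auto simp: H_def half_residues_def)
    have "coprime (m - a) m" using a by (simp add: coprime_iff_gcd_eq_1 gcd_diff2_nat)
    hence "hz a - hz (m - a) \<in> V" using a by (intro diff hz) auto
    moreover have "1 - real a / real m = real (m - a) / real m"
      using a by (simp add: of_nat_diff diff_divide_distrib)
    ultimately show ?thesis by (simp add: y_def odd_difference_def hz_def)
  qed
  have UsV: "set Us \<subseteq> V" using one \<open>Z \<in> V\<close> y hs(2) by (auto simp: Us_def)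
  have fd: "CF.finite_dimension K V" unfolding V_def by (rule CF.Span_finite_dimension[OF sf carr])
  have dm: "CF.dimension (CF.dim K V) K V" using CF.finite_dimensionE[OF sf fd] by (simp add: over_def)
  have "\<not> CF.independent K Us"
  proof
    assume "CF.independent K Us"
    hence "length Us \<le> CF.dim K V" by (rule CF.independent_length_le_dimension[OF sf dm _ UsV])
    \<comment> \<open>As phi(m) is at most 2 \<open>card H\<close>, the assumption on the dimension
      gives less than card H + 2.\<close>
    moreover have "length Us = card H + 2" by (simp add: Us_def hs(3))
    moreover have "totient m \<le> 2 * card H" unfolding H_def by (rule totient_le_half_residues[OF m])
    ultimately show False using dim unfolding V by linarith
  qed
  hence "\<exists>c. (\<forall>i<length Us. c i \<in> K) \<and> (\<Sum>i<length Us. c i * Us ! i) = 0 \<and> \<not> (\<forall>i<length Us. c i = 0)"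
    using trivial_sum_imp_independent[OF sf, of Us] by blast
  then obtain c where c: "\<And>i. i < length Us \<Longrightarrow> c i \<in> K" "(\<Sum>i<length Us. c i * Us ! i) = 0"
    "\<not> (\<forall>i<length Us. c i = 0)" by blast
  have len: "length Us = Suc (Suc (length hs))" by (simp add: Us_def)
  have bij: "bij_betw ((!) hs) {..<length hs} H" by (rule bij_betw_nth) (use hs in auto)
  \<comment> \<open>Coefficients indexed by residues instead of list positions; the shift by 2 skips
    \<open>1\<close> and \<open>Z\<close>.\<close>
  define d where "d a = c (Suc (Suc (inv_into {..<length hs} ((!) hs) a)))" for a
  have d_nth: "d (hs ! i) = c (Suc (Suc i))" if "i < length hs" for i
    using bij_betw_inv_into_left[OF bij, of i] that by (simp add: d_def)
  have dK: "d a \<in> K" if a: "a \<in> H" for a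
  proof -
    obtain i where "i < length hs" "hs ! i = a" using a unfolding hs(2)[symmetric] in_set_conv_nth by blast
    thus ?thesis using d_nth[of i] c(1)[of "Suc (Suc i)"] by (simp add: len)
  qed
  have "(\<Sum>a\<in>H. d a * y a) = (\<Sum>i<length hs. d (hs ! i) * y (hs ! i))"
    by (rule sum.reindex_bij_betw[OF bij, symmetric])
  also have "\<dots> = (\<Sum>i<length hs. c (Suc (Suc i)) * Us ! Suc (Suc i))"
    by (intro sum.cong refl) (simp add: d_nth Us_def)
  finally have rel: "c 0 + c 1 * Z + (\<Sum>a\<in>H. d a * y a) = 0"
    using c(2) unfolding len by (simp add: sum.lessThan_Suc_shift Us_def add.assoc del: sum.lessThan_Suc)
  define S where "S = (\<Sum>a\<in>H. d a * poly A (\<zeta> ^ a))"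
  have "(\<Sum>a\<in>H. d a * y a) = \<i> * of_real pi ^ k * S"
    unfolding S_def sum_distrib_left
  proof (rule sum.cong)
    fix a assume "a \<in> H"
    hence "y a = \<i> * of_real pi ^ k * poly A (\<zeta> ^ a)"
      unfolding y_def \<zeta>_def by (intro A(2)) (auto simp: H_def half_residues_def)
    thus "d a * y a = \<i> * of_real pi ^ k * (d a * poly A (\<zeta> ^ a))" by simp
  qed simp
  with rel have rel': "c 0 + c 1 * Z = - (\<i> * of_real pi ^ k * S)" by (simp add: eq_neg_iff_add_eq_0)
  define B where "B = (\<Sum>a\<in>H. smult (- d a) (pcompose A (monom 1 a)))"
  have AK: "A \<in> polys_over K" by (rule polys_over_mono[OF K.Rats_subset A(1)])
  have "B \<in> polys_over K"
    unfolding B_def using dK AK by (intro K.polys_over_sum K.polys_over_smult K.polys_over_pcompose) auto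
  moreover have "poly B \<zeta> = - S"
    by (simp add: B_def S_def poly_sum poly_pcompose poly_monom sum_negf)
  \<comment> \<open>With both zero the relation would involve the odd differences alone, against
    their independence.\<close>
  moreover have "(c 0, c 1) \<noteq> (0, 0)"
  proof
    assume c01: "(c 0, c 1) = (0, 0)"
    hence "S = 0" using rel' by simp
    have d0: "d a = 0" if "a \<in> H" for a
      using K.odd_differences_independent[OF ur m k3 A, of d a] dK \<open>S = 0\<close> that
      by (simp add: S_def H_def \<zeta>_def)
    have "c i = 0" if i: "i < length Us" for i
    proof -
      consider "i = 0" | "i = 1" | j where "i = Suc (Suc j)" "j < length hs"
        using i len by (cases i; cases "i - 1") auto
      thus ?thesis
      proof cases
        case 3
        hence "hs ! j \<in> H" using hs(2) nth_mem by blast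
        thus ?thesis using d0[of "hs ! j"] d_nth[of j] 3 by simp
      qed (use c01 in auto)
    qed
    thus False using c(3) by blast
  qed
  ultimately show ?thesis
    using rel' c(1)[of 0] c(1)[of 1] by (intro that[of "c 0" "c 1" B]) (auto simp: len Z_def \<zeta>_def)
qed

section \<open>Comparison of the two conductors\<close>

lemma algebraic_of_power: "algebraic (x ^ n) \<Longrightarrow> n > 0 \<Longrightarrow> algebraic (x :: complex)"
  by (rule algebraic_root[of "x ^ n" "monom 1 n"]) (auto simp: poly_monom degree_monom_eq)

text \<open>Otherwise pi^k = u/(i v) would be algebraic.\<close>

lemma algebraic_relation_with_pi_power:
  assumes "algebraic u" "algebraic v" "u = \<i> * of_real pi ^ k * v" "k > 0"
  shows "u = 0"
proof (rule ccontr)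
  assume "u \<noteq> 0"
  hence v: "v \<noteq> 0" using assms(3) by auto
  have "of_real pi ^ k = u / (\<i> * v)" using assms(3) v by simp
  moreover have "u / (\<i> * v) \<in> {x. algebraic x}"
    using assms(1,2) algebraic_int_imp_algebraic[OF algebraic_int_ii]
    by (intro Alg.divide_closed Alg.mult_closed) auto
  ultimately have "algebraic (of_real pi ^ k :: complex)" by simp
  hence "algebraic (of_real pi :: complex)" using assms(4) by (rule algebraic_of_power)
  thus False using transcendental_pi by contradiction
qed

lemma proportional_pairs:
  fixes c0 c1 d0 d1 :: complex
  assumes "complex_subfield K" "c0 \<in> K" "c1 \<in> K" "d0 \<in> K" "d1 \<in> K"
    and "(d0, d1) \<noteq> (0, 0)" "c0 * d1 = c1 * d0"
  obtains \<mu> where "\<mu> \<in> K" "c0 = \<mu> * d0" "c1 = \<mu> * d1"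
proof -
  interpret complex_subfield K by fact
  show ?thesis
  proof (cases "d0 = 0")
    case True
    hence "d1 \<noteq> 0" "c0 = 0" using assms(6,7) by auto
    thus ?thesis using True assms by (intro that[of "c1 / d1"]) auto
  next
    case False
    hence "c1 = c0 / d0 * d1" using assms(7) by simp
    thus ?thesis using False assms by (intro that[of "c0 / d0"]) auto
  qed
qed

lemma (in complex_subfield) coprime_conductors_real:
  assumes real: "R \<subseteq> \<real>" and cop: "coprime q r" and q: "q > 0" and r: "r > 0"
    and ur: "\<And>p. prime p \<Longrightarrow> p dvd q * r \<Longrightarrow> unramified R p"
    and B: "B \<in> polys_over R" and D: "D \<in> polys_over R"
    and eq: "poly B (cis (2 * pi / real q)) = poly D (cis (2 * pi / real r))"
  shows "poly B (cis (2 * pi / real q)) \<in> \<real>"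
proof -
  define \<zeta> where "\<zeta> = cis (2 * pi / real (q * r))"
  define \<zeta>q where "\<zeta>q = cis (2 * pi / real q)"
  define \<zeta>r where "\<zeta>r = cis (2 * pi / real r)"
  have \<zeta>q: "\<zeta> ^ r = \<zeta>q" and \<zeta>r: "\<zeta> ^ q = \<zeta>r"
    using q r by (simp_all add: \<zeta>_def \<zeta>q_def \<zeta>r_def Complex.DeMoivre)
  have prim: "primitive_root_of_unity (q * r) \<zeta>" "primitive_root_of_unity q \<zeta>q" "primitive_root_of_unity r \<zeta>r"
    unfolding \<zeta>_def \<zeta>q_def \<zeta>r_def using q r by (intro primitive_root_of_unity_cis; simp)+
  \<comment> \<open>q - 1 stands for -1: the power b inverts the q-th root of unity and fixes the
    r-th one.\<close>
  obtain b where b: "[b = q - 1] (mod q)" "[b = 1] (mod r)"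
    using binary_chinese_remainder_nat[OF cop] by blast
  have "coprime b (q * r)"
  proof -
    have "coprime (q - 1) q" using q coprime_Suc_left_nat[of "q - 1"] by (simp add: coprime_commute)
    hence "coprime b q" by (rule cong_imp_coprime[OF cong_sym[OF b(1)]])
    moreover have "coprime b r" by (rule cong_imp_coprime[OF cong_sym[OF b(2)]]) simp
    ultimately show ?thesis by simp
  qed
  have bq: "\<zeta>q ^ b = cnj \<zeta>q"
  proof -
    have "\<zeta>q ^ b * \<zeta>q = \<zeta>q ^ (q - 1) * \<zeta>q" using primitive_root_power_cong[OF prim(2) b(1)] by simp
    also have "\<dots> = \<zeta>q ^ Suc (q - 1)" by simp
    also have "\<dots> = 1" using primitive_root_power_order[OF prim(2)] q by simp
    also have "\<dots> = cnj \<zeta>q * \<zeta>q" by (simp add: \<zeta>q_def cis_cnj cis_mult)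
    finally show ?thesis using primitive_root_nonzero[OF prim(2)] by simp
  qed
  have br: "\<zeta>r ^ b = \<zeta>r" using primitive_root_power_cong[OF prim(3) b(2)] by simp
  \<comment> \<open>The equality of the two values becomes a zero at the primitive (q r)-th root of
    unity, whose powers r and q are \<open>\<zeta>q\<close> and \<open>\<zeta>r\<close>.\<close>
  define P where "P = pcompose B (monom 1 r) - pcompose D (monom 1 q)"
  have P: "P \<in> polys_over R"
    unfolding P_def using B D by (intro polys_over_diff polys_over_pcompose) auto
  have polyP: "poly P z = poly B (z ^ r) - poly D (z ^ q)" for z
    by (simp add: P_def poly_pcompose poly_monom)
  have "poly P \<zeta> = 0" using eq by (simp add: polyP \<zeta>q \<zeta>r) (simp add: \<zeta>q_def \<zeta>r_def)
  have "poly P (\<zeta> ^ b) = 0"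
    by (rule root_of_unity_conjugate[OF ur prim(1) \<open>coprime b (q * r)\<close> P \<open>poly P \<zeta> = 0\<close>])
  moreover have "(\<zeta> ^ b) ^ r = cnj \<zeta>q" "(\<zeta> ^ b) ^ q = \<zeta>r"
    using bq br by (simp_all add: power_commutes power_mult[symmetric] mult.commute[of b] power_mult[of _ _ b] \<zeta>q \<zeta>r)
  ultimately have "poly B (cnj \<zeta>q) = poly B \<zeta>q" using eq by (simp add: polyP \<zeta>q_def \<zeta>r_def)
  moreover have "cnj (poly B \<zeta>q) = poly B (cnj \<zeta>q)"
    by (rule poly_cnj_real) (use real B in \<open>auto simp: polys_over_def\<close>)
  ultimately show ?thesis by (simp add: complex_is_Real_iff complex_eq_iff \<zeta>q_def)
qed

theorem theorem3p5:
  fixes k q r :: nat and K :: "complex set"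
  assumes "k > 1" and "odd k"
    and "q > 2" and "r > 2" and "coprime q r"
    and "number_field K" and "K \<subseteq> \<real>"
    and "coprime (number_field_discriminant K) (int (q * r))"
    and "riemann_zeta (of_nat k) \<notin> K"
  shows "real (ring.dim complex_field K (chowla_milnor_space k q K)) \<ge> real (totient q) / 2 + 2 \<or>
         real (ring.dim complex_field K (chowla_milnor_space k r K)) \<ge> real (totient r) / 2 + 2"
proof (rule ccontr)
  assume "\<not> ?thesis"
  hence dim: "real (ring.dim complex_field K (chowla_milnor_space k q K)) < real (totient q) / 2 + 2"
    "real (ring.dim complex_field K (chowla_milnor_space k r K)) < real (totient r) / 2 + 2" by auto
  interpret K: complex_subfield K by (rule number_field_subfield[OF assms(6)])
  have ur: "unramified K p" if p: "prime p" "p dvd q * r" for p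
  proof (rule unramified_of_not_dvd_discriminant[OF assms(6) p(1)])
    show "\<not> int p dvd number_field_discriminant K"
    proof
      assume "int p dvd number_field_discriminant K"
      moreover have "int p dvd int (q * r)" using p(2) by (simp only: of_nat_dvd_iff)
      ultimately have "is_unit (int p)" by (rule coprime_common_divisor[OF assms(8)])
      thus False using prime_gt_1_nat[OF p(1)] by simp
    qed
  qed
  define z where "z = complex_of_real (hurwitz_sum k 1)"
  have z: "z \<notin> K" using assms(9) hurwitz_zeta_of_nat[of 1 k] assms(1) by (simp add: z_def riemann_zeta_def)
  define w where "w = \<i> * complex_of_real pi ^ k"
  define \<beta> where "\<beta> B m = poly B (cis (2 * pi / real m))" for B and m :: nat
  obtain c0 c1 B where c: "c0 \<in> K" "c1 \<in> K" "(c0, c1) \<noteq> (0, 0)" "B \<in> polys_over K" "c0 + c1 * z = w * \<beta> B q"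
    unfolding z_def w_def \<beta>_def
    by (rule chowla_milnor_relation[OF assms(6) _ assms(2,1,3) dim(1)]) (use ur in auto)
  obtain d0 d1 D where d: "d0 \<in> K" "d1 \<in> K" "(d0, d1) \<noteq> (0, 0)" "D \<in> polys_over K" "d0 + d1 * z = w * \<beta> D r"
    unfolding z_def w_def \<beta>_def
    by (rule chowla_milnor_relation[OF assms(6) _ assms(2,1,4) dim(2)]) (use ur in auto)
  have alg: "algebraic x" if "x \<in> K" for x by (rule number_field_imp_algebraic[OF assms(6) that])
  have alg\<beta>: "algebraic (\<beta> P m)" if "P \<in> polys_over K" "m > 0" for P m
  proof -
    have "cis (2 * pi / real m) ^ m = 1"
      using primitive_root_power_order[OF primitive_root_of_unity_cis[OF that(2)]] .
    hence "algebraic (cis (2 * pi / real m) ^ m)" by simp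
    hence cis: "algebraic (cis (2 * pi / real m))"
      using that(2) by (rule algebraic_of_power)
    have "poly P (cis (2 * pi / real m)) \<in> {x. algebraic x}"
      by (rule Alg.poly_closed) (use that(1) alg cis in \<open>auto simp: polys_over_def\<close>)
    thus ?thesis by (simp add: \<beta>_def)
  qed
  have "c0 * d1 - c1 * d0 = 0"
  proof (rule algebraic_relation_with_pi_power)
    have "c0 * d1 - c1 * d0 \<in> K" using c d by (intro K.diff_closed K.mult_closed)
    thus "algebraic (c0 * d1 - c1 * d0)" by (rule alg)
    have "d1 * \<beta> B q - c1 * \<beta> D r \<in> {x. algebraic x}"
      using alg alg\<beta> c d assms(3,4) by (intro Alg.diff_closed Alg.mult_closed) auto
    thus "algebraic (d1 * \<beta> B q - c1 * \<beta> D r)" by simp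
    have "c0 * d1 - c1 * d0 = d1 * (c0 + c1 * z) - c1 * (d0 + d1 * z)" by (simp add: algebra_simps)
    also have "\<dots> = w * (d1 * \<beta> B q - c1 * \<beta> D r)" unfolding c(5) d(5) by (simp add: algebra_simps)
    finally show "c0 * d1 - c1 * d0 = \<i> * of_real pi ^ k * (d1 * \<beta> B q - c1 * \<beta> D r)" by (simp add: w_def)
  qed (use assms(1) in simp)
  hence "c0 * d1 = c1 * d0" by simp
  then obtain \<mu> where \<mu>: "\<mu> \<in> K" "c0 = \<mu> * d0" "c1 = \<mu> * d1"
    using proportional_pairs[OF K.complex_subfield_axioms c(1,2) d(1,2,3)] by blast
  have "w * \<beta> B q = \<mu> * (d0 + d1 * z)" unfolding c(5)[symmetric] \<mu>(2,3) by (simp add: algebra_simps)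
  also have "\<dots> = w * (\<mu> * \<beta> D r)" unfolding d(5) by simp
  \<comment> \<open>As \<mu> lies in K, it can be absorbed into the polynomial for the conductor
    r.\<close>
  finally have eq: "\<beta> B q = \<beta> (smult \<mu> D) r" by (simp add: w_def \<beta>_def)
  have "\<beta> B q \<in> \<real>"
    unfolding \<beta>_def
    by (rule K.coprime_conductors_real[OF assms(7,5) _ _ ur c(4) K.polys_over_smult[OF \<mu>(1) d(4)] eq[unfolded \<beta>_def]])
      (use assms(3,4) in auto)
  then obtain t where t: "\<beta> B q = complex_of_real t" by (elim Reals_cases)
  have "Re (w * \<beta> B q) = 0" by (simp add: w_def t flip: of_real_power)
  moreover have "c0 + c1 * z \<in> \<real>" using c(1,2) assms(7) by (auto simp: z_def intro!: Reals_add Reals_mult)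
  hence "Im (w * \<beta> B q) = 0" unfolding c(5) by (simp add: complex_is_Real_iff)
  ultimately have rel: "c0 + c1 * z = 0" unfolding c(5) by (simp add: complex_eq_iff)
  show False
  proof (cases "c1 = 0")
    case True
    thus False using rel c(3) by simp
  next
    case False
    have "c1 * z = - c0" using rel by (simp add: eq_neg_iff_add_eq_0 add.commute)
    moreover have "z = c1 * z / c1" using False by simp
    ultimately have "z = - c0 / c1" by simp
    hence "z \<in> K" using c(1,2) by (simp add: K.divide_closed K.uminus_closed)
    thus False using z by contradiction
  qed
qed

end
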